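(* Let $c>0$. Then there exists $C>0$ such that the following holds. Let $p=p(n)\in(2^{-0.9n},n^{-c})$, and let $V$ be formed by sampling each vertex of $\{0,1\}^n$ independently with probability $p$. Then with high probability the graph $G$ of $\mathrm{conv}(V)$ satisfies $h(G)\ge n^{C\log n}$.
   Context: The graph (1-skeleton) of a polytope has as vertices its 0-dimensional faces and as edges its 1-dimensional faces. For a graph $G$, $h(G)=\min\{|\partial(U)|/|U| : U\subseteq V(G),\ 1\le |U|\le |V(G)|/2\}$, where $\partial(U)$ is the set of edges with exactly one endpoint in $U$. "With high probability" means with probability tending to $1$ as $n\to\infty$. *)

theory Defs
  imports "HOL-Analysis.Analysis" "HOL-Analysis.Finite_Function_Topology" "HOL-Probability.Probability"
begin

text \<open>
  Since the dimension \<open>n\<close> tends to infinity inside the statement, \<open>\<real>\<^sup>n\<close> is realised as the subspace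
  of the finitely supported sequences \<^typ>\<open>nat \<Rightarrow>\<^sub>0 real\<close> supported on \<open>{..<n}\<close>.  This type is a
  \<^class>\<open>real_vector\<close>, so the library's \<open>convex hull\<close> and \<open>face_of\<close> apply to it.
\<close>

definition hypercube :: "nat \<Rightarrow> (nat \<Rightarrow>\<^sub>0 real) set" where
  "hypercube n = {x. Poly_Mapping.keys x \<subseteq> {..<n} \<and> (\<forall>i. Poly_Mapping.lookup x i \<in> {0, 1})}"

lemma bij_betw_keys_hypercube: "bij_betw Poly_Mapping.keys (hypercube n) (Pow {..<n})"
proof (rule bij_betwI')
  fix x y assume "x \<in> hypercube n" "y \<in> hypercube n"
  then have x: "\<And>i. Poly_Mapping.lookup x i = 0 \<or> Poly_Mapping.lookup x i = 1"
    and y: "\<And>i. Poly_Mapping.lookup y i = 0 \<or> Poly_Mapping.lookup y i = 1"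
    by (auto simp: hypercube_def)
  show "(Poly_Mapping.keys x = Poly_Mapping.keys y) = (x = y)"
  proof
    assume k: "Poly_Mapping.keys x = Poly_Mapping.keys y"
    show "x = y"
    proof (rule poly_mapping_eqI)
      fix i
      show "Poly_Mapping.lookup x i = Poly_Mapping.lookup y i"
        using x[of i] y[of i] k by (metis in_keys_iff zero_neq_one)
    qed
  qed simp
next
  fix x assume "x \<in> hypercube n"
  then show "Poly_Mapping.keys x \<in> Pow {..<n}"
    by (simp add: hypercube_def)
next
  fix K :: "nat set" assume K: "K \<in> Pow {..<n}"
  define x :: "nat \<Rightarrow>\<^sub>0 real" where "x = Abs_poly_mapping (\<lambda>i. if i \<in> K then 1 else 0)"
  have "finite K"
    using K finite_subset by auto
  then have l: "Poly_Mapping.lookup x = (\<lambda>i. if i \<in> K then 1 else 0)"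
    unfolding x_def by (subst lookup_Abs_poly_mapping) auto
  have "Poly_Mapping.keys x = K"
    by (auto simp: in_keys_iff l split: if_splits)
  moreover have "x \<in> hypercube n"
    using K calculation by (auto simp: hypercube_def l)
  ultimately show "\<exists>x\<in>hypercube n. K = Poly_Mapping.keys x"
    by blast
qed

lemma finite_hypercube: "finite (hypercube n)"
  using bij_betw_finite[OF bij_betw_keys_hypercube] by simp

lemma card_hypercube: "card (hypercube n) = 2 ^ n"
  using bij_betw_same_card[OF bij_betw_keys_hypercube] by (simp add: card_Pow)

definition random_vertices :: "nat \<Rightarrow> real \<Rightarrow> (nat \<Rightarrow>\<^sub>0 real) set pmf" where
  "random_vertices n q =
     map_pmf (\<lambda>s. {x \<in> hypercube n. s x})
       (Pi_pmf (hypercube n) False (\<lambda>_. bernoulli_pmf q))"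

text \<open>
  The library's \<^const>\<open>aff_dim\<close> is restricted to \<^class>\<open>euclidean_space\<close>; the following is its
  defining property, stated for arbitrary real vector spaces.
\<close>

definition has_aff_dim :: "'a::real_vector set \<Rightarrow> int \<Rightarrow> bool" where
  "has_aff_dim S d \<longleftrightarrow>
     (\<exists>B. finite B \<and> \<not> affine_dependent B \<and> affine hull B = affine hull S \<and> int (card B) = d + 1)"

lemma has_aff_dim_iff_aff_dim:
  fixes S :: "'a::euclidean_space set"
  shows "has_aff_dim S d \<longleftrightarrow> aff_dim S = d"
proof
  assume "has_aff_dim S d"
  then show "aff_dim S = d"
    unfolding has_aff_dim_def by (metis aff_dim_unique aff_dim_affine_hull2 add_diff_cancel_right')
next
  assume "aff_dim S = d"
  moreover obtain B where "affine hull B = affine hull S" "\<not> affine_dependent B"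
      "int (card B) = aff_dim S + 1"
    using aff_dim_basis_exists by blast
  ultimately show "has_aff_dim S d"
    unfolding has_aff_dim_def using aff_independent_finite by blast
qed

text \<open>
  A graph is given by a vertex set and a set of edges, an edge being the set of its endpoints.
  In the graph of a polytope the vertices are the faces of dimension 0 (as singleton sets), and a
  face of dimension 1 yields the edge consisting of the vertices that it contains.
\<close>

definition skeleton_verts :: "'a::real_vector set \<Rightarrow> 'a set set" where
  "skeleton_verts P = {F. F face_of P \<and> has_aff_dim F 0}"

definition skeleton_edges :: "'a::real_vector set \<Rightarrow> 'a set set set" where
  "skeleton_edges P = {{F \<in> skeleton_verts P. F \<subseteq> e} | e. e face_of P \<and> has_aff_dim e 1}"

definition edge_boundary :: "'v set set \<Rightarrow> 'v set \<Rightarrow> 'v set set" where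
  "edge_boundary E U = {e \<in> E. card (e \<inter> U) = 1}"

text \<open>For finite graphs; the minimum is over an empty set iff there are fewer than two vertices.\<close>

definition edge_expansion :: "'v set \<Rightarrow> 'v set set \<Rightarrow> real" where
  "edge_expansion V E =
     Min {real (card (edge_boundary E U)) / real (card U) | U.
            U \<subseteq> V \<and> 1 \<le> card U \<and> real (card U) \<le> real (card V) / 2}"

definition polytope_expansion :: "'a::real_vector set \<Rightarrow> real" where
  "polytope_expansion P = edge_expansion (skeleton_verts P) (skeleton_edges P)"

end

theory Submission
  imports Defs "HOL-Real_Asymp.Real_Asymp"
begin

text \<open>
  Identify the cube with the subsets of \<open>{..<n}\<close>. Two sampled points whose spanned subcube contains
  (almost) no further sampled point are adjacent in the polytope. Fix a set \<open>S\<close> of directions and let the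
  hub of a cube vertex \<open>z\<close> consist of the sampled points in \<open>z \<triangle> S\<close>. If \<open>p |S|\<close> is superpolynomial then,
  by union bounds over all \<open>z\<close>, every hub has about \<open>p |S|\<close> points, almost all pairs of points in equal or
  neighbouring hubs are adjacent, and every sampled point is adjacent to a fair share of its hubs.
  Given \<open>U\<close> with few boundary edges, most hubs meeting \<open>U\<close> are then almost contained in \<open>U\<close>, and these
  hubs make up at most about half of all hubs; by edge isoperimetry in the cube many of them have a
  neighbour that is not almost contained in \<open>U\<close>, and such a pair of hubs yields many boundary edges.

  For \<open>p \<le> 2 powr (- 20 sqrt n)\<close> the set \<open>S\<close> is a subcube with about \<open>p powr (- 11/10)\<close> elements; for larger
  \<open>p\<close> it consists of the sets whose size is a small multiple of \<open>log 2 (1 / p)\<close>.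
\<close>

section \<open>The cube as a group and its edge isoperimetry\<close>

text \<open>The union bounds call for failure probabilities like \<open>(1/2) ^ (4 * n)\<close>,
  while the obstructing configurations overlap heavily; their counts are therefore controlled by
  moments of order linear in \<open>n\<close>. Moments alone do not handle sampled points very close
  to a given point or, for spheres, to a hub centre, since one of them obstructs too large a share
  of the pairs. There are few such points, and a small set \<open>J\<close> of coordinates hits them
  all, so pairs that avoid \<open>J\<close> are safe. The two choices of \<open>S\<close> are
  complementary. Let l = log 2 (1 / p). Hubs in a subcube of dimension about 11/10 l have size about
  2 powr (l / 10), only polynomial in n when p is a power of n; and avoiding \<open>J\<close> costs
  a factor 2 ^ k with k about 7 n / l, affordable only if l is a large multiple of sqrt n. Sets of
  size r proportional to l give hubs of size n powr (const * log n), but r^2 has to be small against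
  n, so l may be at most of order sqrt n. The ranges meet at l = 20 sqrt n. At the other end, l <
  9/10 n lets the subcube fit into the cube, because 11/10 * 9/10 < 1.\<close>

definition symdiff :: "'a set \<Rightarrow> 'a set \<Rightarrow> 'a set" (infixl "\<triangle>" 70) where
  "x \<triangle> y = (x - y) \<union> (y - x)"

lemma in_symdiff_iff [simp]: "i \<in> x \<triangle> y \<longleftrightarrow> (i \<in> x) \<noteq> (i \<in> y)"
  by (auto simp: symdiff_def)

lemma symdiff_commute: "x \<triangle> y = y \<triangle> x"
  by auto

lemma symdiff_assoc: "(x \<triangle> y) \<triangle> z = x \<triangle> (y \<triangle> z)"
  by auto

lemma symdiff_left_commute: "x \<triangle> (y \<triangle> z) = y \<triangle> (x \<triangle> z)"
  by auto

lemmas symdiff_ac = symdiff_assoc symdiff_commute symdiff_left_commute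

lemma symdiff_empty [simp]: "x \<triangle> {} = x" "{} \<triangle> x = x"
  by auto

lemma symdiff_self [simp]: "x \<triangle> x = {}"
  by auto

lemma symdiff_cancel [simp]: "x \<triangle> (x \<triangle> y) = y"
  by auto

lemma symdiff_inj [simp]: "x \<triangle> y = x \<triangle> z \<longleftrightarrow> y = z"
  by (metis symdiff_cancel)

lemma symdiff_inj2 [simp]: "y \<triangle> x = z \<triangle> x \<longleftrightarrow> y = z"
  by (metis symdiff_cancel symdiff_commute)

lemma symdiff_eq_empty [simp]: "x \<triangle> y = {} \<longleftrightarrow> x = y"
  by (metis symdiff_cancel symdiff_self symdiff_empty(1))

lemma symdiff_eq_self [simp]: "x \<triangle> y = x \<longleftrightarrow> y = {}"
  by (metis symdiff_empty(1) symdiff_inj)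

lemma symdiff_Pow: "x \<in> Pow A \<Longrightarrow> y \<in> Pow A \<Longrightarrow> x \<triangle> y \<in> Pow A"
  by (auto simp: symdiff_def)

lemma card_symdiff_translate: "card {z. z \<triangle> x \<in> S} = card S"
proof -
  have "bij_betw (\<lambda>z. z \<triangle> x) {z. z \<triangle> x \<in> S} S"
    by (rule bij_betwI[where g = "\<lambda>z. z \<triangle> x"]) (auto simp: symdiff_assoc)
  then show ?thesis by (rule bij_betw_same_card)
qed

lemma sum_card_swap:
  assumes "finite A" "finite B"
  shows "(\<Sum>a\<in>A. card {b \<in> B. R a b}) = (\<Sum>b\<in>B. card {a \<in> A. R a b})"
proof -
  have "(\<Sum>a\<in>A. card {b \<in> B. R a b}) = (\<Sum>a\<in>A. \<Sum>b\<in>B. of_bool (R a b))"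
    using assms by (auto intro!: sum.cong simp: Int_def)
  also have "\<dots> = (\<Sum>b\<in>B. \<Sum>a\<in>A. of_bool (R a b))"
    by (rule sum.swap)
  also have "\<dots> = (\<Sum>b\<in>B. card {a \<in> A. R a b})"
    using assms by (auto intro!: sum.cong simp: Int_def)
  finally show ?thesis .
qed

text \<open>Induction on the dimension: the last coordinate splits \<open>Y\<close> into
  \<open>Y0\<close> and \<open>Y1\<close>, of sizes a and b in cubes of size M. The left side for
  \<open>Y\<close> is twice the sum of the left sides for the halves plus (a - b)^2, and the edges
  in the new direction, at least |a - b| of them, pay for (a - b)^2 \<le> M |a - b|. The product
  form lets the induction close and remains useful for sets larger than half of the cube, which
  occur below. Each boundary edge is counted once, from its end in \<open>Y\<close>.\<close>

theorem cube_edge_isoperimetry: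
  fixes Y :: "nat set set"
  assumes "Y \<subseteq> Pow {..<n}"
  shows "real (card Y) * (2 ^ n - real (card Y))
    \<le> 2 ^ n * real (card {(z, i). z \<in> Y \<and> i < n \<and> z \<triangle> {i} \<notin> Y})"
  using assms
proof (induction n arbitrary: Y)
  case 0
  then have "Y = {} \<or> Y = {{}}" by auto
  then show ?case by auto
next
  case (Suc n)
  define Y0 where "Y0 = {z \<in> Y. n \<notin> z}"
  define Y1 where "Y1 = {z. n \<notin> z \<and> insert n z \<in> Y}"
  define B where "B = {(z, i). z \<in> Y \<and> i < Suc n \<and> z \<triangle> {i} \<notin> Y}"
  define C0 where "C0 = {(z, i). z \<in> Y0 \<and> i < n \<and> z \<triangle> {i} \<notin> Y0}"
  define C1 where "C1 = {(z, i). z \<in> Y1 \<and> i < n \<and> z \<triangle> {i} \<notin> Y1}"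
  have finY: "finite Y"
    using Suc.prems finite_subset by blast
  have sub0: "Y0 \<subseteq> Pow {..<n}"
    using Suc.prems by (fastforce simp: Y0_def less_Suc_eq)
  have sub1: "Y1 \<subseteq> Pow {..<n}"
    using Suc.prems by (fastforce simp: Y1_def less_Suc_eq)
  have fin0: "finite Y0" and fin1: "finite Y1"
    using sub0 sub1 finite_subset by blast+
  have card_Y: "card Y = card Y0 + card Y1"
  proof -
    have "Y = Y0 \<union> insert n ` Y1"
    proof -
      have "y \<in> insert n ` Y1" if "y \<in> Y" "n \<in> y" for y
        using that by (intro image_eqI[of _ _ "y - {n}"]) (auto simp: Y1_def insert_absorb)
      then show ?thesis by (auto simp: Y0_def Y1_def)
    qed
    moreover have "Y0 \<inter> insert n ` Y1 = {}" by (auto simp: Y0_def)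
    moreover have "inj_on (insert n) Y1"
      by (auto simp: inj_on_def Y1_def)
    ultimately show ?thesis
      using fin0 fin1 by (metis card_Un_disjoint card_image finite_imageI)
  qed
  have finC0: "finite C0"
    by (rule finite_subset[of _ "Y0 \<times> {..<n}"]) (auto simp: C0_def fin0)
  have finC1: "finite C1"
    by (rule finite_subset[of _ "Y1 \<times> {..<n}"]) (auto simp: C1_def fin1)
  have finB: "finite B"
    by (rule finite_subset[of _ "Y \<times> {..<Suc n}"]) (auto simp: B_def finY)
  have ins: "insert n z \<triangle> {i} = insert n (z \<triangle> {i})" if "n \<notin> z" "i < n" for z i
    using that by auto
  have ins2: "insert n z \<triangle> {n} = z" if "n \<notin> z" for z
    using that by auto
  have ins3: "z \<triangle> {n} = insert n z" if "n \<notin> z" for z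
    using that by auto
  \<comment> \<open>Boundary edges of \<open>Y\<close> are those inside either half, and one in
    direction \<open>n\<close> for each point that belongs to exactly one of the halves.\<close>
  let ?f1 = "\<lambda>(z, i). (insert n z, i)"
  let ?D0 = "(\<lambda>z. (z, n)) ` (Y0 - Y1)"
  let ?D1 = "(\<lambda>z. (insert n z, n)) ` (Y1 - Y0)"
  have "C0 \<union> ?f1 ` C1 \<union> ?D0 \<union> ?D1 \<subseteq> B"
    by (auto simp: C0_def C1_def B_def Y0_def Y1_def ins ins2 ins3)
  moreover have "card (C0 \<union> ?f1 ` C1 \<union> ?D0 \<union> ?D1) = card C0 + card C1 + card (Y0 - Y1) + card (Y1 - Y0)"
  proof -
    have c1: "card (?f1 ` C1) = card C1"
      by (rule card_image) (auto simp: inj_on_def C1_def Y1_def)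
    have c2: "card ?D0 = card (Y0 - Y1)"
      by (rule card_image) (auto simp: inj_on_def)
    have c3: "card ?D1 = card (Y1 - Y0)"
      by (rule card_image) (auto simp: inj_on_def Y1_def)
    have d1: "C0 \<inter> ?f1 ` C1 = {}" by (auto simp: C0_def Y0_def)
    have d2: "(C0 \<union> ?f1 ` C1) \<inter> ?D0 = {}" by (auto simp: C0_def C1_def)
    have d3: "(C0 \<union> ?f1 ` C1 \<union> ?D0) \<inter> ?D1 = {}" by (auto simp: C0_def C1_def Y0_def)
    show ?thesis
      using finC0 finC1 fin0 fin1 c1 c2 c3
      by (subst card_Un_disjoint[OF _ _ d3], simp, simp,
          subst card_Un_disjoint[OF _ _ d2], simp, simp,
          subst card_Un_disjoint[OF _ _ d1], simp, simp, simp)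
  qed
  ultimately have "card C0 + card C1 + card (Y0 - Y1) + card (Y1 - Y0) \<le> card B"
    using card_mono[OF finB] by metis
  then have cB: "real (card B) \<ge> real (card C0) + real (card C1) + real (card (Y0 - Y1)) + real (card (Y1 - Y0))"
    by (metis of_nat_add of_nat_le_iff)
  define a where "a = real (card Y0)"
  define b where "b = real (card Y1)"
  define M :: real where "M = 2 ^ n"
  have "card Y0 \<le> 2 ^ n" "card Y1 \<le> 2 ^ n"
    using card_mono[OF _ sub0] card_mono[OF _ sub1] by (simp_all add: card_Pow)
  then have "real (card Y0) \<le> real (2 ^ n)" "real (card Y1) \<le> real (2 ^ n)"
    by (simp_all only: of_nat_le_iff)
  then have ab: "a \<le> M" "b \<le> M" "a \<ge> 0" "b \<ge> 0" "M > 0"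
    by (simp_all add: a_def b_def M_def)
  have diff: "\<bar>a - b\<bar> \<le> real (card (Y0 - Y1)) + real (card (Y1 - Y0))"
    using card_Int_Diff[OF fin0, of Y1] card_Int_Diff[OF fin1, of Y0]
    by (simp add: a_def b_def Int_commute)
  have IH0: "a * (M - a) \<le> M * real (card C0)"
    using Suc.IH[OF sub0] by (simp add: a_def M_def C0_def)
  have IH1: "b * (M - b) \<le> M * real (card C1)"
    using Suc.IH[OF sub1] by (simp add: b_def M_def C1_def)
  have "(a - b)\<^sup>2 \<le> M * \<bar>a - b\<bar>"
  proof -
    have "\<bar>a - b\<bar> \<le> M" using ab by linarith
    then have "\<bar>a - b\<bar> * \<bar>a - b\<bar> \<le> M * \<bar>a - b\<bar>" by (intro mult_right_mono) auto
    then show ?thesis by (simp add: power2_eq_square abs_mult_self_eq)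
  qed
  then have "(a + b) * (2 * M - (a + b)) \<le> 2 * (a * (M - a)) + 2 * (b * (M - b)) + 2 * (M * \<bar>a - b\<bar>)"
  proof -
    have "0 \<le> M * \<bar>a - b\<bar>" using ab by simp
    moreover have "2 * (a * (M - a)) + 2 * (b * (M - b)) - (a + b) * (2 * M - (a + b)) = - (a - b)\<^sup>2"
      by (simp add: algebra_simps power2_eq_square)
    ultimately show ?thesis using \<open>(a - b)\<^sup>2 \<le> M * \<bar>a - b\<bar>\<close> by linarith
  qed
  also have "\<dots> \<le> 2 * (M * real (card C0)) + 2 * (M * real (card C1))
       + 2 * (M * (real (card (Y0 - Y1)) + real (card (Y1 - Y0))))"
    using IH0 IH1 mult_left_mono[OF diff, of M] ab by linarith
  also have "\<dots> \<le> 2 * M * real (card B)"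
    using mult_left_mono[OF cB, of M] ab by (simp add: algebra_simps)
  finally show ?case
    by (simp add: a_def b_def M_def B_def card_Y)
qed

definition hub :: "nat set set \<Rightarrow> nat set set \<Rightarrow> nat set \<Rightarrow> nat set set" where
  "hub S V z = {x \<in> V. x \<triangle> z \<in> S}"

lemma hub_subset: "hub S V z \<subseteq> V"
  by (auto simp: hub_def)

text \<open>Makes the system of hubs regular: summing a count of points over all hubs multiplies it
  by \<open>card S\<close>, the double counting behind \<open>hub_expansion\<close>.\<close>

lemma card_hubs_containing:
  assumes "x \<in> Pow {..<n}" "S \<subseteq> Pow {..<n}"
  shows "card {z \<in> Pow {..<n}. x \<triangle> z \<in> S} = card S"
proof -
  have "z \<in> Pow {..<n}" if "z \<triangle> x \<in> S" for z
    using symdiff_Pow[OF assms(1), of "z \<triangle> x"] that assms(2) by (auto simp: symdiff_ac)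
  then have "{z \<in> Pow {..<n}. x \<triangle> z \<in> S} = {z. z \<triangle> x \<in> S}"
    unfolding symdiff_commute[of x] by blast
  then show ?thesis by (simp add: card_symdiff_translate)
qed

section \<open>Expansion from a system of hubs\<close>

text \<open>Boundary pairs are counted through hubs: \<open>f z\<close> and \<open>g z\<close> are
  the numbers of hub points inside and outside \<open>U\<close>, and \<open>E z z'\<close> counts
  the boundary pairs leading from one hub to another. As a point lies in \<open>N\<close> hubs, a
  sum of \<open>E\<close> over all hubs counts no pair more than \<open>N\<close> times, while
  almost complete adjacency makes \<open>E z z'\<close> at least \<open>f z * g z'\<close> up to
  \<epsilon>^2 D^2 / 4. The three cases correspond to three sources of boundary pairs: points whose
  hubs mostly miss \<open>U\<close>, mixed hubs, and hubs almost inside \<open>U\<close> next to one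
  that is not. Only the last loses the factor \<open>n\<close>, one for each direction.\<close>

theorem hub_expansion:
  fixes V S :: "nat set set" and D \<epsilon> :: real and adj :: "nat set \<Rightarrow> nat set \<Rightarrow> bool"
  defines "H \<equiv> hub S V"
  assumes V: "V \<subseteq> Pow {..<n}" and S: "S \<subseteq> Pow {..<n}" "S \<noteq> {}"
    and n: "n \<ge> 1" and D: "D > 0" and eps: "0 < \<epsilon>" "\<epsilon> \<le> 1/10"
    and size: "\<And>z. z \<in> Pow {..<n} \<Longrightarrow> 9/10 * D \<le> real (card (H z))"
              "\<And>z. z \<in> Pow {..<n} \<Longrightarrow> real (card (H z)) \<le> 11/10 * D"
    and degree: "\<And>x. x \<in> V \<Longrightarrow>
        4 * \<epsilon> * real (card S) * D \<le> (\<Sum>z\<in>{z \<in> Pow {..<n}. x \<in> H z}. real (card {y \<in> H z. adj x y}))"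
    and pairs: "\<And>z e. z \<in> Pow {..<n} \<Longrightarrow> e = {} \<or> (\<exists>i<n. e = {i}) \<Longrightarrow>
        real (card {(a, b). a \<in> H z \<and> b \<in> H (z \<triangle> e) \<and> \<not> adj a b}) \<le> \<epsilon>\<^sup>2 * D\<^sup>2 / 4"
    and U: "U \<subseteq> V" "2 * card U \<le> card V"
  shows "real (card {(a, b). a \<in> U \<and> b \<in> V - U \<and> adj a b}) \<ge> \<epsilon>\<^sup>2 * D / (25 * real n) * real (card U)"
proof -
  define \<Omega> where "\<Omega> = Pow {..<n}"
  define N where "N = real (card S)"
  define bd where "bd = {(a, b). a \<in> U \<and> b \<in> V - U \<and> adj a b}"
  define f where "f = (\<lambda>z. real (card (H z \<inter> U)))"
  define g where "g = (\<lambda>z. real (card (H z - U)))"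
  define E where "E = (\<lambda>z z'. real (card {q \<in> bd. fst q \<in> H z \<and> snd q \<in> H z'}))"
  have fin\<Omega>: "finite \<Omega>" by (simp add: \<Omega>_def)
  have finV: "finite V" using V finite_subset by blast
  have finU: "finite U" using U finV finite_subset by blast
  have finH: "finite (H z)" for z
    using finV by (auto simp: H_def hub_def)
  have HV: "H z \<subseteq> V" for z by (auto simp: H_def hub_def)
  have finbd: "finite bd"
    by (rule finite_subset[of _ "V \<times> V"]) (use U finV in \<open>auto simp: bd_def\<close>)
  have N: "N > 0"
    using S finite_subset[OF S(1)] by (auto simp: N_def card_gt_0_iff)
  have fg: "f z + g z = real (card (H z))" for z
    using card_Int_Diff[OF finH, of z U] by (simp add: f_def g_def)
  have f0: "f z \<ge> 0" and g0: "g z \<ge> 0" for z by (auto simp: f_def g_def)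
  have cnt: "real (card {z \<in> \<Omega>. x \<in> H z}) = N" if "x \<in> V" for x
    using card_hubs_containing[of x n S] that V S by (auto simp: H_def hub_def \<Omega>_def N_def)

  have sumE0: "(\<Sum>z\<in>\<Omega>. E z z) \<le> N * real (card bd)"
  proof -
    have "(\<Sum>z\<in>\<Omega>. E z z) = real (\<Sum>q\<in>bd. card {z \<in> \<Omega>. fst q \<in> H z \<and> snd q \<in> H z})"
      unfolding E_def by (subst sum_card_swap[OF fin\<Omega> finbd, symmetric]) simp
    also have "\<dots> \<le> (\<Sum>q\<in>bd. real (card {z \<in> \<Omega>. fst q \<in> H z}))"
      unfolding of_nat_sum by (intro sum_mono of_nat_mono card_mono) (auto simp: fin\<Omega>)
    also have "\<dots> = (\<Sum>q\<in>bd. N)"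
      by (intro sum.cong refl cnt) (use U in \<open>auto simp: bd_def\<close>)
    finally show ?thesis by (simp add: mult.commute)
  qed
  have sumE1: "(\<Sum>z\<in>\<Omega>. E z (z \<triangle> {i})) \<le> N * real (card bd)" for i
  proof -
    have "(\<Sum>z\<in>\<Omega>. E z (z \<triangle> {i})) = real (\<Sum>q\<in>bd. card {z \<in> \<Omega>. fst q \<in> H z \<and> snd q \<in> H (z \<triangle> {i})})"
      unfolding E_def by (subst sum_card_swap[OF fin\<Omega> finbd, symmetric]) simp
    also have "\<dots> \<le> (\<Sum>q\<in>bd. real (card {z \<in> \<Omega>. fst q \<in> H z}))"
      unfolding of_nat_sum by (intro sum_mono of_nat_mono card_mono) (auto simp: fin\<Omega>)
    also have "\<dots> = (\<Sum>q\<in>bd. N)"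
      by (intro sum.cong refl cnt) (use U in \<open>auto simp: bd_def\<close>)
    finally show ?thesis by (simp add: mult.commute)
  qed
  have Elow: "E z (z \<triangle> e) \<ge> f z * g (z \<triangle> e) - \<epsilon>\<^sup>2 * D\<^sup>2 / 4"
    if "z \<in> \<Omega>" "e = {} \<or> (\<exists>i<n. e = {i})" for z e
  proof -
    let ?P = "(H z \<inter> U) \<times> (H (z \<triangle> e) - U)"
    let ?B = "{(a, b). a \<in> H z \<and> b \<in> H (z \<triangle> e) \<and> \<not> adj a b}"
    let ?G = "{q \<in> bd. fst q \<in> H z \<and> snd q \<in> H (z \<triangle> e)}"
    have finB: "finite ?B"
      by (rule finite_subset[of _ "H z \<times> H (z \<triangle> e)"]) (auto simp: finH)
    have "?P \<subseteq> ?G \<union> ?B"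
      using HV by (auto simp: bd_def)
    then have "card ?P \<le> card (?G \<union> ?B)"
      by (rule card_mono[rotated]) (use finbd finB in auto)
    also have "\<dots> \<le> card ?G + card ?B" by (rule card_Un_le)
    finally have "real (card ?P) \<le> real (card ?G) + real (card ?B)"
      unfolding of_nat_add[symmetric] of_nat_le_iff .
    moreover have "real (card ?B) \<le> \<epsilon>\<^sup>2 * D\<^sup>2 / 4"
      using pairs[of z e] that by (simp add: \<Omega>_def)
    moreover have "real (card ?P) = f z * g (z \<triangle> e)"
      by (simp add: f_def g_def card_cartesian_product)
    ultimately show ?thesis by (simp add: E_def)
  qed
  have sumf: "(\<Sum>z\<in>Z. f z) = (\<Sum>x\<in>U. real (card {z \<in> Z. x \<in> H z}))" if "finite Z" for Z
  proof -
    have eq: "H z \<inter> U = {x \<in> U. x \<in> H z}" for z by auto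
    show ?thesis
      unfolding f_def eq of_nat_sum[symmetric] by (subst sum_card_swap[OF that finU]) simp
  qed
  have totf: "(\<Sum>z\<in>\<Omega>. f z) = N * real (card U)"
    unfolding sumf[OF fin\<Omega>] using cnt U by (simp add: subset_iff mult.commute)
  \<comment> \<open>\<open>Yy\<close> are the hubs with a noticeable part in \<open>U\<close>, and
    \<open>U1\<close> the points of \<open>U\<close> lying in few of them. If \<open>U1\<close> is
    small, the other points put much of the weight of \<open>f\<close> on \<open>Yy\<close>.\<close>
  define Yy where "Yy = {z \<in> \<Omega>. f z > \<epsilon> * D}"
  have finYy: "finite Yy" by (simp add: Yy_def fin\<Omega>)
  define U1 where "U1 = {x \<in> U. real (card {z \<in> Yy. x \<in> H z}) \<le> \<epsilon> * N}"
  have finU1: "finite U1" using finU by (simp add: U1_def)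
  have goal: ?thesis if "real (card bd) \<ge> \<epsilon>\<^sup>2 * D / (25 * real n) * real (card U)"
    using that by (simp add: bd_def)
  have n1: "real n \<ge> 1" using n by simp
  have k1: "\<epsilon>\<^sup>2 * D / (25 * real n) \<le> \<epsilon>\<^sup>2 * D / 25"
    using n1 D by (intro divide_left_mono) (auto intro: mult_nonneg_nonneg)
  consider (sparse) "2 * card U1 \<ge> card U"
    | (mid) "2 * card U1 < card U" "(\<Sum>z\<in>{z \<in> Yy. g z \<ge> \<epsilon> * D}. f z) \<ge> \<epsilon> * N * real (card U) / 4"
    | (high) "2 * card U1 < card U" "(\<Sum>z\<in>{z \<in> Yy. g z \<ge> \<epsilon> * D}. f z) < \<epsilon> * N * real (card U) / 4"
    by linarith
  then show ?thesis
  proof cases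
    case sparse
    \<comment> \<open>Of the degree 4 \<epsilon> N D of \<open>x\<close>, the hubs in
      \<open>Yy\<close> absorb at most 11/10 \<epsilon> N D and the neighbours in \<open>U\<close>
      within the other hubs at most \<epsilon> N D, so at least \<epsilon> N D leads out of
      \<open>U\<close>.\<close>
    have low: "(\<Sum>z\<in>{z \<in> \<Omega>. x \<in> H z}. real (card {y \<in> H z - U. adj x y})) \<ge> \<epsilon> * N * D"
      if "x \<in> U1" for x
    proof -
      have xU: "x \<in> U" "x \<in> V" using that U by (auto simp: U1_def)
      have split: "{z \<in> \<Omega>. x \<in> H z} = {z \<in> Yy. x \<in> H z} \<union> {z \<in> \<Omega> - Yy. x \<in> H z}"
        by (auto simp: Yy_def)
      have fA: "finite {z \<in> Yy. x \<in> H z}" "finite {z \<in> \<Omega> - Yy. x \<in> H z}"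
        using fin\<Omega> finYy by auto
      have "4 * \<epsilon> * N * D \<le> (\<Sum>z\<in>{z \<in> \<Omega>. x \<in> H z}. real (card {y \<in> H z. adj x y}))"
        using degree[OF xU(2)] by (simp add: N_def \<Omega>_def)
      also have "\<dots> = (\<Sum>z\<in>{z \<in> Yy. x \<in> H z}. real (card {y \<in> H z. adj x y}))
          + (\<Sum>z\<in>{z \<in> \<Omega> - Yy. x \<in> H z}. real (card {y \<in> H z. adj x y}))"
        unfolding split by (rule sum.union_disjoint) (use fA in auto)
      also have "(\<Sum>z\<in>{z \<in> Yy. x \<in> H z}. real (card {y \<in> H z. adj x y})) \<le> (\<Sum>z\<in>{z \<in> Yy. x \<in> H z}. 11/10 * D)"
      proof (rule sum_mono)
        fix z assume "z \<in> {z \<in> Yy. x \<in> H z}"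
        then have "z \<in> Pow {..<n}" by (auto simp: Yy_def \<Omega>_def)
        moreover have "card {y \<in> H z. adj x y} \<le> card (H z)"
          by (rule card_mono) (auto simp: finH)
        ultimately show "real (card {y \<in> H z. adj x y}) \<le> 11/10 * D"
          using size(2)[of z] by linarith
      qed
      also have "\<dots> = real (card {z \<in> Yy. x \<in> H z}) * (11/10 * D)" by simp
      also have "\<dots> \<le> \<epsilon> * N * (11/10 * D)"
        using that D by (intro mult_right_mono) (auto simp: U1_def)
      also have "(\<Sum>z\<in>{z \<in> \<Omega> - Yy. x \<in> H z}. real (card {y \<in> H z. adj x y}))
          \<le> (\<Sum>z\<in>{z \<in> \<Omega> - Yy. x \<in> H z}. real (card {y \<in> H z - U. adj x y}) + \<epsilon> * D)"
      proof (rule sum_mono)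
        fix z assume z: "z \<in> {z \<in> \<Omega> - Yy. x \<in> H z}"
        have "card {y \<in> H z. adj x y} \<le> card ({y \<in> H z - U. adj x y} \<union> (H z \<inter> U))"
          by (rule card_mono) (auto simp: finH)
        also have "\<dots> \<le> card {y \<in> H z - U. adj x y} + card (H z \<inter> U)"
          by (rule card_Un_le)
        finally have "real (card {y \<in> H z. adj x y}) \<le> real (card {y \<in> H z - U. adj x y}) + f z"
          unfolding f_def of_nat_add[symmetric] of_nat_le_iff .
        then show "real (card {y \<in> H z. adj x y}) \<le> real (card {y \<in> H z - U. adj x y}) + \<epsilon> * D"
          using z by (auto simp: Yy_def)
      qed
      also have "\<dots> = (\<Sum>z\<in>{z \<in> \<Omega> - Yy. x \<in> H z}. real (card {y \<in> H z - U. adj x y}))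
          + real (card {z \<in> \<Omega> - Yy. x \<in> H z}) * (\<epsilon> * D)"
        by (simp add: sum.distrib)
      also have "real (card {z \<in> \<Omega> - Yy. x \<in> H z}) \<le> N"
        unfolding cnt[OF xU(2), symmetric] by (intro of_nat_mono card_mono) (auto simp: fin\<Omega>)
      also have "(\<Sum>z\<in>{z \<in> \<Omega> - Yy. x \<in> H z}. real (card {y \<in> H z - U. adj x y}))
          \<le> (\<Sum>z\<in>{z \<in> \<Omega>. x \<in> H z}. real (card {y \<in> H z - U. adj x y}))"
        by (rule sum_mono2) (auto simp: fin\<Omega>)
      finally have "4 * \<epsilon> * N * D \<le> \<epsilon> * N * (11/10 * D)
          + ((\<Sum>z\<in>{z \<in> \<Omega>. x \<in> H z}. real (card {y \<in> H z - U. adj x y})) + N * (\<epsilon> * D))"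
        using D eps by (simp add: mult_right_mono)
      moreover have "\<epsilon> * N * D \<ge> 0" using eps N D by simp
      ultimately show ?thesis by (simp add: algebra_simps)
    qed
    have "real (card U1) * (\<epsilon> * N * D) \<le> (\<Sum>x\<in>U1. \<Sum>z\<in>{z \<in> \<Omega>. x \<in> H z}. real (card {y \<in> H z - U. adj x y}))"
      using sum_mono[of U1 "\<lambda>_. \<epsilon> * N * D", OF low] by simp
    also have "\<dots> \<le> (\<Sum>x\<in>U. \<Sum>z\<in>{z \<in> \<Omega>. x \<in> H z}. real (card {y \<in> H z - U. adj x y}))"
      by (rule sum_mono2) (auto simp: finU U1_def intro!: sum_nonneg)
    also have "\<dots> = (\<Sum>x\<in>U. \<Sum>z\<in>\<Omega>. if x \<in> H z then real (card {y \<in> H z - U. adj x y}) else 0)"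
      by (intro sum.cong refl sum.mono_neutral_cong_left) (auto simp: fin\<Omega>)
    also have "\<dots> = (\<Sum>z\<in>\<Omega>. \<Sum>x\<in>U. if x \<in> H z then real (card {y \<in> H z - U. adj x y}) else 0)"
      by (rule sum.swap)
    also have "\<dots> = (\<Sum>z\<in>\<Omega>. E z z)"
    proof (rule sum.cong[OF refl])
      fix z assume "z \<in> \<Omega>"
      have "(\<Sum>x\<in>U. if x \<in> H z then real (card {y \<in> H z - U. adj x y}) else 0)
          = (\<Sum>x\<in>H z \<inter> U. real (card {y \<in> H z - U. adj x y}))"
        by (rule sum.mono_neutral_cong_right) (auto simp: finU)
      also have "\<dots> = real (card (SIGMA x:H z \<inter> U. {y \<in> H z - U. adj x y}))"
        by (subst card_SigmaI) (auto simp: finH)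
      also have "(SIGMA x:H z \<inter> U. {y \<in> H z - U. adj x y}) = {q \<in> bd. fst q \<in> H z \<and> snd q \<in> H z}"
        using HV by (auto simp: bd_def)
      finally show "(\<Sum>x\<in>U. if x \<in> H z then real (card {y \<in> H z - U. adj x y}) else 0) = E z z"
        by (simp add: E_def)
    qed
    also note sumE0
    finally have "N * (real (card U1) * (\<epsilon> * D)) \<le> N * real (card bd)"
      by (simp add: mult_ac)
    then have "real (card U1) * (\<epsilon> * D) \<le> real (card bd)"
      using N by simp
    moreover have "real (card U) / 2 * (\<epsilon> * D) \<le> real (card U1) * (\<epsilon> * D)"
      using sparse eps D by (intro mult_right_mono) auto
    moreover have "\<epsilon>\<^sup>2 * D / (25 * real n) * real (card U) \<le> real (card U) / 2 * (\<epsilon> * D)"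
    proof -
      have "\<epsilon>\<^sup>2 * D / 25 \<le> \<epsilon> * D / 2"
        using eps D by (simp add: power2_eq_square field_simps)
      then have "\<epsilon>\<^sup>2 * D / (25 * real n) \<le> \<epsilon> * D / 2" using k1 by linarith
      from mult_right_mono[OF this, of "real (card U)"] show ?thesis by (simp add: mult_ac)
    qed
    ultimately show ?thesis by (intro goal) linarith
  next
    case mid
    \<comment> \<open>Mixed hubs have \<epsilon> D points on either side, so the error \<epsilon>^2
      D^2 / 4 is at most a quarter of \<open>f z * (\<epsilon> * D)\<close>.\<close>
    let ?Z = "{z \<in> Yy. g z \<ge> \<epsilon> * D}"
    have "3/4 * (\<epsilon> * D) * (\<epsilon> * N * real (card U) / 4) \<le> 3/4 * (\<epsilon> * D) * (\<Sum>z\<in>?Z. f z)"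
      using mid(2) eps D by (intro mult_left_mono) auto
    also have "\<dots> = (\<Sum>z\<in>?Z. 3/4 * (\<epsilon> * D) * f z)" by (simp add: sum_distrib_left)
    also have "\<dots> \<le> (\<Sum>z\<in>?Z. E z z)"
    proof (rule sum_mono)
      fix z assume z: "z \<in> ?Z"
      then have fz: "f z \<ge> \<epsilon> * D" "g z \<ge> \<epsilon> * D" "z \<in> \<Omega>" by (auto simp: Yy_def)
      have "f z * (\<epsilon> * D) \<le> f z * g z" using fz f0 by (intro mult_left_mono) auto
      moreover have "\<epsilon> * D * (\<epsilon> * D) \<le> f z * (\<epsilon> * D)" using fz eps D by (intro mult_right_mono) auto
      moreover have "E z z \<ge> f z * g z - \<epsilon>\<^sup>2 * D\<^sup>2 / 4" using Elow[of z "{}"] fz by simp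
      ultimately show "3/4 * (\<epsilon> * D) * f z \<le> E z z" by (simp add: power2_eq_square algebra_simps)
    qed
    also have "\<dots> \<le> (\<Sum>z\<in>\<Omega>. E z z)"
      by (rule sum_mono2) (auto simp: fin\<Omega> Yy_def E_def)
    also note sumE0
    finally have "N * (3/16 * \<epsilon>\<^sup>2 * D * real (card U)) \<le> N * real (card bd)"
      by (simp add: power2_eq_square mult_ac)
    then have "3/16 * \<epsilon>\<^sup>2 * D * real (card U) \<le> real (card bd)" using N by simp
    moreover have "\<epsilon>\<^sup>2 * D / (25 * real n) * real (card U) \<le> 3/16 * \<epsilon>\<^sup>2 * D * real (card U)"
      using k1 D eps by (intro mult_right_mono order_trans[OF k1]) auto
    ultimately show ?thesis by (intro goal) linarith
  next
    case high
    \<comment> \<open>\<open>Z\<close> are the hubs almost inside \<open>U\<close>. Weight on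
      \<open>Yy\<close> that is not on mixed hubs sits here, which bounds \<open>card Z\<close> from
      below.\<close>
    define Z where "Z = {z \<in> Yy. g z < \<epsilon> * D}"
    have ZO: "Z \<subseteq> \<Omega>" by (auto simp: Z_def Yy_def)
    have finZ: "finite Z" using ZO fin\<Omega> finite_subset by blast
    have "\<epsilon> * N * real (card U) / 2 \<le> \<epsilon> * N * real (card (U - U1))"
    proof -
      have "card (U - U1) = card U - card U1"
        by (rule card_Diff_subset[OF finU1]) (auto simp: U1_def)
      then have "real (card U) / 2 \<le> real (card (U - U1))" using high(1) by linarith
      then have "\<epsilon> * N * (real (card U) / 2) \<le> \<epsilon> * N * real (card (U - U1))"
        using eps N by (intro mult_left_mono) auto
      then show ?thesis by simp
    qed
    also have "\<dots> \<le> (\<Sum>x\<in>U - U1. real (card {z \<in> Yy. x \<in> H z}))"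
      using sum_mono[of "U - U1" "\<lambda>_. \<epsilon> * N" "\<lambda>x. real (card {z \<in> Yy. x \<in> H z})"]
      by (force simp: U1_def mult.commute)
    also have "\<dots> \<le> (\<Sum>x\<in>U. real (card {z \<in> Yy. x \<in> H z}))"
      by (rule sum_mono2) (auto simp: finU)
    also have "\<dots> = (\<Sum>z\<in>Yy. f z)" using sumf[OF finYy] by simp
    also have "\<dots> = (\<Sum>z\<in>Z. f z) + (\<Sum>z\<in>{z \<in> Yy. g z \<ge> \<epsilon> * D}. f z)"
    proof -
      have "Yy = Z \<union> {z \<in> Yy. g z \<ge> \<epsilon> * D}" by (auto simp: Z_def)
      moreover have "Z \<inter> {z \<in> Yy. g z \<ge> \<epsilon> * D} = {}" by (auto simp: Z_def)
      ultimately show ?thesis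
        using finYy finZ by (metis (no_types, lifting) finite_Un sum.union_disjoint)
    qed
    finally have sZ: "\<epsilon> * N * real (card U) / 4 \<le> (\<Sum>z\<in>Z. f z)"
      using high(2) by linarith
    also have "\<dots> \<le> (\<Sum>z\<in>Z. 11/10 * D)"
    proof (rule sum_mono)
      fix z assume "z \<in> Z"
      then show "f z \<le> 11/10 * D"
        using size(2)[of z] fg[of z] g0[of z] ZO by (auto simp: \<Omega>_def)
    qed
    finally have Zlow: "\<epsilon> * N * real (card U) / 4 \<le> real (card Z) * (11/10 * D)" by simp
    have fZ: "f z \<ge> 8/10 * D" if "z \<in> Z" for z
    proof -
      have "z \<in> Pow {..<n}" using that ZO by (auto simp: \<Omega>_def)
      moreover have "\<epsilon> * D \<le> 1/10 * D" using eps D by (intro mult_right_mono) auto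
      ultimately show ?thesis
        using size(1)[of z] fg[of z] that by (auto simp: Z_def)
    qed
    \<comment> \<open>This is where \<open>2 * card U \<le> card V\<close> enters: hubs in
      \<open>Z\<close> hold at least 8/10 D points of \<open>U\<close> each, all hubs at most 11/20
      D on average, so \<open>Z\<close> is at most the fraction 11/16 < 7/10 of the cube and
      isoperimetry keeps a factor 3/10.\<close>
    have "real (card Z) * (8/10 * D) \<le> (\<Sum>z\<in>Z. f z)"
      using sum_mono[of Z "\<lambda>_. 8/10 * D" f] fZ by simp
    also have "\<dots> \<le> (\<Sum>z\<in>\<Omega>. f z)"
      by (rule sum_mono2) (use ZO fin\<Omega> f0 in auto)
    also have "\<dots> = N * real (card U)" by (rule totf)
    also have "\<dots> \<le> N * (real (card V) / 2)"
      using U(2) N by (intro mult_left_mono) auto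
    also have "N * real (card V) = (\<Sum>z\<in>\<Omega>. real (card (H z)))"
    proof -
      have eq: "H z = {x \<in> V. x \<in> H z}" for z using HV by auto
      have "(\<Sum>z\<in>\<Omega>. card (H z)) = (\<Sum>z\<in>\<Omega>. card {x \<in> V. x \<in> H z})" by (simp flip: eq)
      also have "\<dots> = (\<Sum>x\<in>V. card {z \<in> \<Omega>. x \<in> H z})" by (rule sum_card_swap[OF fin\<Omega> finV])
      finally have "real (\<Sum>z\<in>\<Omega>. card (H z)) = real (\<Sum>x\<in>V. card {z \<in> \<Omega>. x \<in> H z})"
        by (rule arg_cong)
      then have "(\<Sum>z\<in>\<Omega>. real (card (H z))) = (\<Sum>x\<in>V. real (card {z \<in> \<Omega>. x \<in> H z}))"
        unfolding of_nat_sum .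
      then show ?thesis using cnt by simp
    qed
    then have "N * (real (card V) / 2) = (\<Sum>z\<in>\<Omega>. real (card (H z))) / 2" by simp
    also have "\<dots> \<le> (\<Sum>z\<in>\<Omega>. 11/10 * D) / 2"
      by (intro divide_right_mono sum_mono) (use size(2) in \<open>auto simp: \<Omega>_def\<close>)
    also have "\<dots> = 2 ^ n * (11/20 * D)"
      by (simp add: \<Omega>_def card_Pow)
    finally have "real (card Z) * (8/10) \<le> 2 ^ n * (11/20)"
      using D by (simp add: mult.assoc[symmetric])
    then have Zup: "real (card Z) \<le> 7/10 * 2 ^ n" by simp
    let ?bZ = "{(z, i). z \<in> Z \<and> i < n \<and> z \<triangle> {i} \<notin> Z}"
    have finbZ: "finite ?bZ"
      by (rule finite_subset[of _ "Z \<times> {..<n}"]) (auto simp: finZ)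
    have "real (card Z) * (3/10 * 2 ^ n) \<le> real (card Z) * (2 ^ n - real (card Z))"
      using Zup by (intro mult_left_mono) auto
    also have "\<dots> \<le> 2 ^ n * real (card ?bZ)"
      using cube_edge_isoperimetry[of Z n] ZO by (simp add: \<Omega>_def)
    finally have bZ: "3/10 * real (card Z) \<le> real (card ?bZ)" by simp
    have "real (card ?bZ) * (7/10 * \<epsilon> * D\<^sup>2) = (\<Sum>q\<in>?bZ. 7/10 * \<epsilon> * D\<^sup>2)" by simp
    also have "\<dots> \<le> (\<Sum>q\<in>?bZ. E (fst q) (fst q \<triangle> {snd q}))"
    proof (rule sum_mono, clarify)
      fix z i assume z: "z \<in> Z" and i: "i < n" and nz: "z \<triangle> {i} \<notin> Z"
      have zO: "z \<in> \<Omega>" using z ZO by auto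
      have zi: "z \<triangle> {i} \<in> \<Omega>" using zO i unfolding \<Omega>_def by (intro symdiff_Pow) auto
      have ee: "\<epsilon> * D \<le> 1/10 * D" using eps D by (intro mult_right_mono) auto
      \<comment> \<open>A hub outside \<open>Z\<close> either has \<epsilon> D points outside
        \<open>U\<close> or at most \<epsilon> D points in \<open>U\<close>; in the latter case its
        size of 9/10 D puts even more points outside.\<close>
      have "g (z \<triangle> {i}) \<ge> \<epsilon> * D"
      proof (rule ccontr)
        assume c: "\<not> \<epsilon> * D \<le> g (z \<triangle> {i})"
        then have "f (z \<triangle> {i}) \<le> \<epsilon> * D" using nz zi by (auto simp: Z_def Yy_def)
        moreover have "9/10 * D \<le> f (z \<triangle> {i}) + g (z \<triangle> {i})"
          using size(1)[of "z \<triangle> {i}"] zi by (simp add: fg \<Omega>_def)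
        ultimately show False using c ee D by linarith
      qed
      then have "8/10 * D * (\<epsilon> * D) \<le> f z * g (z \<triangle> {i})"
        using fZ[OF z] eps D by (intro mult_mono) auto
      moreover have "E z (z \<triangle> {i}) \<ge> f z * g (z \<triangle> {i}) - \<epsilon>\<^sup>2 * D\<^sup>2 / 4"
        using Elow[of z "{i}"] zO i by auto
      moreover have "\<epsilon>\<^sup>2 * D\<^sup>2 / 4 \<le> 1/10 * \<epsilon> * D\<^sup>2"
        using eps D by (simp add: power2_eq_square)
      ultimately have "7/10 * \<epsilon> * D\<^sup>2 \<le> E z (z \<triangle> {i})" by (simp add: power2_eq_square algebra_simps)
      then show "7/10 * \<epsilon> * D\<^sup>2 \<le> E (fst (z, i)) (fst (z, i) \<triangle> {snd (z, i)})" by simp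
    qed
    also have "\<dots> \<le> (\<Sum>q\<in>\<Omega> \<times> {..<n}. E (fst q) (fst q \<triangle> {snd q}))"
      by (rule sum_mono2) (use ZO fin\<Omega> in \<open>auto simp: E_def\<close>)
    also have "\<dots> = (\<Sum>z\<in>\<Omega>. \<Sum>i<n. E z (z \<triangle> {i}))"
      by (simp add: sum.cartesian_product case_prod_beta)
    also have "\<dots> = (\<Sum>i<n. \<Sum>z\<in>\<Omega>. E z (z \<triangle> {i}))" by (rule sum.swap)
    also have "\<dots> \<le> (\<Sum>i<n. N * real (card bd))" by (intro sum_mono sumE1)
    also have "\<dots> = real n * (N * real (card bd))" by simp
    finally have b1: "real (card ?bZ) * (7/10 * \<epsilon> * D\<^sup>2) \<le> real n * (N * real (card bd))" .
    have "\<epsilon> * N * real (card U) / 4 * (21/100 * \<epsilon> * D) \<le> real (card Z) * (11/10 * D) * (21/100 * \<epsilon> * D)"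
      using Zlow eps D by (intro mult_right_mono) auto
    also have "\<dots> = 11/10 * (3/10 * real (card Z)) * (7/10 * \<epsilon> * D\<^sup>2)"
      by (simp add: power2_eq_square)
    also have "\<dots> \<le> 11/10 * real (card ?bZ) * (7/10 * \<epsilon> * D\<^sup>2)"
      using bZ eps D by (intro mult_right_mono mult_left_mono) auto
    also have "\<dots> \<le> 11/10 * (real n * (N * real (card bd)))"
      using mult_left_mono[OF b1, of "11/10"] by (simp add: mult_ac)
    finally have "N * (21/440 * \<epsilon>\<^sup>2 * D * real (card U)) \<le> N * (real n * real (card bd))"
      by (simp add: power2_eq_square mult_ac)
    then have "21/440 * \<epsilon>\<^sup>2 * D * real (card U) \<le> real n * real (card bd)" using N by simp
    moreover have "1/25 * (\<epsilon>\<^sup>2 * D * real (card U)) \<le> 21/440 * (\<epsilon>\<^sup>2 * D * real (card U))"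
      using D by (intro mult_right_mono) auto
    ultimately show ?thesis
      using n1 by (intro goal) (simp add: field_simps)
  qed
qed

section \<open>The graph of a 0/1-polytope\<close>

text \<open>A convex combination of \<open>V\<close> that attains the bound \<open>c\<close> puts
  weight only on points of level \<open>c\<close>, because the nonnegative terms
  \<open>u v * (c - f v)\<close> sum to zero. So the level set cut out of the hull is the hull of
  the level set of \<open>V\<close>.\<close>

lemma convex_hull_level_face:
  fixes f :: "'a::real_vector \<Rightarrow> real"
  assumes lin: "linear f" and fin: "finite V" and le: "\<And>x. x \<in> V \<Longrightarrow> f x \<le> c"
  shows "convex hull {x \<in> V. f x = c} face_of convex hull V"
proof -
  have hs: "convex {x. f x \<le> c}"
  proof -
    have "convex (f -` {..c})" by (rule convex_linear_vimage[OF lin]) simp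
    then show ?thesis by (simp add: vimage_def)
  qed
  have leP: "f x \<le> c" if "x \<in> convex hull V" for x
    using hull_minimal[of V "{x. f x \<le> c}" convex] hs le that by auto
  have eq: "convex hull {x \<in> V. f x = c} = convex hull V \<inter> {x. f x = c}"
  proof
    have "convex (f -` {c})" by (rule convex_linear_vimage[OF lin]) simp
    then have "convex hull {x \<in> V. f x = c} \<subseteq> {x. f x = c}"
      by (intro hull_minimal) (auto simp: vimage_def)
    moreover have "convex hull {x \<in> V. f x = c} \<subseteq> convex hull V" by (rule hull_mono) auto
    ultimately show "convex hull {x \<in> V. f x = c} \<subseteq> convex hull V \<inter> {x. f x = c}" by blast
  next
    show "convex hull V \<inter> {x. f x = c} \<subseteq> convex hull {x \<in> V. f x = c}"
    proof
      fix x assume "x \<in> convex hull V \<inter> {x. f x = c}"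
      then have x: "x \<in> convex hull V" and fx: "c = f x" by auto
      obtain u where u: "\<And>v. v \<in> V \<Longrightarrow> 0 \<le> u v" "sum u V = 1" "(\<Sum>v\<in>V. u v *\<^sub>R v) = x"
        using x by (auto simp: convex_hull_finite[OF fin])
      have "f x = (\<Sum>v\<in>V. u v * f v)"
        using u(3) by (auto simp: linear_sum[OF lin] linear_scale[OF lin])
      then have "(\<Sum>v\<in>V. u v * (c - f v)) = 0"
      proof -
        have "(\<Sum>v\<in>V. u v * (c - f v)) = c * sum u V - (\<Sum>v\<in>V. u v * f v)"
          by (simp add: algebra_simps sum_subtractf sum_distrib_left)
        then show ?thesis using u(2) fx \<open>f x = (\<Sum>v\<in>V. u v * f v)\<close> by simp
      qed
      then have z: "u v * (c - f v) = 0" if "v \<in> V" for v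
        using sum_nonneg_eq_0_iff[OF fin, of "\<lambda>v. u v * (c - f v)"] u(1) le that by auto
      let ?W = "{v \<in> V. f v = c}"
      have z0: "u v = 0" if "v \<in> V - ?W" for v using z[of v] that by auto
      have "sum u ?W = 1"
        using u(2) sum.mono_neutral_left[OF fin, of ?W u] z0 by auto
      moreover have "(\<Sum>v\<in>?W. u v *\<^sub>R v) = x"
        using u(3) sum.mono_neutral_left[OF fin, of ?W "\<lambda>v. u v *\<^sub>R v"] z0 by auto
      moreover have "finite ?W" using fin by simp
      ultimately show "x \<in> convex hull ?W"
        unfolding convex_hull_finite[OF \<open>finite ?W\<close>] using u(1) by blast
    qed
  qed
  show ?thesis
    unfolding face_of_def
  proof (intro conjI ballI impI)
    show "convex hull {x \<in> V. f x = c} \<subseteq> convex hull V" by (simp add: eq)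
    show "convex (convex hull {x \<in> V. f x = c})" by simp
    fix a b x
    assume a: "a \<in> convex hull V" and b: "b \<in> convex hull V"
      and x: "x \<in> convex hull {x \<in> V. f x = c}" and ab: "x \<in> open_segment a b"
    obtain t where t: "0 < t" "t < 1" "x = (1 - t) *\<^sub>R a + t *\<^sub>R b"
      using ab by (auto simp: in_segment)
    have "c = (1 - t) * f a + t * f b"
      using x t(3) by (auto simp: eq linear_add[OF lin] linear_scale[OF lin])
    then have "(1 - t) * (c - f a) + t * (c - f b) = 0" by (simp add: algebra_simps)
    moreover have "(1 - t) * (c - f a) \<ge> 0" "t * (c - f b) \<ge> 0"
      using t leP a b by auto
    ultimately have "(1 - t) * (c - f a) = 0" "t * (c - f b) = 0" by linarith+
    then have "f a = c" "f b = c" using t by auto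
    then show "a \<in> convex hull {x \<in> V. f x = c}" "b \<in> convex hull {x \<in> V. f x = c}"
      using a b by (auto simp: eq)
  qed
qed

abbreviation keys :: "(nat \<Rightarrow>\<^sub>0 real) \<Rightarrow> nat set" where
  "keys \<equiv> Poly_Mapping.keys"

lemma inj_on_keys: "inj_on keys (hypercube n)"
  using bij_betw_keys_hypercube bij_betw_imp_inj_on by blast

lemma lookup_scaleR: "Poly_Mapping.lookup (r *\<^sub>R x) i = r * Poly_Mapping.lookup x i"
  for x :: "nat \<Rightarrow>\<^sub>0 real"
proof -
  have "finite {i. r *\<^sub>R Poly_Mapping.lookup x i \<noteq> 0}"
    by (rule finite_subset[of _ "keys x"]) (auto simp: in_keys_iff)
  then show ?thesis by (simp add: scaleR_poly_mapping_def)
qed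

text \<open>Reflecting the cube so that \<open>a\<close> becomes the origin turns arbitrary
  coordinate weights into a functional of the difference set from \<open>a\<close>. A reflected
  coordinate enters \<open>L\<close> with the opposite sign, and \<open>L a\<close> absorbs the
  constant.\<close>

lemma relative_functional:
  assumes a: "a \<in> hypercube n"
  obtains L :: "(nat \<Rightarrow>\<^sub>0 real) \<Rightarrow> real"
    where "linear L" "\<And>w. w \<in> hypercube n \<Longrightarrow> L w = L a + (\<Sum>i\<in>keys w \<triangle> keys a. d i)"
proof
  define L :: "(nat \<Rightarrow>\<^sub>0 real) \<Rightarrow> real"
    where "L = (\<lambda>x. \<Sum>i<n. (if i \<in> keys a then - d i else d i) * Poly_Mapping.lookup x i)"
  show "linear L"
  proof (rule linearI)
    show "L (x + y) = L x + L y" for x y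
      unfolding L_def lookup_add by (simp only: distrib_left sum.distrib)
    show "L (r *\<^sub>R x) = r *\<^sub>R L x" for r x
      unfolding L_def by (simp add: lookup_scaleR sum_distrib_left mult_ac)
  qed
  fix w assume w: "w \<in> hypercube n"
  have lk: "Poly_Mapping.lookup x i = of_bool (i \<in> keys x)" if "x \<in> hypercube n" for x i
    using that by (auto simp: hypercube_def in_keys_iff)
  have "L w - L a = (\<Sum>i<n. if i \<in> keys w \<triangle> keys a then d i else 0)"
    unfolding L_def sum_subtractf[symmetric] by (intro sum.cong) (auto simp: lk[OF w] lk[OF a])
  also have "\<dots> = (\<Sum>i\<in>keys w \<triangle> keys a. d i)"
    using w a by (subst sum.inter_restrict[symmetric]) (auto simp: hypercube_def intro!: sum.cong)
  finally show "L w = L a + (\<Sum>i\<in>keys w \<triangle> keys a. d i)" by simp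
qed

text \<open>On cube points, minus the Hamming distance to \<open>v\<close> is linear up to a
  constant, and it is maximal only at \<open>v\<close>.\<close>

lemma hypercube_point_face:
  assumes V: "V \<subseteq> hypercube n" and v: "v \<in> V"
  shows "{v} face_of convex hull V"
proof -
  have finV: "finite V" using V finite_hypercube finite_subset by blast
  obtain L :: "(nat \<Rightarrow>\<^sub>0 real) \<Rightarrow> real" where L: "linear L"
    "\<And>w. w \<in> hypercube n \<Longrightarrow> L w = L v + (\<Sum>i\<in>keys w \<triangle> keys v. -1)"
    using relative_functional[of v n "\<lambda>_. -1"] V v by auto
  have fin: "finite (keys w \<triangle> keys v)" for w by (auto simp: symdiff_def)
  have Lw: "L w = L v - real (card (keys w \<triangle> keys v))" if "w \<in> V" for w
    using L(2)[of w] that V by auto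
  have "convex hull {x \<in> V. L x = L v} face_of convex hull V"
    by (rule convex_hull_level_face[OF L(1) finV]) (simp add: Lw)
  moreover have "{x \<in> V. L x = L v} = {v}"
  proof -
    have "x = v" if x: "x \<in> V" "L x = L v" for x
    proof -
      have "card (keys x \<triangle> keys v) = 0" using Lw[OF x(1)] x(2) by simp
      then have "keys x = keys v" using fin[of x] by (simp only: card_0_eq symdiff_eq_empty)
      then show ?thesis using inj_onD[OF inj_on_keys[of n]] V v x(1) by blast
    qed
    then show ?thesis using v by blast
  qed
  ultimately show ?thesis by simp
qed

lemma has_aff_dim_0_iff: "has_aff_dim F 0 \<longleftrightarrow> (\<exists>v. F = {v})"
proof
  assume "has_aff_dim F 0"
  then obtain B where B: "card B = 1" "affine hull B = affine hull F" by (auto simp: has_aff_dim_def)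
  then obtain v where "B = {v}" by (auto simp: card_1_singleton_iff)
  then have F: "affine hull F = {v}" using B hull_same[of affine "{v}"] by simp
  then have "F \<noteq> {}" by auto
  moreover have "F \<subseteq> {v}" using hull_subset[of F affine] F by simp
  ultimately show "\<exists>v. F = {v}" by blast
next
  assume "\<exists>v. F = {v}"
  then show "has_aff_dim F 0"
    unfolding has_aff_dim_def by (auto intro!: exI[of _ F])
qed

lemma skeleton_verts_hypercube:
  assumes V: "V \<subseteq> hypercube n"
  shows "skeleton_verts (convex hull V) = (\<lambda>v. {v}) ` V"
proof -
  have "v \<in> V" if "{v} face_of convex hull V" for v
    using that extreme_point_of_convex_hull face_of_singleton by blast
  then show ?thesis
    using hypercube_point_face[OF V] by (auto simp: skeleton_verts_def has_aff_dim_0_iff)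
qed

text \<open>Measure coordinates relative to \<open>a\<close>. If \<open>w \<triangle> a \<subseteq> a \<triangle> b\<close> fails, the functional
  \<open>- 2 (\<Sum>i\<notin>a \<triangle> b. x\<^sub>i) - x\<^sub>j + x\<^sub>k\<close> is negative at \<open>w\<close>; the condition below makes it negative
  at the remaining sampled points as well, so it exposes the edge from \<open>a\<close> to \<open>b\<close>. The case
  \<open>j = k\<close> says that no other sampled point lies in the subcube spanned by \<open>a\<close> and \<open>b\<close>.\<close>

definition cube_adj :: "nat set set \<Rightarrow> nat set \<Rightarrow> nat set \<Rightarrow> bool" where
  "cube_adj V a b \<longleftrightarrow> a \<noteq> b \<and> (\<exists>j\<in>a \<triangle> b. \<exists>k\<in>a \<triangle> b. \<forall>w\<in>V. w \<triangle> a \<subseteq> a \<triangle> b \<longrightarrow>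
     w = a \<or> w = b \<or> (j \<in> w \<triangle> a \<and> k \<notin> w \<triangle> a))"

lemma cube_adj_imp_skeleton_edge:
  assumes V: "V \<subseteq> hypercube n" and a: "a \<in> V" and b: "b \<in> V"
    and adj: "cube_adj (keys ` V) (keys a) (keys b)"
  shows "{{a}, {b}} \<in> skeleton_edges (convex hull V)"
proof -
  have finV: "finite V" using V finite_hypercube finite_subset by blast
  have ab: "a \<noteq> b" using adj by (auto simp: cube_adj_def)
  define Q where "Q = keys a \<triangle> keys b"
  have "\<exists>j\<in>Q. \<exists>k\<in>Q. \<forall>w\<in>keys ` V. w \<triangle> keys a \<subseteq> Q \<longrightarrow>
      w = keys a \<or> w = keys b \<or> (j \<in> w \<triangle> keys a \<and> k \<notin> w \<triangle> keys a)"
    using adj unfolding cube_adj_def Q_def by (rule conjunct2)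
  then obtain j k where jk: "j \<in> Q" "k \<in> Q" and w0: "\<forall>w\<in>keys ` V. w \<triangle> keys a \<subseteq> Q \<longrightarrow>
      w = keys a \<or> w = keys b \<or> (j \<in> w \<triangle> keys a \<and> k \<notin> w \<triangle> keys a)"
    by (elim bexE)
  have w: "keys w = keys a \<or> keys w = keys b \<or> (j \<in> keys w \<triangle> keys a \<and> k \<notin> keys w \<triangle> keys a)"
    if "w \<in> V" "keys w \<triangle> keys a \<subseteq> Q" for w
    using w0[rule_format, of "keys w"] that by (simp only: imageI simp_thms)
  \<comment> \<open>The weight -2 off \<open>Q\<close> outweighs the possible +1 from
    \<open>k\<close>, so leaving the subcube always makes the value negative. For
    \<open>j = k\<close> the two unit terms cancel.\<close>
  define d where "d = (\<lambda>i. (if i \<in> Q then 0 else -2) - of_bool (i = j) + of_bool (i = k) :: real)"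
  obtain L :: "(nat \<Rightarrow>\<^sub>0 real) \<Rightarrow> real" where L: "linear L"
    "\<And>w. w \<in> hypercube n \<Longrightarrow> L w = L a + (\<Sum>i\<in>keys w \<triangle> keys a. d i)"
    using relative_functional[of a n d] V a by auto
  have fin: "finite (keys w \<triangle> keys a)" for w by (auto simp: symdiff_def)
  have Lw: "L w = L a - 2 * real (card (keys w \<triangle> keys a - Q))
      - of_bool (j \<in> keys w \<triangle> keys a) + of_bool (k \<in> keys w \<triangle> keys a)" if "w \<in> V" for w
  proof -
    have "(\<Sum>i\<in>keys w \<triangle> keys a. if i \<in> Q then 0 else -2 :: real) = - 2 * real (card (keys w \<triangle> keys a - Q))"
      using fin[of w] by (subst sum.If_cases) (auto simp: Diff_eq)
    moreover have "(\<Sum>i\<in>keys w \<triangle> keys a. of_bool (i = x) :: real) = of_bool (x \<in> keys w \<triangle> keys a)" for x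
      using fin[of w] by (auto simp: of_bool_def sum.delta simp del: in_symdiff_iff)
    ultimately show ?thesis
      using L(2)[of w] that V unfolding d_def sum.distrib sum_subtractf by auto
  qed
  have inj: "x = y" if "x \<in> V" "y \<in> V" "keys x = keys y" for x y
    using inj_on_keys[of n] V that by (auto simp: inj_on_def)
  have Lb: "L b = L a"
    using Lw[OF b] jk by (simp add: Q_def symdiff_commute[of "keys b"])
  have key: "L x < L a" if "x \<in> V" "x \<noteq> a" "x \<noteq> b" for x
  proof (cases "keys x \<triangle> keys a \<subseteq> Q")
    case True
    then have "j \<in> keys x \<triangle> keys a \<and> k \<notin> keys x \<triangle> keys a"
      using w[of x] inj that a b by metis
    then show ?thesis using Lw[OF that(1)] by (simp del: in_symdiff_iff)
  next
    case False
    then have "card (keys x \<triangle> keys a - Q) \<noteq> 0"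
      using fin[of x] by (auto simp: card_eq_0_iff)
    then show ?thesis using Lw[OF that(1)] by (auto simp del: in_symdiff_iff split: if_splits)
  qed
  have "convex hull {x \<in> V. L x = L a} face_of convex hull V"
    by (rule convex_hull_level_face[OF L(1) finV]) (metis key Lb order_refl less_imp_le)
  moreover have lev: "{x \<in> V. L x = L a} = {a, b}"
    using key Lb a b by force
  ultimately have face: "convex hull {a, b} face_of convex hull V" by simp
  have dim: "has_aff_dim (convex hull {a, b}) 1"
    unfolding has_aff_dim_def
    by (rule exI[of _ "{a, b}"]) (use ab in auto)
  have "v \<in> {a, b}" if "v \<in> V" "v \<in> convex hull {a, b}" for v
  proof -
    have "convex (L -` {L a})" by (rule convex_linear_vimage[OF L(1)]) simp
    then have "convex hull {a, b} \<subseteq> L -` {L a}" using Lb by (intro hull_minimal) auto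
    then show ?thesis using that lev by auto
  qed
  then have "{F \<in> skeleton_verts (convex hull V). F \<subseteq> convex hull {a, b}} = {{a}, {b}}"
    unfolding skeleton_verts_hypercube[OF V] using a b hull_inc[of _ "{a, b}" convex] by auto
  then show ?thesis
    unfolding skeleton_edges_def mem_Collect_eq using face dim
    by (intro exI[of _ "convex hull {a, b}"] conjI) simp_all
qed

text \<open>\<open>cube_adj\<close> is only a sufficient condition for adjacency, which is enough
  for bounding boundaries from below. Ordered pairs leading out of \<open>U\<close> map injectively
  to unordered edges, since only the first entry lies in \<open>U\<close>.\<close>

lemma polytope_expansion_ge:
  assumes V: "V \<subseteq> hypercube n" and card: "2 \<le> card V"
    and exp: "\<And>U. U \<subseteq> keys ` V \<Longrightarrow> U \<noteq> {} \<Longrightarrow> 2 * card U \<le> card (keys ` V) \<Longrightarrow>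
      K * real (card U) \<le> real (card {(a, b). a \<in> U \<and> b \<in> keys ` V - U \<and> cube_adj (keys ` V) a b})"
  shows "K \<le> polytope_expansion (convex hull V)"
proof -
  have finV: "finite V" using V finite_hypercube finite_subset by blast
  let ?P = "convex hull V"
  define sg where "sg = (\<lambda>v :: nat \<Rightarrow>\<^sub>0 real. {v})"
  have verts: "skeleton_verts ?P = sg ` V" using skeleton_verts_hypercube[OF V] by (simp add: sg_def)
  have injsg: "inj_on sg A" for A by (auto simp: sg_def inj_on_def)
  have finE: "finite (skeleton_edges ?P)"
    by (rule finite_subset[of _ "Pow (skeleton_verts ?P)"]) (auto simp: skeleton_edges_def verts finV)
  have injk: "inj_on keys V" using inj_on_keys V inj_on_subset by blast
  define q where "q = (\<lambda>U. real (card (edge_boundary (skeleton_edges ?P) U)) / real (card U))"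
  define Fam where "Fam = {U. U \<subseteq> sg ` V \<and> 1 \<le> card U \<and> real (card U) \<le> real (card (sg ` V)) / 2}"
  have expansion_eq: "polytope_expansion ?P = Min (q ` Fam)"
    unfolding polytope_expansion_def edge_expansion_def verts q_def Fam_def by (simp only: setcompr_eq_image)
  have finR: "finite (q ` Fam)"
    by (rule finite_imageI, rule finite_subset[of _ "Pow (sg ` V)"]) (use finV in \<open>auto simp: Fam_def\<close>)
  obtain v where v: "v \<in> V" using card by fastforce
  have "{sg v} \<in> Fam"
    using v card card_image[OF injsg, of V] by (auto simp: Fam_def)
  then have "q ` Fam \<noteq> {}" by auto
  moreover have "K \<le> r" if r: "r \<in> q ` Fam" for r
  proof -
    obtain W where WF: "W \<in> Fam" and rW: "r = q W" using r by auto
    then have W: "W \<subseteq> sg ` V" "1 \<le> card W" "real (card W) \<le> real (card (sg ` V)) / 2"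
      "r = real (card (edge_boundary (skeleton_edges ?P) W)) / real (card W)"
      by (simp_all add: Fam_def q_def)
    obtain X where X: "X \<subseteq> V" "W = sg ` X" using W(1) by (auto simp: subset_image_iff)
    have cW: "card W = card X" using card_image[OF injsg] X by simp
    have injX: "inj_on keys X" using injk X inj_on_subset by blast
    have cX: "card (keys ` X) = card X" by (rule card_image[OF injX])
    have "2 * card X \<le> card V"
      using W(3) cW card_image[OF injsg, of V] by linarith
    moreover have "X \<noteq> {}" using W(2) cW by auto
    ultimately have 1: "K * real (card X) \<le> real (card {(a, b). a \<in> keys ` X \<and> b \<in> keys ` V - keys ` X \<and> cube_adj (keys ` V) a b})"
      using X(1) card_image[OF injk] unfolding cX[symmetric] by (intro exp) auto
    let ?A = "{(a, b). a \<in> X \<and> b \<in> V - X \<and> cube_adj (keys ` V) (keys a) (keys b)}"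
    have finA: "finite ?A"
      by (rule finite_subset[of _ "V \<times> V"]) (use X finV in auto)
    have "{(a, b). a \<in> keys ` X \<and> b \<in> keys ` V - keys ` X \<and> cube_adj (keys ` V) a b} \<subseteq> (\<lambda>(a, b). (keys a, keys b)) ` ?A"
      by force
    then have 2: "card {(a, b). a \<in> keys ` X \<and> b \<in> keys ` V - keys ` X \<and> cube_adj (keys ` V) a b} \<le> card ?A"
      using finA by (meson card_image_le card_mono finite_imageI order_trans)
    have "inj_on (\<lambda>(a, b). {sg a, sg b}) ?A"
      by (auto simp: inj_on_def doubleton_eq_iff sg_def)
    then have "card ?A = card ((\<lambda>(a, b). {sg a, sg b}) ` ?A)"
      by (simp add: card_image)
    also have "\<dots> \<le> card (edge_boundary (skeleton_edges ?P) W)"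
    proof (rule card_mono)
      show "finite (edge_boundary (skeleton_edges ?P) W)"
        using finE by (simp add: edge_boundary_def)
      show "(\<lambda>(a, b). {sg a, sg b}) ` ?A \<subseteq> edge_boundary (skeleton_edges ?P) W"
      proof clarify
        fix a b assume ab: "a \<in> X" "b \<in> V" "b \<notin> X" "cube_adj (keys ` V) (keys a) (keys b)"
        have "{sg a, sg b} \<inter> W = {sg a}" using ab X by (auto simp: sg_def)
        moreover have "{sg a, sg b} \<in> skeleton_edges ?P"
          using cube_adj_imp_skeleton_edge[OF V _ ab(2) ab(4)] ab X by (auto simp: sg_def)
        ultimately show "{sg a, sg b} \<in> edge_boundary (skeleton_edges ?P) W"
          by (simp add: edge_boundary_def)
      qed
    qed
    finally have "K * real (card X) \<le> real (card (edge_boundary (skeleton_edges ?P) W))"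
      using 1 2 by linarith
    moreover have "real (card X) > 0" using W(2) cW by simp
    ultimately show ?thesis unfolding W(4) cW by (simp add: pos_le_divide_eq)
  qed
  ultimately show ?thesis
    unfolding expansion_eq using finR by (subst Min_ge_iff) auto
qed

section \<open>Random subsets\<close>

definition random_subset :: "'a set \<Rightarrow> real \<Rightarrow> 'a set pmf" where
  "random_subset \<Omega> p = map_pmf (\<lambda>s. {x \<in> \<Omega>. s x}) (Pi_pmf \<Omega> False (\<lambda>_. bernoulli_pmf p))"

lemma map_keys_random_vertices:
  "map_pmf (image Poly_Mapping.keys) (random_vertices n q) = random_subset (Pow {..<n}) q"
proof -
  \<comment> \<open>The transport of product measures along \<open>h\<close> also wants points
    outside the domain to miss the codomain; \<open>{n}\<close> is a value outside
    \<open>Pow {..<n}\<close>.\<close>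
  define h where "h = (\<lambda>x :: nat \<Rightarrow>\<^sub>0 real. if x \<in> hypercube n then Poly_Mapping.keys x else {n})"
  have bij: "bij_betw h (hypercube n) (Pow {..<n})"
    using bij_betw_keys_hypercube[of n] by (subst bij_betw_cong[of _ _ Poly_Mapping.keys]) (auto simp: h_def)
  have "Pi_pmf (hypercube n) False (\<lambda>_. bernoulli_pmf q)
      = map_pmf (\<lambda>g. g \<circ> h) (Pi_pmf (Pow {..<n}) False (\<lambda>_. bernoulli_pmf q))"
    by (rule Pi_pmf_bij_betw[OF finite_hypercube bij]) (auto simp: h_def)
  moreover have "Poly_Mapping.keys ` {x \<in> hypercube n. (g \<circ> h) x} = {y \<in> Pow {..<n}. g y}" for g
  proof -
    have "Poly_Mapping.keys ` {x \<in> hypercube n. (g \<circ> h) x} = {y \<in> Poly_Mapping.keys ` hypercube n. g y}"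
      by (auto simp: h_def)
    then show ?thesis using bij_betw_imp_surj_on[OF bij_betw_keys_hypercube[of n]] by simp
  qed
  ultimately show ?thesis
    unfolding random_vertices_def random_subset_def by (simp add: pmf.map_comp o_def)
qed

context
  fixes \<Omega> :: "'a set" and p :: real
  assumes fin: "finite \<Omega>" and p: "0 \<le> p" "p \<le> 1"
begin

lemma set_random_subset: "set_pmf (random_subset \<Omega> p) \<subseteq> Pow \<Omega>"
  by (auto simp: random_subset_def)

lemma integrable_random_subset [simp]:
  "integrable (measure_pmf (random_subset \<Omega> p)) (f :: _ \<Rightarrow> real)"
  by (rule integrable_measure_pmf_finite) (use set_random_subset fin finite_subset in blast)

lemma prob_random_subset_superset:
  assumes "A \<subseteq> \<Omega>"
  shows "measure_pmf.prob (random_subset \<Omega> p) {V. A \<subseteq> V} = p ^ card A"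
proof -
  have "measure_pmf.prob (random_subset \<Omega> p) {V. A \<subseteq> V}
      = measure_pmf.prob (Pi_pmf \<Omega> False (\<lambda>_. bernoulli_pmf p)) (Pi \<Omega> (\<lambda>x. if x \<in> A then {True} else UNIV))"
    unfolding random_subset_def measure_map_pmf using assms
    by (intro arg_cong[where f = "measure_pmf.prob _"]) (auto simp: Pi_def split: if_splits)
  also have "\<dots> = (\<Prod>x\<in>\<Omega>. if x \<in> A then p else 1)"
    using p by (subst measure_Pi_pmf_Pi[OF fin]) (auto intro!: prod.cong simp: measure_pmf_single)
  also have "\<dots> = p ^ card A"
    using assms fin by (simp add: prod.If_cases Int_absorb1)
  finally show ?thesis .
qed

text \<open>Supplies the exponential moment for the lower tail. Independence of the sampled points
  enters only here and in \<open>prob_random_subset_superset\<close>.\<close>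

lemma expectation_random_subset_prod:
  fixes g :: "'a \<Rightarrow> real"
  assumes "\<And>x. g x \<ge> 0"
  shows "measure_pmf.expectation (random_subset \<Omega> p) (\<lambda>V. \<Prod>x\<in>\<Omega>. if x \<in> V then g x else 1)
    = (\<Prod>x\<in>\<Omega>. 1 - p + p * g x)"
proof -
  have "measure_pmf.expectation (random_subset \<Omega> p) (\<lambda>V. \<Prod>x\<in>\<Omega>. if x \<in> V then g x else 1)
      = measure_pmf.expectation (Pi_pmf \<Omega> False (\<lambda>_. bernoulli_pmf p)) (\<lambda>s. \<Prod>x\<in>\<Omega>. if s x then g x else 1)"
    unfolding random_subset_def by (simp cong: prod.cong)
  also have "\<dots> = (\<Prod>x\<in>\<Omega>. measure_pmf.expectation (bernoulli_pmf p) (\<lambda>v. if v then g x else 1))"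
    by (rule expectation_prod_Pi_pmf[OF fin]) (use assms in \<open>auto intro: integrable_measure_pmf_finite\<close>)
  also have "\<dots> = (\<Prod>x\<in>\<Omega>. 1 - p + p * g x)"
    using p by (intro prod.cong) auto
  finally show ?thesis .
qed

text \<open>Expand the power one factor at a time: each further factor costs at most the expected count
  conditioned on the presence of the boundedly many points selected so far.\<close>

lemma expectation_power_le:
  fixes \<tau> :: "'f \<Rightarrow> 'a set"
  assumes finF: "finite F" and \<tau>: "\<And>f. f \<in> F \<Longrightarrow> \<tau> f \<subseteq> \<Omega>" "\<And>f. f \<in> F \<Longrightarrow> card (\<tau> f) \<le> h"
    and mu: "\<mu> \<ge> 0"
    and cond: "\<And>A. A \<subseteq> \<Omega> \<Longrightarrow> card A \<le> h * m \<Longrightarrow> (\<Sum>f\<in>F. p ^ card (\<tau> f - A)) \<le> \<mu>"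
  shows "measure_pmf.expectation (random_subset \<Omega> p) (\<lambda>V. real (card {f \<in> F. \<tau> f \<subseteq> V}) ^ m) \<le> \<mu> ^ m"
proof -
  define T where "T = (\<lambda>V. real (card {f \<in> F. \<tau> f \<subseteq> V}))"
  have "measure_pmf.expectation (random_subset \<Omega> p) (\<lambda>V. of_bool (A \<subseteq> V) * T V ^ j) \<le> p ^ card A * \<mu> ^ j"
    if "A \<subseteq> \<Omega>" "card A + h * j \<le> h * m" for A j
    using that
  proof (induction j arbitrary: A)
    case 0
    have "measure_pmf.expectation (random_subset \<Omega> p) (\<lambda>V. of_bool (A \<subseteq> V)) = p ^ card A"
    proof -
      have "(\<lambda>V. of_bool (A \<subseteq> V) :: real) = indicator {V. A \<subseteq> V}"
        by (auto simp: fun_eq_iff indicator_def)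
      then show ?thesis using prob_random_subset_superset[OF 0(1)] by simp
    qed
    then show ?case by simp
  next
    case (Suc j)
    have finA: "finite A" using Suc.prems fin finite_subset by blast
    have "of_bool (A \<subseteq> V) * T V ^ Suc j = (\<Sum>f\<in>F. of_bool (A \<union> \<tau> f \<subseteq> V) * T V ^ j)" for V
    proof -
      have "T V = (\<Sum>f\<in>F. of_bool (\<tau> f \<subseteq> V))"
        unfolding T_def using finF by (simp add: Int_def)
      then have "of_bool (A \<subseteq> V) * T V ^ Suc j = (\<Sum>f\<in>F. of_bool (A \<subseteq> V) * of_bool (\<tau> f \<subseteq> V) * T V ^ j)"
        by (simp add: sum_distrib_left sum_distrib_right mult_ac)
      then show ?thesis by (simp add: of_bool_conj[symmetric])
    qed
    then have "measure_pmf.expectation (random_subset \<Omega> p) (\<lambda>V. of_bool (A \<subseteq> V) * T V ^ Suc j)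
        = (\<Sum>f\<in>F. measure_pmf.expectation (random_subset \<Omega> p) (\<lambda>V. of_bool (A \<union> \<tau> f \<subseteq> V) * T V ^ j))"
      by (simp only: integrable_random_subset Bochner_Integration.integral_sum)
    also have "\<dots> \<le> (\<Sum>f\<in>F. p ^ card (A \<union> \<tau> f) * \<mu> ^ j)"
    proof (intro sum_mono Suc.IH)
      fix f assume f: "f \<in> F"
      show "A \<union> \<tau> f \<subseteq> \<Omega>" using Suc.prems \<tau>(1)[OF f] by auto
      show "card (A \<union> \<tau> f) + h * j \<le> h * m"
        using card_Un_le[of A "\<tau> f"] \<tau>(2)[OF f] Suc.prems(2) by simp
    qed
    also have "\<dots> = p ^ card A * \<mu> ^ j * (\<Sum>f\<in>F. p ^ card (\<tau> f - A))"
    proof -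
      have "card (A \<union> \<tau> f) = card A + card (\<tau> f - A)" if "f \<in> F" for f
      proof -
        have "finite (\<tau> f)" using \<tau>(1)[OF that] fin finite_subset by blast
        then have "card (A \<union> (\<tau> f - A)) = card A + card (\<tau> f - A)"
          using finA by (intro card_Un_disjoint) auto
        then show ?thesis by simp
      qed
      then show ?thesis by (simp add: sum_distrib_left power_add mult_ac)
    qed
    also have "\<dots> \<le> p ^ card A * \<mu> ^ j * \<mu>"
      using Suc.prems p mu by (intro mult_left_mono cond) auto
    finally show ?case by (simp add: mult_ac)
  qed
  from this[of "{}" m] show ?thesis by (simp add: T_def)
qed

text \<open>Markov's inequality for the \<open>m\<close>-th power. With \<open>t = 2 * \<mu>\<close>
  and \<open>m = 4 * n\<close> the bound becomes \<open>(1/2) ^ (4 * n)\<close>, although the sets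
  \<open>\<tau> f\<close> may overlap. The exposed set \<open>A\<close> has up to
  \<open>h * m\<close> points because \<open>m\<close> chosen members reveal no more than
  that.\<close>

lemma prob_count_ge:
  fixes \<tau> :: "'f \<Rightarrow> 'a set"
  assumes "finite F" "\<And>f. f \<in> F \<Longrightarrow> \<tau> f \<subseteq> \<Omega>" "\<And>f. f \<in> F \<Longrightarrow> card (\<tau> f) \<le> h" "\<mu> \<ge> 0"
    and "\<And>A. A \<subseteq> \<Omega> \<Longrightarrow> card A \<le> h * m \<Longrightarrow> (\<Sum>f\<in>F. p ^ card (\<tau> f - A)) \<le> \<mu>"
    and t: "t > 0"
  shows "measure_pmf.prob (random_subset \<Omega> p) {V. t \<le> real (card {f \<in> F. \<tau> f \<subseteq> V})} \<le> (\<mu> / t) ^ m"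
proof -
  let ?T = "\<lambda>V. real (card {f \<in> F. \<tau> f \<subseteq> V})"
  have "t ^ m * measure_pmf.prob (random_subset \<Omega> p) {V. t \<le> ?T V}
      = measure_pmf.expectation (random_subset \<Omega> p) (\<lambda>V. t ^ m * indicator {V. t \<le> ?T V} V)"
    by simp
  also have "\<dots> \<le> measure_pmf.expectation (random_subset \<Omega> p) (\<lambda>V. ?T V ^ m)"
    using t by (intro integral_mono integrable_random_subset) (auto simp: indicator_def intro: power_mono)
  also have "\<dots> \<le> \<mu> ^ m" by (rule expectation_power_le) (use assms in auto)
  finally show ?thesis using t by (simp add: field_simps power_divide)
qed

text \<open>The Taylor bound for \<open>exp u\<close> times 1 - u + u^2 / 2 equals 1 + u^4 / 4,
  hence is at least 1.\<close>

lemma exp_minus_le_quadratic: "exp (- u) \<le> 1 - u + u\<^sup>2 / 2" if "u \<ge> 0" for u :: real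
proof -
  have "1 + u + u\<^sup>2 / 2 \<le> exp u" by (rule exp_lower_Taylor_quadratic[OF that])
  moreover have pos: "0 \<le> 1 - u + u\<^sup>2 / 2"
    using zero_le_power2[of "u - 1"] by (simp add: power2_eq_square algebra_simps)
  ultimately have "(1 + u + u\<^sup>2 / 2) * (1 - u + u\<^sup>2 / 2) \<le> exp u * (1 - u + u\<^sup>2 / 2)"
    by (rule mult_right_mono)
  moreover have "(1 + u + u\<^sup>2 / 2) * (1 - u + u\<^sup>2 / 2) = 1 + (u\<^sup>2)\<^sup>2 / 4"
    by (simp add: power2_eq_square algebra_simps)
  ultimately have "1 \<le> exp u * (1 - u + u\<^sup>2 / 2)"
    using zero_le_power2[of "u\<^sup>2"] by linarith
  then show ?thesis by (simp add: exp_minus field_simps)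
qed

text \<open>Chernoff's lower tail, tilted by \<open>\<delta>\<close> itself instead of the optimal
  -ln (1 - \<delta>), which already gives the exponent \<delta>^2 M / 2. Weights in [0, 1] enter
  through c^2 \<le> c.\<close>

lemma prob_weight_le:
  fixes c :: "'a \<Rightarrow> real" and \<delta> :: real
  defines "M \<equiv> p * (\<Sum>x\<in>\<Omega>. c x)"
  assumes c: "\<And>x. 0 \<le> c x" "\<And>x. c x \<le> 1" and d: "0 \<le> \<delta>"
  shows "measure_pmf.prob (random_subset \<Omega> p) {V. (\<Sum>x\<in>\<Omega> \<inter> V. c x) \<le> (1 - \<delta>) * M} \<le> exp (- (\<delta>\<^sup>2 * M / 2))"
proof -
  let ?X = "\<lambda>V. \<Sum>x\<in>\<Omega> \<inter> V. c x"
  have "exp (- (\<delta> * ((1 - \<delta>) * M))) * measure_pmf.prob (random_subset \<Omega> p) {V. ?X V \<le> (1 - \<delta>) * M}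
      = measure_pmf.expectation (random_subset \<Omega> p)
          (\<lambda>V. exp (- (\<delta> * ((1 - \<delta>) * M))) * indicator {V. ?X V \<le> (1 - \<delta>) * M} V)"
    by simp
  also have "\<dots> \<le> measure_pmf.expectation (random_subset \<Omega> p) (\<lambda>V. exp (- (\<delta> * ?X V)))"
    using d by (intro integral_mono integrable_random_subset) (auto simp: indicator_def intro: mult_left_mono)
  also have "(\<lambda>V. exp (- (\<delta> * ?X V))) = (\<lambda>V. \<Prod>x\<in>\<Omega>. if x \<in> V then exp (- (\<delta> * c x)) else 1)"
  proof
    fix V
    have "exp (- (\<delta> * ?X V)) = (\<Prod>x\<in>\<Omega> \<inter> V. exp (- (\<delta> * c x)))"
      using fin by (simp add: exp_sum[symmetric] sum_distrib_left sum_negf)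
    then show "exp (- (\<delta> * ?X V)) = (\<Prod>x\<in>\<Omega>. if x \<in> V then exp (- (\<delta> * c x)) else 1)"
      using fin by (simp add: prod.inter_restrict)
  qed
  also have "measure_pmf.expectation (random_subset \<Omega> p) (\<lambda>V. \<Prod>x\<in>\<Omega>. if x \<in> V then exp (- (\<delta> * c x)) else 1)
      = (\<Prod>x\<in>\<Omega>. 1 - p + p * exp (- (\<delta> * c x)))"
    by (rule expectation_random_subset_prod) simp
  also have "\<dots> \<le> (\<Prod>x\<in>\<Omega>. exp (- (p * (\<delta> - \<delta>\<^sup>2 / 2) * c x)))"
  proof (rule prod_mono)
    fix x
    have "exp (- (\<delta> * c x)) \<le> 1 - \<delta> * c x + (\<delta> * c x)\<^sup>2 / 2"
      using c d by (intro exp_minus_le_quadratic) auto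
    also have "(\<delta> * c x)\<^sup>2 \<le> \<delta>\<^sup>2 * c x"
      using c[of x] unfolding power_mult_distrib
      by (intro mult_left_mono) (auto simp: power2_eq_square mult_left_le_one_le)
    finally have "exp (- (\<delta> * c x)) - 1 \<le> - ((\<delta> - \<delta>\<^sup>2 / 2) * c x)" by (simp add: algebra_simps)
    from mult_left_mono[OF this p(1)]
    have "1 - p + p * exp (- (\<delta> * c x)) \<le> 1 + - (p * (\<delta> - \<delta>\<^sup>2 / 2) * c x)" by (simp add: algebra_simps)
    also have "\<dots> \<le> exp (- (p * (\<delta> - \<delta>\<^sup>2 / 2) * c x))" by (rule exp_ge_add_one_self)
    finally show "0 \<le> 1 - p + p * exp (- (\<delta> * c x)) \<and> 1 - p + p * exp (- (\<delta> * c x)) \<le> exp (- (p * (\<delta> - \<delta>\<^sup>2 / 2) * c x))"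
      using p by simp
  qed
  also have "\<dots> = exp (- ((\<delta> - \<delta>\<^sup>2 / 2) * M))"
    using fin by (simp add: exp_sum[symmetric] sum_negf M_def sum_distrib_left sum_distrib_right mult_ac)
  finally have "measure_pmf.prob (random_subset \<Omega> p) {V. ?X V \<le> (1 - \<delta>) * M}
      \<le> exp (- ((\<delta> - \<delta>\<^sup>2 / 2) * M)) / exp (- (\<delta> * ((1 - \<delta>) * M)))"
    by (simp add: field_simps)
  also have "\<dots> = exp (- (\<delta>\<^sup>2 * M / 2))"
    by (simp add: exp_diff[symmetric] algebra_simps power2_eq_square)
  finally show ?thesis .
qed

end

section \<open>Samples of the cube\<close>

lemma card_le_fibres:
  assumes "finite F" "finite X" "\<And>f. f \<in> F \<Longrightarrow> \<pi> f \<in> X"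
    and "\<And>x. x \<in> X \<Longrightarrow> real (card {f \<in> F. \<pi> f = x}) \<le> C"
  shows "real (card F) \<le> real (card X) * C"
proof -
  have "F = (\<Union>x\<in>X. {f \<in> F. \<pi> f = x})" using assms(3) by auto
  then have "card F \<le> (\<Sum>x\<in>X. card {f \<in> F. \<pi> f = x})"
    by (metis card_UN_le[OF assms(2)])
  then have "real (card F) \<le> (\<Sum>x\<in>X. real (card {f \<in> F. \<pi> f = x}))"
    unfolding of_nat_sum[symmetric] of_nat_le_iff .
  also have "\<dots> \<le> (\<Sum>x\<in>X. C)" by (rule sum_mono) (rule assms(4))
  finally show ?thesis by simp
qed

lemma card_le_fibres':
  assumes "finite F" "finite X" "\<And>f. f \<in> F \<Longrightarrow> \<pi> f \<in> X" "real (card X) \<le> L" "C \<ge> 0"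
    and "\<And>x. x \<in> X \<Longrightarrow> real (card {f \<in> F. \<pi> f = x}) \<le> C"
  shows "real (card F) \<le> L * C"
proof -
  have "real (card F) \<le> real (card X) * C"
    by (rule card_le_fibres[OF assms(1-3)]) (auto intro: assms(6))
  also have "\<dots> \<le> L * C" by (rule mult_right_mono[OF assms(4,5)])
  finally show ?thesis .
qed

text \<open>The set is the subcube through \<open>a\<close> with directions \<open>q\<close>; for
  \<open>q = a \<triangle> b\<close> it consists of the points between \<open>a\<close> and
  \<open>b\<close>, the candidates for obstructing that pair.\<close>

lemma card_between: "card {w. w \<triangle> a \<subseteq> q} = 2 ^ card q" if "finite q"
  using card_symdiff_translate[of a "Pow q"] that by (simp add: card_Pow)

lemma finite_between: "finite {w. w \<triangle> a \<subseteq> q}" if "finite q"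
proof -
  have "{w. w \<triangle> a \<subseteq> q} \<subseteq> (\<lambda>v. v \<triangle> a) ` Pow q"
    by (auto intro!: image_eqI[of _ _ "_ \<triangle> a"] simp: symdiff_assoc)
  then show ?thesis using that finite_subset by blast
qed

text \<open>Splits one point off a configuration: it costs \<open>p\<close> if it is new and nothing
  if it already lies in \<open>A\<close>. Multiplying out such factors sorts configurations by which
  of their points are exposed.\<close>

lemma power_card_insert_le:
  assumes "0 \<le> p" "p \<le> (1::real)" "x \<notin> B" "finite B"
  shows "p ^ card (insert x B - A) \<le> (p + of_bool (x \<in> A)) * p ^ card (B - A)"
  using assms by (auto simp: insert_Diff_if of_bool_def mult_le_cancel_right1 algebra_simps)

text \<open>\<open>N\<close> is the size of a full translate of \<open>S\<close>, and
  \<open>D\<close> the expected size of a hub.\<close>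

locale cube_sample =
  fixes n :: nat and p :: real and S :: "nat set set" and \<Omega> :: "nat set set" and N D :: real
    and M :: "nat set set pmf"
  assumes n: "n \<ge> 1" and p: "0 < p" "p \<le> 1" and S: "S \<subseteq> Pow {..<n}" "S \<noteq> {}"
  defines "\<Omega> \<equiv> Pow {..<n}" and "N \<equiv> real (card S)" and "D \<equiv> p * N"
    and "M \<equiv> random_subset \<Omega> p"
begin

lemma fin: "finite \<Omega>" by (simp add: \<Omega>_def)

lemma finS: "finite S" using S finite_subset by blast

lemma S_Omega: "S \<subseteq> \<Omega>" using S by (simp add: \<Omega>_def)

lemma N_pos: "N \<ge> 1"
proof -
  have "card S > 0" using S(2) finS by (simp add: card_gt_0_iff)
  then show ?thesis unfolding N_def by linarith
qed

lemma D_pos: "D > 0" using N_pos p by (simp add: D_def)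

lemma card_Omega: "real (card \<Omega>) = 2 ^ n" by (simp add: \<Omega>_def card_Pow)

lemma sdO: "x \<in> \<Omega> \<Longrightarrow> y \<in> \<Omega> \<Longrightarrow> x \<triangle> y \<in> \<Omega>"
  unfolding \<Omega>_def by (rule symdiff_Pow)

lemma finO: "x \<in> \<Omega> \<Longrightarrow> finite x"
  unfolding \<Omega>_def using finite_subset by blast

lemma p0: "0 \<le> p" using p by simp

lemma prob_mono:
  assumes "\<And>V. V \<subseteq> \<Omega> \<Longrightarrow> V \<in> E \<Longrightarrow> V \<in> E'"
  shows "measure_pmf.prob M E \<le> measure_pmf.prob M E'"
proof -
  have "measure_pmf.prob M E = measure_pmf.prob M (E \<inter> set_pmf M)"
    by (rule measure_Int_set_pmf[symmetric])
  also have "\<dots> \<le> measure_pmf.prob M E'"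
    by (rule measure_pmf.finite_measure_mono)
      (use assms set_random_subset[OF fin p0 p(2)] in \<open>auto simp: M_def\<close>)
  finally show ?thesis .
qed

lemma prob_union:
  assumes "finite I" "\<And>i. i \<in> I \<Longrightarrow> measure_pmf.prob M {V. P i V} \<le> c"
  shows "measure_pmf.prob M {V. \<exists>i\<in>I. P i V} \<le> real (card I) * c"
proof -
  have "{V. \<exists>i\<in>I. P i V} = (\<Union>i\<in>I. {V. P i V})" by auto
  then have "measure_pmf.prob M {V. \<exists>i\<in>I. P i V} \<le> (\<Sum>i\<in>I. measure_pmf.prob M {V. P i V})"
    by (simp add: measure_UNION_le[OF assms(1)])
  also have "\<dots> \<le> (\<Sum>i\<in>I. c)" by (rule sum_mono) (rule assms(2))
  finally show ?thesis by simp
qed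

lemma prob_disj: "measure_pmf.prob M {V. P V \<or> Q V} \<le> measure_pmf.prob M {V. P V} + measure_pmf.prob M {V. Q V}"
  using measure_Un_le[of "{V. P V}" "measure_pmf M" "{V. Q V}"] by (simp add: Collect_disj_eq)

text \<open>The moment bound with single points as configurations: among \<open>m\<close> exposed
  points at most \<open>m\<close> candidates come for free, hence the summand \<open>m\<close> next
  to the mean in \<open>\<mu>\<close>.\<close>

lemma prob_hub_part_ge:
  assumes R: "R \<subseteq> S" and z: "z \<in> \<Omega>" and mu: "p * real (card R) + real m \<le> \<mu>" and t: "t > 0"
  shows "measure_pmf.prob M {V. t \<le> real (card {x \<in> V. x \<triangle> z \<in> R})} \<le> (\<mu> / t) ^ m"
proof -
  let ?F = "{x. x \<triangle> z \<in> R}"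
  have FO: "?F \<subseteq> \<Omega>"
  proof
    fix x assume "x \<in> ?F"
    then have "x \<triangle> z \<in> \<Omega>" using R S_Omega by auto
    then show "x \<in> \<Omega>" using sdO[OF _ z, of "x \<triangle> z"] by (simp add: symdiff_assoc)
  qed
  have finF: "finite ?F" using FO fin finite_subset by blast
  have cF: "card ?F = card R" by (rule card_symdiff_translate)
  have finR: "finite R" using R finS finite_subset by blast
  have "measure_pmf.prob M {V. t \<le> real (card {x \<in> ?F. {x} \<subseteq> V})} \<le> (\<mu> / t) ^ m"
    unfolding M_def
  proof (rule prob_count_ge[OF fin p0 p(2), where h = 1])
    show "\<mu> \<ge> 0" using mu p by (smt (verit) mult_nonneg_nonneg of_nat_0_le_iff)
    fix A :: "nat set set" assume A: "A \<subseteq> \<Omega>" "card A \<le> 1 * m"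
    have finA: "finite A" using A fin finite_subset by blast
    have "(\<Sum>f\<in>?F. p ^ card ({f} - A)) \<le> (\<Sum>f\<in>?F. p + of_bool (f \<in> A))"
      by (rule sum_mono) (use p in \<open>auto simp: insert_Diff_if\<close>)
    also have "\<dots> = p * real (card R) + real (card (?F \<inter> A))"
      using finF by (simp add: sum.distrib cF Int_def)
    also have "card (?F \<inter> A) \<le> m"
      using A card_mono[OF finA, of "?F \<inter> A"] by auto
    finally show "(\<Sum>f\<in>?F. p ^ card ({f} - A)) \<le> \<mu>" using mu by simp
  qed (use finF FO t in auto)
  moreover have "{x \<in> V. x \<triangle> z \<in> R} = {x \<in> ?F. {x} \<subseteq> V}" for V by auto
  ultimately show ?thesis by simp
qed

lemma prob_hub_small:
  assumes z: "z \<in> \<Omega>"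
  shows "measure_pmf.prob M {V. real (card (hub S V z)) \<le> 9/10 * D} \<le> exp (- (D / 200))"
proof -
  let ?c = "\<lambda>x. of_bool (x \<triangle> z \<in> S) :: real"
  have "(\<Sum>x\<in>\<Omega>. ?c x) = real (card {x \<in> \<Omega>. x \<triangle> z \<in> S})"
    using fin by (simp add: Int_def)
  also have "{x \<in> \<Omega>. x \<triangle> z \<in> S} = {x \<in> \<Omega>. z \<triangle> x \<in> S}" by (simp add: symdiff_commute)
  also have "card \<dots> = card S"
    unfolding \<Omega>_def by (rule card_hubs_containing) (use z S in \<open>auto simp: \<Omega>_def\<close>)
  finally have sumc: "(\<Sum>x\<in>\<Omega>. ?c x) = N" by (simp add: N_def)
  have "measure_pmf.prob M {V. real (card (hub S V z)) \<le> 9/10 * D}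
     \<le> measure_pmf.prob M {V. (\<Sum>x\<in>\<Omega> \<inter> V. ?c x) \<le> (1 - 1/10) * (p * (\<Sum>x\<in>\<Omega>. ?c x))}"
  proof (rule prob_mono, clarify)
    fix V assume V: "V \<subseteq> \<Omega>" and h: "real (card (hub S V z)) \<le> 9/10 * D"
    have "finite V" using V fin finite_subset by blast
    moreover have "\<Omega> \<inter> V = V" using V by auto
    ultimately have "(\<Sum>x\<in>\<Omega> \<inter> V. ?c x) = real (card (hub S V z))"
      by (simp add: hub_def) (simp add: Int_def)
    then show "(\<Sum>x\<in>\<Omega> \<inter> V. ?c x) \<le> (1 - 1/10) * (p * (\<Sum>x\<in>\<Omega>. ?c x))"
      unfolding sumc using h by (simp add: D_def)
  qed
  also have "\<dots> \<le> exp (- ((1/10)\<^sup>2 * (p * (\<Sum>x\<in>\<Omega>. ?c x)) / 2))"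
    unfolding M_def by (rule prob_weight_le[OF fin p0 p(2)]) auto
  also have "\<dots> = exp (- (D / 200))"
    unfolding sumc by (simp add: D_def power2_eq_square)
  finally show ?thesis .
qed

text \<open>Amounts to exp 3 \<ge> 16, which follows from exp (3/4) \<ge> 65/32 > 2 by squaring
  twice.\<close>

lemma exp_le_half_power: "exp (- x) \<le> (1/2) ^ (4 * n)" if "x \<ge> 3 * real n"
proof -
  have "exp (- x) \<le> exp (- 3) ^ n"
    using that by (simp add: exp_of_nat_mult[symmetric] mult.commute)
  also have "exp (- 3 :: real) \<le> (1/2) ^ 4"
  proof -
    have "(16::real) \<le> exp 3"
    proof -
      have "(5/2 :: real) \<le> exp 1" using exp_lower_Taylor_quadratic[of 1] by simp
      then have "(5/2 :: real) ^ 3 \<le> exp 1 ^ 3" by (intro power_mono) auto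
      moreover have "exp (3::real) = exp 1 ^ 3" by (simp add: exp_of_nat_mult[symmetric])
      moreover have "exp (3/2 :: real) \<ge> 4"
      proof -
        have "exp (3/4 :: real) \<ge> 1 + 3/4 + (3/4)\<^sup>2 / 2" by (rule exp_lower_Taylor_quadratic) simp
        then have "exp (3/4 :: real) \<ge> 65/32" by (simp add: power2_eq_square)
        then have "(65/32 :: real) ^ 2 \<le> exp (3/4) ^ 2" by (intro power_mono) auto
        moreover have "exp (3/2 :: real) = exp (3/4) ^ 2" by (simp add: exp_of_nat_mult[symmetric])
        ultimately show ?thesis by (simp add: power2_eq_square)
      qed
      moreover have "exp (3::real) = exp (3/2) * exp (3/2)" by (simp add: exp_add[symmetric])
      ultimately show ?thesis
        using mult_mono[of "4::real" "exp (3/2)" 4 "exp (3/2)"] by simp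
    qed
    then show ?thesis by (simp add: exp_minus field_simps)
  qed
  then have "exp (- 3 :: real) ^ n \<le> ((1/2) ^ 4) ^ n" by (intro power_mono) auto
  finally show ?thesis by (simp add: power_mult)
qed

lemma prob_hub_sizes:
  assumes "D \<ge> 2000 * real n"
  shows "measure_pmf.prob M {V. \<exists>z\<in>\<Omega>. \<not> (9/10 * D \<le> real (card (hub S V z)) \<and> real (card (hub S V z)) \<le> 11/10 * D)}
    \<le> 2 ^ n * (2 * (1/2) ^ (4 * n))"
proof -
  have "measure_pmf.prob M {V. \<not> (9/10 * D \<le> real (card (hub S V z)) \<and> real (card (hub S V z)) \<le> 11/10 * D)}
      \<le> 2 * (1/2) ^ (4 * n)" if z: "z \<in> \<Omega>" for z
  proof -
    have "measure_pmf.prob M {V. real (card (hub S V z)) \<le> 9/10 * D} \<le> exp (- (D / 200))"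
      by (rule prob_hub_small[OF z])
    also have "\<dots> \<le> (1/2) ^ (4 * n)" by (rule exp_le_half_power) (use assms in simp)
    finally have 1: "measure_pmf.prob M {V. real (card (hub S V z)) \<le> 9/10 * D} \<le> (1/2) ^ (4 * n)" .
    \<comment> \<open>The moment of order 60 n has \<mu> = D + 60 n \<le> 1.03 D, and 1.03 / 1.1 <
      15/16; the factor 60 is large enough for (15/16)^60 to drop below 1/16.\<close>
    have "measure_pmf.prob M {V. 11/10 * D \<le> real (card (hub S V z))} \<le> ((D + real (60 * n)) / (11/10 * D)) ^ (60 * n)"
      unfolding hub_def by (rule prob_hub_part_ge[OF subset_refl z]) (use D_pos in \<open>auto simp: D_def N_def\<close>)
    also have "\<dots> \<le> (15/16) ^ (60 * n)"
      using assms D_pos by (intro power_mono) (auto simp: field_simps)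
    also have "(15/16 :: real) ^ (60 * n) \<le> (1/2) ^ (4 * n)"
    proof -
      have "(15/16 :: real) ^ 60 \<le> (1/2) ^ 4" by (simp add: power_divide)
      then have "((15/16 :: real) ^ 60) ^ n \<le> ((1/2) ^ 4) ^ n" by (intro power_mono) auto
      then show ?thesis by (simp only: power_mult)
    qed
    finally have 2: "measure_pmf.prob M {V. 11/10 * D \<le> real (card (hub S V z))} \<le> (1/2) ^ (4 * n)" .
    have "measure_pmf.prob M {V. \<not> (9/10 * D \<le> real (card (hub S V z)) \<and> real (card (hub S V z)) \<le> 11/10 * D)}
       \<le> measure_pmf.prob M {V. real (card (hub S V z)) \<le> 9/10 * D \<or> 11/10 * D \<le> real (card (hub S V z))}"
      by (rule prob_mono) auto
    also have "\<dots> \<le> (1/2) ^ (4 * n) + (1/2) ^ (4 * n)"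
      using prob_disj[of "\<lambda>V. real (card (hub S V z)) \<le> 9/10 * D" "\<lambda>V. 11/10 * D \<le> real (card (hub S V z))"] 1 2
      by linarith
    finally show ?thesis by simp
  qed
  then show ?thesis using prob_union[OF fin] card_Omega by simp
qed

text \<open>Union bound over the \<open>k\<close> places that would be sampled. Each costs a factor
  \<open>p\<close>, so \<open>k\<close> of order n / log 2 (1 / p) makes the bound exponentially
  small for both choices of \<open>S\<close>.\<close>

lemma prob_low_count:
  assumes Low: "Low \<subseteq> \<Omega>"
  shows "measure_pmf.prob M {V. \<exists>z\<in>\<Omega>. k \<le> card {u \<in> Low. z \<triangle> u \<in> V}}
    \<le> 2 ^ n * (real (card Low choose k) * p ^ k)"
proof -
  have finLow: "finite Low" using Low fin finite_subset by blast
  let ?B = "{B. B \<subseteq> Low \<and> card B = k}"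
  have "measure_pmf.prob M {V. k \<le> card {u \<in> Low. z \<triangle> u \<in> V}} \<le> real (card Low choose k) * p ^ k"
    if z: "z \<in> \<Omega>" for z
  proof -
    have "measure_pmf.prob M {V. k \<le> card {u \<in> Low. z \<triangle> u \<in> V}}
        \<le> measure_pmf.prob M {V. \<exists>B\<in>?B. (\<lambda>u. z \<triangle> u) ` B \<subseteq> V}"
    proof (rule prob_mono, clarify)
      fix V assume "k \<le> card {u \<in> Low. z \<triangle> u \<in> V}"
      then obtain B where "B \<subseteq> {u \<in> Low. z \<triangle> u \<in> V}" "card B = k"
        by (meson obtain_subset_with_card_n)
      then show "\<exists>B\<in>?B. (\<lambda>u. z \<triangle> u) ` B \<subseteq> V" by (intro bexI[of _ B]) auto
    qed
    also have "\<dots> \<le> real (card ?B) * p ^ k"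
    proof (rule prob_union)
      show "finite ?B" using finLow by simp
      fix B assume B: "B \<in> ?B"
      have "measure_pmf.prob M {V. (\<lambda>u. z \<triangle> u) ` B \<subseteq> V} = p ^ card ((\<lambda>u. z \<triangle> u) ` B)"
        unfolding M_def by (rule prob_random_subset_superset[OF fin p0 p(2)]) (use B Low z sdO in auto)
      also have "card ((\<lambda>u. z \<triangle> u) ` B) = k"
        using B by (subst card_image) (auto simp: inj_on_def)
      finally show "measure_pmf.prob M {V. (\<lambda>u. z \<triangle> u) ` B \<subseteq> V} \<le> p ^ k" by simp
    qed
    also have "card ?B = (card Low choose k)" using n_subsets[OF finLow] by simp
    finally show ?thesis .
  qed
  then show ?thesis using prob_union[OF fin] card_Omega by simp
qed

end

section \<open>Obstructed pairs between neighbouring hubs\<close>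

context cube_sample
begin

text \<open>A triple \<open>(s, t, w)\<close> records that \<open>w\<close> obstructs the edge between the points \<open>z \<triangle> s\<close> and
  \<open>z \<triangle> e \<triangle> t\<close> of two neighbouring hubs; points \<open>w\<close> in \<open>Hv\<close> are dealt with separately.\<close>

definition pair_triples :: "nat set \<Rightarrow> nat set \<Rightarrow> nat set set \<Rightarrow> (nat set \<times> nat set \<times> nat set) set" where
  "pair_triples z e Hv = {(s, t, w). s \<in> S \<and> t \<in> S \<and> w \<in> \<Omega> - Hv \<and> w \<noteq> z \<triangle> s \<and> w \<noteq> z \<triangle> e \<triangle> t \<and>
     w \<triangle> (z \<triangle> s) \<subseteq> (z \<triangle> s) \<triangle> (z \<triangle> e \<triangle> t)}"

definition triple_points :: "nat set \<Rightarrow> nat set \<Rightarrow> nat set \<times> nat set \<times> nat set \<Rightarrow> nat set set" where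
  "triple_points z e = (\<lambda>(s, t, w). {z \<triangle> s, z \<triangle> e \<triangle> t, w})"

lemma card_symdiff_edge_le:
  assumes "finite s" "finite t" "card e \<le> 1" "finite e"
  shows "card ((z \<triangle> s) \<triangle> (z \<triangle> e \<triangle> t)) \<le> card (s \<triangle> t) + 1"
proof -
  have "(z \<triangle> s) \<triangle> (z \<triangle> e \<triangle> t) = (s \<triangle> t) \<triangle> e" by auto
  also have "\<dots> \<subseteq> (s \<triangle> t) \<union> e" by auto
  finally have "card ((z \<triangle> s) \<triangle> (z \<triangle> e \<triangle> t)) \<le> card ((s \<triangle> t) \<union> e)"
    using assms by (intro card_mono) (auto simp: symdiff_def)
  also have "\<dots> \<le> card (s \<triangle> t) + card e" by (rule card_Un_le)
  finally show ?thesis using assms(3) by simp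
qed

text \<open>The summands of \<open>\<mu>\<close> sort the triples by which of their points lie in an
  exposed set of at most \<open>L\<close> points: none, one endpoint, \<open>w\<close> alone, both
  endpoints, \<open>w\<close> with one endpoint, all three. \<open>C1\<close> controls the points
  between the endpoints once one of these is fixed, \<open>C2\<close> the pairs that have a given
  \<open>w\<close> between them, and \<open>dm\<close> the points between two given endpoints. The
  extra direction of \<open>e\<close> doubles the number of points in between.\<close>

lemma prob_pair_triples:
  fixes C1 C2 L :: real and dm m :: nat
  assumes z: "z \<in> \<Omega>" and e: "e \<in> \<Omega>" "card e \<le> 1"
    and C1: "\<And>s. s \<in> S \<Longrightarrow> (\<Sum>t\<in>S. 2 ^ card (s \<triangle> t)) \<le> C1"
    and C2: "\<And>w. w \<in> \<Omega> - Hv \<Longrightarrow>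
        real (card {(s, t). s \<in> S \<and> t \<in> S \<and> w \<triangle> (z \<triangle> s) \<subseteq> (z \<triangle> s) \<triangle> (z \<triangle> e \<triangle> t)}) \<le> C2"
    and dm: "\<And>s t. s \<in> S \<Longrightarrow> t \<in> S \<Longrightarrow> card (s \<triangle> t) \<le> dm"
    and L: "real (3 * m) \<le> L" "L > 0" and C0: "C2 \<ge> 0"
    and mu: "\<mu> = 2 * p\<^sup>2 * D * C1 + 4 * p\<^sup>2 * L * C1 + p\<^sup>2 * L * C2 + 2 * p * L\<^sup>2 * 2 ^ dm + 2 * L\<^sup>2 * D + L ^ 3"
  shows "measure_pmf.prob M {V. 2 * \<mu> \<le> real (card {f \<in> pair_triples z e Hv. triple_points z e f \<subseteq> V})} \<le> (1/2) ^ m"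
proof -
  let ?F = "pair_triples z e Hv" and ?\<tau> = "triple_points z e"
  have finF: "finite ?F"
    by (rule finite_subset[of _ "S \<times> S \<times> \<Omega>"]) (auto simp: pair_triples_def finS fin)
  have fe: "finite e" using finO e by blast
  \<comment> \<open>Nothing else lies between equal endpoints, so a triple always has three distinct
    points and each contributes its own factor.\<close>
  have ab: "z \<triangle> s \<noteq> z \<triangle> e \<triangle> t" if "(s, t, w) \<in> ?F" for s t w
  proof
    assume eq: "z \<triangle> s = z \<triangle> e \<triangle> t"
    have "w \<triangle> (z \<triangle> s) \<subseteq> {}" using that unfolding pair_triples_def by (simp add: eq)
    then have "w = z \<triangle> s" by (simp add: subset_empty)
    then show False using that by (auto simp: pair_triples_def)
  qed
  have C1nn: "C1 \<ge> 0"
  proof -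
    obtain s where s: "s \<in> S" using S by auto
    have "(0::real) \<le> (\<Sum>t\<in>S. 2 ^ card (s \<triangle> t))" by (rule sum_nonneg) simp
    then show ?thesis using C1[OF s] by linarith
  qed
  have mupos: "\<mu> > 0"
  proof -
    have "\<mu> \<ge> L ^ 3" unfolding mu using p D_pos C1nn C0 L by simp
    moreover have "L ^ 3 > 0" using L by simp
    ultimately show ?thesis by linarith
  qed
  have two: "(2::real) ^ card ((z \<triangle> s) \<triangle> (z \<triangle> e \<triangle> t)) \<le> 2 * 2 ^ card (s \<triangle> t)" if "s \<in> S" "t \<in> S" for s t
  proof -
    have "card ((z \<triangle> s) \<triangle> (z \<triangle> e \<triangle> t)) \<le> card (s \<triangle> t) + 1"
      by (rule card_symdiff_edge_le) (use that S_Omega finO e fe in auto)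
    then have "(2::real) ^ card ((z \<triangle> s) \<triangle> (z \<triangle> e \<triangle> t)) \<le> 2 ^ (card (s \<triangle> t) + 1)"
      by (intro power_increasing) auto
    then show ?thesis by simp
  qed
  have fq: "finite ((z \<triangle> s) \<triangle> (z \<triangle> e \<triangle> t))" if "s \<in> S" "t \<in> S" for s t
    using that S_Omega sdO z e finO by (meson subset_iff)
  have fib_st: "real (card {f \<in> ?F. (fst f, fst (snd f)) = (s, t)}) \<le> 2 * 2 ^ card (s \<triangle> t)"
    if st: "s \<in> S" "t \<in> S" for s t
  proof -
    let ?q = "(z \<triangle> s) \<triangle> (z \<triangle> e \<triangle> t)"
    have "card {f \<in> ?F. (fst f, fst (snd f)) = (s, t)} \<le> card {w. w \<triangle> (z \<triangle> s) \<subseteq> ?q}"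
      by (rule card_inj_on_le[where f = "\<lambda>f. snd (snd f)"])
         (auto simp: inj_on_def pair_triples_def simp del: in_symdiff_iff intro!: finite_between fq[OF st])
    also have "\<dots> = 2 ^ card ?q" by (rule card_between[OF fq[OF st]])
    finally have "real (card {f \<in> ?F. (fst f, fst (snd f)) = (s, t)}) \<le> real (2 ^ card ?q)"
      by (rule of_nat_mono)
    then show ?thesis using two[OF st] unfolding of_nat_power of_nat_numeral by linarith
  qed
  have fib_s: "real (card {f \<in> ?F. fst f = s}) \<le> 2 * C1" if s: "s \<in> S" for s
  proof -
    have "{f \<in> ?F. fst f = s} = (\<Union>t\<in>S. {f \<in> ?F. (fst f, fst (snd f)) = (s, t)})"
      by (auto simp: pair_triples_def)
    then have "card {f \<in> ?F. fst f = s} \<le> (\<Sum>t\<in>S. card {f \<in> ?F. (fst f, fst (snd f)) = (s, t)})"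
      using card_UN_le[OF finS, of "\<lambda>t. {f \<in> ?F. (fst f, fst (snd f)) = (s, t)}"] by simp
    then have "real (card {f \<in> ?F. fst f = s}) \<le> (\<Sum>t\<in>S. real (card {f \<in> ?F. (fst f, fst (snd f)) = (s, t)}))"
      unfolding of_nat_sum[symmetric] of_nat_le_iff .
    also have "\<dots> \<le> (\<Sum>t\<in>S. 2 * 2 ^ card (s \<triangle> t))" by (rule sum_mono) (rule fib_st[OF s])
    also have "\<dots> = 2 * (\<Sum>t\<in>S. 2 ^ card (s \<triangle> t))" by (simp add: sum_distrib_left)
    also have "\<dots> \<le> 2 * C1" using C1[OF s] by simp
    finally show ?thesis .
  qed
  have fib_t: "real (card {f \<in> ?F. fst (snd f) = t}) \<le> 2 * C1" if t: "t \<in> S" for t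
  proof -
    have "{f \<in> ?F. fst (snd f) = t} = (\<Union>s\<in>S. {f \<in> ?F. (fst f, fst (snd f)) = (s, t)})"
      by (auto simp: pair_triples_def)
    then have "card {f \<in> ?F. fst (snd f) = t} \<le> (\<Sum>s\<in>S. card {f \<in> ?F. (fst f, fst (snd f)) = (s, t)})"
      using card_UN_le[OF finS, of "\<lambda>s. {f \<in> ?F. (fst f, fst (snd f)) = (s, t)}"] by simp
    then have "real (card {f \<in> ?F. fst (snd f) = t}) \<le> (\<Sum>s\<in>S. real (card {f \<in> ?F. (fst f, fst (snd f)) = (s, t)}))"
      unfolding of_nat_sum[symmetric] of_nat_le_iff .
    also have "\<dots> \<le> (\<Sum>s\<in>S. 2 * 2 ^ card (s \<triangle> t))" by (rule sum_mono) (rule fib_st[OF _ t])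
    also have "\<dots> = 2 * (\<Sum>s\<in>S. 2 ^ card (t \<triangle> s))" by (simp add: sum_distrib_left symdiff_commute)
    also have "\<dots> \<le> 2 * C1" using C1[OF t] by simp
    finally show ?thesis .
  qed
  have "measure_pmf.prob M {V. 2 * \<mu> \<le> real (card {f \<in> ?F. ?\<tau> f \<subseteq> V})} \<le> (\<mu> / (2 * \<mu>)) ^ m"
    unfolding M_def
  proof (rule prob_count_ge[OF fin p0 p(2) finF, where h = 3])
    show "?\<tau> f \<subseteq> \<Omega>" if "f \<in> ?F" for f
      using that z e S_Omega sdO by (auto simp: pair_triples_def triple_points_def simp del: in_symdiff_iff)
    show "card (?\<tau> f) \<le> 3" if "f \<in> ?F" for f
      by (auto simp: triple_points_def card_insert_if split: prod.splits)
    show "\<mu> \<ge> 0" "2 * \<mu> > 0" using mupos by auto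
    fix A :: "nat set set" assume A: "A \<subseteq> \<Omega>" "card A \<le> 3 * m"
    have finA: "finite A" using A fin finite_subset by blast
    have cA: "real (card A) \<le> L" using A L by linarith
    define a where "a = (\<lambda>f::nat set \<times> nat set \<times> nat set. z \<triangle> fst f)"
    define b where "b = (\<lambda>f::nat set \<times> nat set \<times> nat set. z \<triangle> e \<triangle> fst (snd f))"
    define w where "w = (\<lambda>f::nat set \<times> nat set \<times> nat set. snd (snd f))"
    define ct where "ct = (\<lambda>P. real (card {f \<in> ?F. P f}))"
    have ctsum: "(\<Sum>f\<in>?F. of_bool (P f)) = ct P" for P
      using finF by (simp add: ct_def Int_def)
    have "(\<Sum>f\<in>?F. p ^ card (?\<tau> f - A))
        \<le> (\<Sum>f\<in>?F. (p + of_bool (a f \<in> A)) * ((p + of_bool (b f \<in> A)) * (p + of_bool (w f \<in> A))))"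
    proof (rule sum_mono, clarify)
      fix s t v assume f: "(s, t, v) \<in> ?F"
      have 1: "z \<triangle> s \<notin> {z \<triangle> e \<triangle> t, v}" using ab[OF f] f by (auto simp: pair_triples_def)
      have 2: "z \<triangle> e \<triangle> t \<notin> {v}" using f by (auto simp: pair_triples_def)
      have "p ^ card ({z \<triangle> s, z \<triangle> e \<triangle> t, v} - A) \<le> (p + of_bool (z \<triangle> s \<in> A)) * p ^ card ({z \<triangle> e \<triangle> t, v} - A)"
        by (rule power_card_insert_le[OF p0 p(2) 1]) simp
      also have "\<dots> \<le> (p + of_bool (z \<triangle> s \<in> A)) * ((p + of_bool (z \<triangle> e \<triangle> t \<in> A)) * p ^ card ({v} - A))"
        by (intro mult_left_mono power_card_insert_le[OF p0 p(2) 2]) (use p in auto)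
      also have "\<dots> \<le> (p + of_bool (z \<triangle> s \<in> A)) * ((p + of_bool (z \<triangle> e \<triangle> t \<in> A)) * (p + of_bool (v \<in> A)))"
        by (intro mult_left_mono) (use p in \<open>auto simp: insert_Diff_if\<close>)
      finally show "p ^ card (?\<tau> (s, t, v) - A) \<le> (p + of_bool (a (s, t, v) \<in> A)) *
          ((p + of_bool (b (s, t, v) \<in> A)) * (p + of_bool (w (s, t, v) \<in> A)))"
        by (simp add: triple_points_def a_def b_def w_def)
    qed
    also have "\<dots> = (\<Sum>f\<in>?F. p ^ 3 * of_bool True + p\<^sup>2 * of_bool (a f \<in> A) + p\<^sup>2 * of_bool (b f \<in> A)
         + p\<^sup>2 * of_bool (w f \<in> A) + p * of_bool (a f \<in> A \<and> b f \<in> A) + p * of_bool (a f \<in> A \<and> w f \<in> A)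
         + p * of_bool (b f \<in> A \<and> w f \<in> A) + of_bool (a f \<in> A \<and> b f \<in> A \<and> w f \<in> A))"
      by (intro sum.cong refl) (auto simp: of_bool_def algebra_simps power2_eq_square power3_eq_cube)
    also have "\<dots> = p ^ 3 * ct (\<lambda>_. True) + p\<^sup>2 * ct (\<lambda>f. a f \<in> A) + p\<^sup>2 * ct (\<lambda>f. b f \<in> A)
         + p\<^sup>2 * ct (\<lambda>f. w f \<in> A) + p * ct (\<lambda>f. a f \<in> A \<and> b f \<in> A) + p * ct (\<lambda>f. a f \<in> A \<and> w f \<in> A)
         + p * ct (\<lambda>f. b f \<in> A \<and> w f \<in> A) + ct (\<lambda>f. a f \<in> A \<and> b f \<in> A \<and> w f \<in> A)"
      unfolding ctsum[symmetric] sum.distrib sum_distrib_left[symmetric] ..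
    also have "\<dots> \<le> p ^ 3 * (N * (2 * C1)) + p\<^sup>2 * (L * (2 * C1)) + p\<^sup>2 * (L * (2 * C1))
         + p\<^sup>2 * (L * C2) + p * (L\<^sup>2 * (2 * 2 ^ dm)) + p * (L\<^sup>2 * N) + p * (L\<^sup>2 * N) + L ^ 3"
    proof -
      have sub: "real (card {f \<in> {f \<in> ?F. P f}. Q f}) \<le> c" if "real (card {f \<in> ?F. Q f}) \<le> c" for P Q and c :: real
      proof -
        have "card {f \<in> {f \<in> ?F. P f}. Q f} \<le> card {f \<in> ?F. Q f}"
          by (rule card_mono) (use finF in auto)
        then show ?thesis using that by linarith
      qed
      have finP: "finite {f \<in> ?F. P f}" for P using finF by simp
      define As where "As = {s \<in> S. z \<triangle> s \<in> A}"
      define At where "At = {t \<in> S. z \<triangle> e \<triangle> t \<in> A}"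
      have cAs: "real (card As) \<le> L"
      proof -
        have "card As \<le> card A"
          by (rule card_inj_on_le[where f = "\<lambda>s. z \<triangle> s"]) (auto simp: inj_on_def As_def finA)
        then show ?thesis using cA by linarith
      qed
      have cAt: "real (card At) \<le> L"
      proof -
        have "card At \<le> card A"
          by (rule card_inj_on_le[where f = "\<lambda>s. z \<triangle> e \<triangle> s"]) (auto simp: inj_on_def At_def finA)
        then show ?thesis using cA by linarith
      qed
      have fA: "finite As" "finite At" using finS by (auto simp: As_def At_def)
      have k0: "ct (\<lambda>_. True) \<le> N * (2 * C1)"
        unfolding ct_def
      proof (rule card_le_fibres'[where \<pi> = fst and X = S])
        show "real (card {f \<in> {f \<in> ?F. True}. fst f = x}) \<le> 2 * C1" if "x \<in> S" for x
          by (rule sub, rule fib_s) (use that in auto)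
        show "finite {f \<in> ?F. True}" by (rule finP)
      qed (use finS C1nn in \<open>auto simp: pair_triples_def N_def\<close>)
      have k1: "ct (\<lambda>f. a f \<in> A) \<le> L * (2 * C1)"
        unfolding ct_def
      proof (rule card_le_fibres'[where \<pi> = fst and X = As])
        show "real (card {f \<in> {f \<in> ?F. a f \<in> A}. fst f = x}) \<le> 2 * C1" if "x \<in> As" for x
          by (rule sub, rule fib_s) (use that in \<open>auto simp: As_def\<close>)
      qed (rule finP, use fA cAs C1nn in \<open>auto simp: pair_triples_def a_def As_def\<close>)
      have k2: "ct (\<lambda>f. b f \<in> A) \<le> L * (2 * C1)"
        unfolding ct_def
      proof (rule card_le_fibres'[where \<pi> = "\<lambda>f. fst (snd f)" and X = At])
        show "real (card {f \<in> {f \<in> ?F. b f \<in> A}. fst (snd f) = x}) \<le> 2 * C1" if "x \<in> At" for x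
          by (rule sub, rule fib_t) (use that in \<open>auto simp: At_def\<close>)
      qed (rule finP, use fA cAt C1nn in \<open>auto simp: pair_triples_def b_def At_def\<close>)
      have k3: "ct (\<lambda>f. w f \<in> A) \<le> L * C2"
        unfolding ct_def
      proof (rule card_le_fibres'[where \<pi> = w and X = A])
        show "real (card {f \<in> {f \<in> ?F. w f \<in> A}. w f = x}) \<le> C2" if "x \<in> A" for x
        proof (rule sub)
          let ?R = "{(s, t). s \<in> S \<and> t \<in> S \<and> x \<triangle> (z \<triangle> s) \<subseteq> (z \<triangle> s) \<triangle> (z \<triangle> e \<triangle> t)}"
          show "real (card {f \<in> ?F. w f = x}) \<le> C2"
          proof (cases "x \<in> \<Omega> - Hv")
            case True
            have "card {f \<in> ?F. w f = x} \<le> card ?R"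
            proof (rule card_inj_on_le[where f = "\<lambda>f. (fst f, fst (snd f))"])
              show "inj_on (\<lambda>f. (fst f, fst (snd f))) {f \<in> ?F. w f = x}"
                by (auto simp: inj_on_def w_def)
              show "(\<lambda>f. (fst f, fst (snd f))) ` {f \<in> ?F. w f = x} \<subseteq> ?R"
                by (auto simp: pair_triples_def w_def simp del: in_symdiff_iff)
              show "finite ?R" by (rule finite_subset[of _ "S \<times> S"]) (auto simp: finS)
            qed
            then have "real (card {f \<in> ?F. w f = x}) \<le> real (card ?R)" by simp
            then show ?thesis using C2[OF True] by linarith
          next
            case False
            then have emp: "{f \<in> ?F. w f = x} = {}" by (auto simp: pair_triples_def w_def simp del: in_symdiff_iff)
            show ?thesis unfolding emp using C0 by simp
          qed
        qed
      qed (rule finP, use finA cA C0 in auto)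
      have sq: "real (card (X \<times> Y)) \<le> L\<^sup>2" if "real (card X) \<le> L" "real (card Y) \<le> L"
        for X :: "nat set set" and Y :: "nat set set"
        using that L by (simp add: card_cartesian_product power2_eq_square mult_mono)
      have k4: "ct (\<lambda>f. a f \<in> A \<and> b f \<in> A) \<le> L\<^sup>2 * (2 * 2 ^ dm)"
        unfolding ct_def
      proof (rule card_le_fibres'[where \<pi> = "\<lambda>f. (fst f, fst (snd f))" and X = "As \<times> At"])
        show "real (card {f \<in> {f \<in> ?F. a f \<in> A \<and> b f \<in> A}. (fst f, fst (snd f)) = x}) \<le> 2 * 2 ^ dm"
          if xA: "x \<in> As \<times> At" for x
        proof (rule sub)
          obtain s t where x: "x = (s, t)" "s \<in> S" "t \<in> S" using xA by (auto simp: As_def At_def)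
          have "(2::real) ^ card (s \<triangle> t) \<le> 2 ^ dm" using dm[OF x(2,3)] by (intro power_increasing) auto
          then show "real (card {f \<in> ?F. (fst f, fst (snd f)) = x}) \<le> 2 * 2 ^ dm"
            using fib_st[OF x(2,3)] unfolding x(1) by linarith
        qed
        show "real (card (As \<times> At)) \<le> L\<^sup>2" by (rule sq[OF cAs cAt])
      qed (rule finP, use fA in \<open>auto simp: pair_triples_def a_def b_def As_def At_def\<close>)
      have k5: "ct (\<lambda>f. a f \<in> A \<and> w f \<in> A) \<le> L\<^sup>2 * N"
        unfolding ct_def
      proof (rule card_le_fibres'[where \<pi> = "\<lambda>f. (fst f, w f)" and X = "As \<times> A"])
        show "real (card {f \<in> {f \<in> ?F. a f \<in> A \<and> w f \<in> A}. (fst f, w f) = x}) \<le> N"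
          if "x \<in> As \<times> A" for x
          unfolding N_def
          by (rule of_nat_mono, rule card_inj_on_le[where f = "\<lambda>f. fst (snd f)"])
             (auto simp: inj_on_def w_def finS pair_triples_def)
        show "real (card (As \<times> A)) \<le> L\<^sup>2" by (rule sq[OF cAs cA])
      qed (rule finP, use fA finA N_pos in \<open>auto simp: pair_triples_def a_def As_def\<close>)
      have k6: "ct (\<lambda>f. b f \<in> A \<and> w f \<in> A) \<le> L\<^sup>2 * N"
        unfolding ct_def
      proof (rule card_le_fibres'[where \<pi> = "\<lambda>f. (fst (snd f), w f)" and X = "At \<times> A"])
        show "real (card {f \<in> {f \<in> ?F. b f \<in> A \<and> w f \<in> A}. (fst (snd f), w f) = x}) \<le> N"
          if "x \<in> At \<times> A" for x
          unfolding N_def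
          by (rule of_nat_mono, rule card_inj_on_le[where f = fst])
             (auto simp: inj_on_def w_def finS pair_triples_def)
        show "real (card (At \<times> A)) \<le> L\<^sup>2" by (rule sq[OF cAt cA])
      qed (rule finP, use fA finA N_pos in \<open>auto simp: pair_triples_def b_def At_def\<close>)
      have k7: "ct (\<lambda>f. a f \<in> A \<and> b f \<in> A \<and> w f \<in> A) \<le> L ^ 3"
      proof -
        have "card {f \<in> ?F. a f \<in> A \<and> b f \<in> A \<and> w f \<in> A} \<le> card (As \<times> At \<times> A)"
          by (rule card_mono) (use fA finA in \<open>auto simp: pair_triples_def a_def b_def w_def As_def At_def\<close>)
        then have "real (card {f \<in> ?F. a f \<in> A \<and> b f \<in> A \<and> w f \<in> A}) \<le> real (card As) * (real (card At) * real (card A))"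
          by (simp add: card_cartesian_product flip: of_nat_mult)
        also have "\<dots> \<le> L * (L * L)"
          using cAs cAt cA L by (intro mult_mono) auto
        finally show ?thesis by (simp add: ct_def power3_eq_cube mult_ac)
      qed
      show ?thesis
        by (intro add_mono mult_left_mono k0 k1 k2 k3 k4 k5 k6 k7) (use p in auto)
    qed
    also have "\<dots> = \<mu>"
      unfolding mu D_def by (simp add: algebra_simps power2_eq_square power3_eq_cube)
    finally show "(\<Sum>f\<in>?F. p ^ card (?\<tau> f - A)) \<le> \<mu>" .
  qed
  also have "\<mu> / (2 * \<mu>) = 1/2" using mupos by simp
  finally show ?thesis .
qed

end

section \<open>Obstructions around a single sampled point\<close>

context cube_sample
begin

text \<open>With \<open>x\<close> fixed, \<open>s\<close> selects the hub centred at
  \<open>x \<triangle> s\<close>, one of those containing a sampled \<open>x\<close>, and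
  \<open>t\<close> the point \<open>x \<triangle> (s \<triangle> t)\<close> of the same hub;
  \<open>w\<close> obstructs this pair. The bound \<open>d0\<close> limits the number of points in
  between, and \<open>s0\<close> excludes obstructions so close to \<open>x\<close> that each would
  spoil too many pairs.\<close>

definition star_triples :: "nat set \<Rightarrow> nat \<Rightarrow> nat \<Rightarrow> (nat set \<times> nat set \<times> nat set) set" where
  "star_triples x d0 s0 = {(s, t, w). s \<in> S \<and> t \<in> S \<and> card (s \<triangle> t) \<le> d0 \<and> w \<in> \<Omega> \<and> w \<noteq> x \<and>
     w \<noteq> x \<triangle> (s \<triangle> t) \<and> w \<triangle> x \<subseteq> s \<triangle> t \<and> s0 < card (w \<triangle> x)}"

definition star_points :: "nat set \<Rightarrow> nat set \<times> nat set \<times> nat set \<Rightarrow> nat set set" where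
  "star_points x = (\<lambda>(s, t, w). {x \<triangle> (s \<triangle> t), w})"

text \<open>As for pairs of hubs, but with two random points, since \<open>x\<close> is given. The
  summands of \<open>\<mu>\<close> stand for neither point exposed, \<open>w\<close> exposed, the
  second endpoint exposed, and both. For a given second endpoint \<open>s\<close> determines
  \<open>t\<close> and at most \<open>2 ^ d0\<close> choices of \<open>w\<close> remain.\<close>

lemma prob_star_triples:
  fixes C1 C2 L :: real and m :: nat
  assumes x: "x \<in> \<Omega>"
    and C1: "\<And>s. s \<in> S \<Longrightarrow> (\<Sum>t\<in>S. 2 ^ card (s \<triangle> t)) \<le> C1"
    and C2: "\<And>u. u \<in> \<Omega> \<Longrightarrow> s0 < card u \<Longrightarrow> real (card {(s, t). s \<in> S \<and> t \<in> S \<and> u \<subseteq> s \<triangle> t}) \<le> C2"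
    and L: "real (2 * m) \<le> L" "L > 0" and C0: "C2 \<ge> 0"
    and mu: "\<mu> = p * D * C1 + p * L * C2 + L * D * 2 ^ d0 + L\<^sup>2 * N"
  shows "measure_pmf.prob M {V. 2 * \<mu> \<le> real (card {f \<in> star_triples x d0 s0. star_points x f \<subseteq> V})} \<le> (1/2) ^ m"
proof -
  let ?F = "star_triples x d0 s0" and ?\<tau> = "star_points x"
  have finF: "finite ?F"
    by (rule finite_subset[of _ "S \<times> S \<times> \<Omega>"]) (auto simp: star_triples_def finS fin)
  have C1nn: "C1 \<ge> 0"
  proof -
    obtain s where s: "s \<in> S" using S by auto
    have "(0::real) \<le> (\<Sum>t\<in>S. 2 ^ card (s \<triangle> t))" by (rule sum_nonneg) simp
    then show ?thesis using C1[OF s] by linarith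
  qed
  have mupos: "\<mu> > 0"
  proof -
    have "\<mu> \<ge> L\<^sup>2 * N" unfolding mu using p D_pos C1nn C0 L by simp
    moreover have "L\<^sup>2 * N > 0" using L N_pos by simp
    ultimately show ?thesis by linarith
  qed
  have fq: "finite (s \<triangle> t)" if "s \<in> S" "t \<in> S" for s t
    using that S_Omega sdO finO by (meson subset_iff)
  have fib_s: "real (card {f \<in> ?F. fst f = s}) \<le> C1" if s: "s \<in> S" for s
  proof -
    have "{f \<in> ?F. fst f = s} \<subseteq> (\<Union>t\<in>S. (\<lambda>w. (s, t, w)) ` {w. w \<triangle> x \<subseteq> s \<triangle> t})"
      by (auto simp: star_triples_def simp del: in_symdiff_iff)
    then have "card {f \<in> ?F. fst f = s} \<le> card (\<Union>t\<in>S. (\<lambda>w. (s, t, w)) ` {w. w \<triangle> x \<subseteq> s \<triangle> t})"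
      by (rule card_mono[rotated]) (auto intro!: finite_between fq[OF s] simp: finS)
    also have "\<dots> \<le> (\<Sum>t\<in>S. card ((\<lambda>w. (s, t, w)) ` {w. w \<triangle> x \<subseteq> s \<triangle> t}))"
      by (rule card_UN_le[OF finS])
    also have "\<dots> = (\<Sum>t\<in>S. 2 ^ card (s \<triangle> t))"
      by (intro sum.cong refl) (subst card_image, auto simp: inj_on_def card_between fq[OF s])
    finally have "real (card {f \<in> ?F. fst f = s}) \<le> real (\<Sum>t\<in>S. 2 ^ card (s \<triangle> t))"
      by (rule of_nat_mono)
    then show ?thesis using C1[OF s] unfolding of_nat_sum of_nat_power of_nat_numeral by linarith
  qed
  have "measure_pmf.prob M {V. 2 * \<mu> \<le> real (card {f \<in> ?F. ?\<tau> f \<subseteq> V})} \<le> (\<mu> / (2 * \<mu>)) ^ m"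
    unfolding M_def
  proof (rule prob_count_ge[OF fin p0 p(2) finF, where h = 2])
    show "?\<tau> f \<subseteq> \<Omega>" if f: "f \<in> ?F" for f
    proof -
      obtain s t w where st: "f = (s, t, w)" "s \<in> S" "t \<in> S" "w \<in> \<Omega>"
        using f by (auto simp: star_triples_def simp del: in_symdiff_iff)
      then have "x \<triangle> (s \<triangle> t) \<in> \<Omega>" using S_Omega x by (intro sdO) auto
      then show ?thesis using st by (simp add: star_points_def)
    qed
    show "card (?\<tau> f) \<le> 2" if "f \<in> ?F" for f
      by (auto simp: star_points_def card_insert_if split: prod.splits)
    show "\<mu> \<ge> 0" "2 * \<mu> > 0" using mupos by auto
    fix A :: "nat set set" assume A: "A \<subseteq> \<Omega>" "card A \<le> 2 * m"
    have finA: "finite A" using A fin finite_subset by blast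
    have cA: "real (card A) \<le> L" using A L by linarith
    define y where "y = (\<lambda>f::nat set \<times> nat set \<times> nat set. x \<triangle> (fst f \<triangle> fst (snd f)))"
    define w where "w = (\<lambda>f::nat set \<times> nat set \<times> nat set. snd (snd f))"
    define ct where "ct = (\<lambda>P. real (card {f \<in> ?F. P f}))"
    have ctsum: "(\<Sum>f\<in>?F. of_bool (P f)) = ct P" for P
      using finF by (simp add: ct_def Int_def)
    have "(\<Sum>f\<in>?F. p ^ card (?\<tau> f - A))
        \<le> (\<Sum>f\<in>?F. (p + of_bool (y f \<in> A)) * (p + of_bool (w f \<in> A)))"
    proof (rule sum_mono, clarify)
      fix s t v assume f: "(s, t, v) \<in> ?F"
      have 2: "x \<triangle> (s \<triangle> t) \<notin> {v}" using f by (auto simp: star_triples_def)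
      have "p ^ card ({x \<triangle> (s \<triangle> t), v} - A) \<le> (p + of_bool (x \<triangle> (s \<triangle> t) \<in> A)) * p ^ card ({v} - A)"
        by (rule power_card_insert_le[OF p0 p(2) 2]) simp
      also have "\<dots> \<le> (p + of_bool (x \<triangle> (s \<triangle> t) \<in> A)) * (p + of_bool (v \<in> A))"
        by (intro mult_left_mono) (use p in \<open>auto simp: insert_Diff_if\<close>)
      finally show "p ^ card (?\<tau> (s, t, v) - A) \<le> (p + of_bool (y (s, t, v) \<in> A)) * (p + of_bool (w (s, t, v) \<in> A))"
        by (simp add: star_points_def y_def w_def)
    qed
    also have "\<dots> = (\<Sum>f\<in>?F. p\<^sup>2 * of_bool True + p * of_bool (y f \<in> A) + p * of_bool (w f \<in> A)
         + of_bool (y f \<in> A \<and> w f \<in> A))"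
      by (intro sum.cong refl) (auto simp: of_bool_def algebra_simps power2_eq_square)
    also have "\<dots> = p\<^sup>2 * ct (\<lambda>_. True) + p * ct (\<lambda>f. y f \<in> A) + p * ct (\<lambda>f. w f \<in> A)
         + ct (\<lambda>f. y f \<in> A \<and> w f \<in> A)"
      unfolding ctsum[symmetric] sum.distrib sum_distrib_left[symmetric] ..
    also have "\<dots> \<le> p\<^sup>2 * (N * C1) + p * (L * (N * 2 ^ d0)) + p * (L * C2) + L\<^sup>2 * N"
    proof -
      have sub: "real (card {f \<in> {f \<in> ?F. P f}. Q f}) \<le> c" if "real (card {f \<in> ?F. Q f}) \<le> c" for P Q and c :: real
      proof -
        have "card {f \<in> {f \<in> ?F. P f}. Q f} \<le> card {f \<in> ?F. Q f}"
          by (rule card_mono) (use finF in auto)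
        then show ?thesis using that by linarith
      qed
      have finP: "finite {f \<in> ?F. P f}" for P using finF by simp
      have injt: "t = t'" if "x \<triangle> (s \<triangle> t) = x \<triangle> (s \<triangle> t')" for s t t' :: "nat set"
        using that by simp
      have k0: "ct (\<lambda>_. True) \<le> N * C1"
        unfolding ct_def
      proof (rule card_le_fibres'[where \<pi> = fst and X = S])
        show "real (card {f \<in> {f \<in> ?F. True}. fst f = x}) \<le> C1" if "x \<in> S" for x
          by (rule sub, rule fib_s) (use that in auto)
        show "finite {f \<in> ?F. True}" by (rule finP)
      qed (use finS C1nn in \<open>auto simp: star_triples_def N_def\<close>)
      have k1: "ct (\<lambda>f. y f \<in> A) \<le> L * (N * 2 ^ d0)"
        unfolding ct_def
      proof (rule card_le_fibres'[where \<pi> = y and X = A])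
        show "real (card {f \<in> {f \<in> ?F. y f \<in> A}. y f = v}) \<le> N * 2 ^ d0" if "v \<in> A" for v
        proof (rule sub, cases "card (x \<triangle> v) \<le> d0")
          case True
          have fv: "finite (x \<triangle> v)" using x that A sdO finO by blast
          have "card {f \<in> ?F. y f = v} \<le> card (S \<times> {u. u \<triangle> x \<subseteq> x \<triangle> v})"
          proof (rule card_inj_on_le[where f = "\<lambda>f. (fst f, snd (snd f))"])
            show "inj_on (\<lambda>f. (fst f, snd (snd f))) {f \<in> ?F. y f = v}"
            proof (rule inj_onI)
              fix f g assume "f \<in> {f \<in> ?F. y f = v}" "g \<in> {f \<in> ?F. y f = v}"
                and eq: "(fst f, snd (snd f)) = (fst g, snd (snd g))"
              then have "x \<triangle> (fst f \<triangle> fst (snd f)) = x \<triangle> (fst f \<triangle> fst (snd g))"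
                by (simp add: y_def)
              then have "fst (snd f) = fst (snd g)" by (rule injt)
              then show "f = g" using eq by (simp add: prod_eq_iff)
            qed
            show "(\<lambda>f. (fst f, snd (snd f))) ` {f \<in> ?F. y f = v} \<subseteq> S \<times> {u. u \<triangle> x \<subseteq> x \<triangle> v}"
              by (auto simp: star_triples_def y_def simp del: in_symdiff_iff)
            show "finite (S \<times> {u. u \<triangle> x \<subseteq> x \<triangle> v})" using finS finite_between[OF fv] by simp
          qed
          also have "\<dots> = card S * 2 ^ card (x \<triangle> v)"
            by (simp add: card_cartesian_product card_between[OF fv])
          also have "\<dots> \<le> card S * 2 ^ d0" using True by simp
          finally have "real (card {f \<in> ?F. y f = v}) \<le> real (card S * 2 ^ d0)" by (rule of_nat_mono)
          then show "real (card {f \<in> ?F. y f = v}) \<le> N * 2 ^ d0" by (simp add: N_def)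
        next
          case False
          have emp: "{f \<in> ?F. y f = v} = {}" using False by (auto simp: star_triples_def y_def simp del: in_symdiff_iff)
          show "real (card {f \<in> ?F. y f = v}) \<le> N * 2 ^ d0" unfolding emp using N_pos by simp
        qed
      qed (rule finP, use finA cA N_pos in auto)
      have k2: "ct (\<lambda>f. w f \<in> A) \<le> L * C2"
        unfolding ct_def
      proof (rule card_le_fibres'[where \<pi> = w and X = A])
        show "real (card {f \<in> {f \<in> ?F. w f \<in> A}. w f = v}) \<le> C2" if "v \<in> A" for v
        proof (rule sub, cases "s0 < card (v \<triangle> x)")
          case True
          let ?R = "{(s, t). s \<in> S \<and> t \<in> S \<and> v \<triangle> x \<subseteq> s \<triangle> t}"
          have "card {f \<in> ?F. w f = v} \<le> card ?R"
          proof (rule card_inj_on_le[where f = "\<lambda>f. (fst f, fst (snd f))"])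
            show "inj_on (\<lambda>f. (fst f, fst (snd f))) {f \<in> ?F. w f = v}"
              by (auto simp: inj_on_def w_def)
            show "(\<lambda>f. (fst f, fst (snd f))) ` {f \<in> ?F. w f = v} \<subseteq> ?R"
              by (auto simp: star_triples_def w_def simp del: in_symdiff_iff)
            show "finite ?R" by (rule finite_subset[of _ "S \<times> S"]) (auto simp: finS)
          qed
          then have "real (card {f \<in> ?F. w f = v}) \<le> real (card ?R)" by simp
          moreover have "v \<triangle> x \<in> \<Omega>" using that A x sdO by blast
          ultimately show "real (card {f \<in> ?F. w f = v}) \<le> C2" using C2[OF _ True] by linarith
        next
          case False
          have emp: "{f \<in> ?F. w f = v} = {}" using False by (auto simp: star_triples_def w_def simp del: in_symdiff_iff)
          show "real (card {f \<in> ?F. w f = v}) \<le> C2" unfolding emp using C0 by simp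
        qed
      qed (rule finP, use finA cA C0 in auto)
      have k3: "ct (\<lambda>f. y f \<in> A \<and> w f \<in> A) \<le> L\<^sup>2 * N"
        unfolding ct_def
      proof (rule card_le_fibres'[where \<pi> = "\<lambda>f. (y f, w f)" and X = "A \<times> A"])
        show "real (card {f \<in> {f \<in> ?F. y f \<in> A \<and> w f \<in> A}. (y f, w f) = v}) \<le> N"
          if "v \<in> A \<times> A" for v
          unfolding N_def
        proof (rule of_nat_mono, rule card_inj_on_le[where f = fst])
          show "inj_on fst {f \<in> {f \<in> ?F. y f \<in> A \<and> w f \<in> A}. (y f, w f) = v}"
          proof (rule inj_onI)
            fix f g assume f: "f \<in> {f \<in> {f \<in> ?F. y f \<in> A \<and> w f \<in> A}. (y f, w f) = v}"
              and g: "g \<in> {f \<in> {f \<in> ?F. y f \<in> A \<and> w f \<in> A}. (y f, w f) = v}" and eq: "fst f = fst g"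
            have "y f = y g" "w f = w g" using f g by auto
            then have "x \<triangle> (fst f \<triangle> fst (snd f)) = x \<triangle> (fst f \<triangle> fst (snd g))"
              using eq by (simp add: y_def)
            then have "fst (snd f) = fst (snd g)" by (rule injt)
            then show "f = g" using eq \<open>w f = w g\<close> by (simp add: prod_eq_iff w_def)
          qed
        qed (use finS in \<open>auto simp: star_triples_def\<close>)
        show "real (card (A \<times> A)) \<le> L\<^sup>2"
          using cA L by (simp add: card_cartesian_product power2_eq_square mult_mono)
      qed (rule finP, use finA N_pos in auto)
      show ?thesis
        by (intro add_mono mult_left_mono k0 k1 k2 k3) (use p in auto)
    qed
    also have "\<dots> = \<mu>"
      unfolding mu D_def by (simp add: algebra_simps power2_eq_square)
    finally show "(\<Sum>f\<in>?F. p ^ card (?\<tau> f - A)) \<le> \<mu>" .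
  qed
  also have "\<mu> / (2 * \<mu>) = 1/2" using mupos by simp
  finally show ?thesis .
qed

text \<open>If \<open>u\<close> meets \<open>J\<close> and \<open>s \<triangle> t\<close> does not,
  then \<open>x \<triangle> u\<close> cannot lie between \<open>x\<close> and
  \<open>x \<triangle> (s \<triangle> t)\<close>. These pairs are thus safe from every obstruction
  that is hit by \<open>J\<close>.\<close>

definition free_pairs :: "nat set \<Rightarrow> nat \<Rightarrow> (nat set \<times> nat set) set" where
  "free_pairs J d0 = {(s, t). s \<in> S \<and> t \<in> S \<and> s \<noteq> t \<and> (s \<triangle> t) \<inter> J = {} \<and> card (s \<triangle> t) \<le> d0}"

lemma finite_free_pairs: "finite (free_pairs J d0)"
  by (rule finite_subset[of _ "S \<times> S"]) (auto simp: free_pairs_def finS)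

text \<open>A point \<open>y\<close> may arise from up to \<open>N\<close> pairs, at most one for
  each \<open>s\<close>. Dividing its multiplicity by \<open>N\<close> gives weights in [0, 1], to
  which the lower tail with deviation 1/2 applies; the division reappears in the exponent.\<close>

lemma prob_free_pairs:
  assumes x: "x \<in> \<Omega>"
  shows "measure_pmf.prob M {V. real (card {(s, t) \<in> free_pairs J d0. x \<triangle> (s \<triangle> t) \<in> V}) \<le> p * real (card (free_pairs J d0)) / 2}
     \<le> exp (- (p * real (card (free_pairs J d0)) / (8 * N)))"
proof -
  let ?P = "free_pairs J d0"
  let ?g = "\<lambda>y. {(s, t) \<in> ?P. x \<triangle> (s \<triangle> t) = y}"
  define c where "c = (\<lambda>y. real (card (?g y)) / N)"
  have cle: "c y \<le> 1" for y
  proof -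
    have "card (?g y) \<le> card S"
    proof (rule card_inj_on_le[where f = fst])
      show "inj_on fst (?g y)"
        by (rule inj_onI) (auto simp: prod_eq_iff simp del: in_symdiff_iff)
    qed (use finS in \<open>auto simp: free_pairs_def\<close>)
    then show ?thesis using N_pos by (simp add: c_def N_def)
  qed
  have sum: "N * (\<Sum>y\<in>Y. c y) = real (card {(s, t) \<in> ?P. x \<triangle> (s \<triangle> t) \<in> Y})" if "finite Y" for Y
  proof -
    have "N * (\<Sum>y\<in>Y. c y) = (\<Sum>y\<in>Y. real (card (?g y)))"
      using N_pos by (simp add: c_def sum_divide_distrib[symmetric])
    also have "\<dots> = real (card (\<Union>y\<in>Y. ?g y))"
      by (subst card_UN_disjoint)
         (use that in \<open>auto intro: finite_subset[OF _ finite_free_pairs]\<close>)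
    also have "(\<Union>y\<in>Y. ?g y) = {(s, t) \<in> ?P. x \<triangle> (s \<triangle> t) \<in> Y}" by auto
    finally show ?thesis .
  qed
  have tot: "N * (\<Sum>y\<in>\<Omega>. c y) = real (card ?P)"
  proof -
    have "{(s, t) \<in> ?P. x \<triangle> (s \<triangle> t) \<in> \<Omega>} = ?P"
    proof -
      have "x \<triangle> (s \<triangle> t) \<in> \<Omega>" if "s \<in> S" "t \<in> S" for s t
        using that x S_Omega by (intro sdO) auto
      then show ?thesis by (auto simp: free_pairs_def simp del: in_symdiff_iff)
    qed
    then show ?thesis using sum[OF fin] by simp
  qed
  have "measure_pmf.prob M {V. real (card {(s, t) \<in> ?P. x \<triangle> (s \<triangle> t) \<in> V}) \<le> p * real (card ?P) / 2}
      \<le> measure_pmf.prob M {V. (\<Sum>y\<in>\<Omega> \<inter> V. c y) \<le> (1 - 1/2) * (p * (\<Sum>y\<in>\<Omega>. c y))}"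
  proof (rule prob_mono, clarify)
    fix V assume V: "V \<subseteq> \<Omega>" and h: "real (card {(s, t) \<in> ?P. x \<triangle> (s \<triangle> t) \<in> V}) \<le> p * real (card ?P) / 2"
    have VV: "\<Omega> \<inter> V = V" "finite V" using V fin finite_subset by auto
    have "N * (\<Sum>y\<in>V. c y) \<le> p * (N * (\<Sum>y\<in>\<Omega>. c y)) / 2" using h unfolding sum[OF VV(2)] tot .
    then have "N * (\<Sum>y\<in>V. c y) \<le> N * (p * (\<Sum>y\<in>\<Omega>. c y) / 2)" by (simp add: mult_ac)
    then have "(\<Sum>y\<in>V. c y) \<le> p * (\<Sum>y\<in>\<Omega>. c y) / 2" using N_pos by simp
    then show "(\<Sum>y\<in>\<Omega> \<inter> V. c y) \<le> (1 - 1/2) * (p * (\<Sum>y\<in>\<Omega>. c y))" unfolding VV by simp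
  qed
  also have "\<dots> \<le> exp (- ((1/2)\<^sup>2 * (p * (\<Sum>y\<in>\<Omega>. c y)) / 2))"
    unfolding M_def by (rule prob_weight_le[OF fin p0 p(2)]) (use cle N_pos in \<open>auto simp: c_def\<close>)
  also have "\<dots> = exp (- (p * real (card ?P) / (8 * N)))"
    unfolding tot[symmetric] using N_pos by (simp add: power2_eq_square field_simps)
  finally show ?thesis .
qed

end

section \<open>Expansion of a sample\<close>

text \<open>Rests on the case \<open>j = k\<close> of \<open>cube_adj\<close>: an empty subcube
  between \<open>a\<close> and \<open>b\<close> would make them adjacent.\<close>

lemma not_cube_adjD:
  assumes "\<not> cube_adj V a b" "a \<noteq> b"
  obtains w where "w \<in> V" "w \<triangle> a \<subseteq> a \<triangle> b" "w \<noteq> a" "w \<noteq> b"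
proof -
  obtain i where i: "i \<in> a \<triangle> b" using assms(2) by auto
  have "\<not> (\<forall>w\<in>V. w \<triangle> a \<subseteq> a \<triangle> b \<longrightarrow> w = a \<or> w = b \<or> (i \<in> w \<triangle> a \<and> i \<notin> w \<triangle> a))"
    using assms i unfolding cube_adj_def by meson
  then show thesis using that by meson
qed

text \<open>Expansion in terms of ordered \<open>cube_adj\<close> pairs, so that the probabilistic
  part does not mention polytopes. Two points are required so that the minimum in the edge expansion
  is not over the empty set.\<close>

definition expanding :: "real \<Rightarrow> nat set set \<Rightarrow> bool" where
  "expanding K V \<longleftrightarrow> 2 \<le> card V \<and> (\<forall>U\<subseteq>V. 2 * card U \<le> card V \<longrightarrow>
     K * real (card U) \<le> real (card {(a, b). a \<in> U \<and> b \<in> V - U \<and> cube_adj V a b}))"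

context cube_sample
begin

text \<open>The few sampled points close to \<open>x\<close> are all hit by a small set \<open>J\<close> of coordinates, so they obstruct
  no pair that avoids \<open>J\<close>.\<close>

lemma degree_lower:
  fixes \<epsilon> :: real
  assumes V: "V \<subseteq> \<Omega>" and x: "x \<in> V"
    and Low: "Low \<subseteq> \<Omega>" "{} \<notin> Low"
      "\<And>s t u. s \<in> S \<Longrightarrow> t \<in> S \<Longrightarrow> u \<subseteq> s \<triangle> t \<Longrightarrow> u \<noteq> {} \<Longrightarrow> card u \<le> s0 \<Longrightarrow> u \<in> Low"
    and few: "card {u \<in> Low. x \<triangle> u \<in> V} < k"
    and free: "\<And>J. J \<in> \<Omega> \<Longrightarrow> card J \<le> k \<Longrightarrow>
        5 * \<epsilon> * N * D \<le> real (card {(s, t) \<in> free_pairs J d0. x \<triangle> (s \<triangle> t) \<in> V})"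
    and star: "real (card {f \<in> star_triples x d0 s0. star_points x f \<subseteq> V}) \<le> \<epsilon> * N * D"
  shows "4 * \<epsilon> * N * D \<le> (\<Sum>z\<in>{z \<in> \<Omega>. x \<in> hub S V z}. real (card {y \<in> hub S V z. cube_adj V x y}))"
proof -
  have xO: "x \<in> \<Omega>" using V x by auto
  have finV: "finite V" using V fin finite_subset by blast
  have finLow: "finite Low" using Low fin finite_subset by blast
  \<comment> \<open>One coordinate per close sampled point is enough to hit all of them, so
    \<open>J\<close> is no larger than their number.\<close>
  define pick where "pick = (\<lambda>u :: nat set. SOME i. i \<in> u)"
  have pick: "pick u \<in> u" if "u \<in> Low" for u
    using that Low(2) unfolding pick_def by (metis ex_in_conv someI_ex)
  define J where "J = pick ` {u \<in> Low. x \<triangle> u \<in> V}"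
  have JO: "J \<in> \<Omega>" using pick Low(1) by (force simp: J_def \<Omega>_def)
  have "card J \<le> card {u \<in> Low. x \<triangle> u \<in> V}"
    unfolding J_def by (rule card_image_le) (use finLow in simp)
  then have cJ: "card J \<le> k" using few by simp
  define P where "P = {(s, t) \<in> free_pairs J d0. x \<triangle> (s \<triangle> t) \<in> V}"
  define P1 where "P1 = {(s, t) \<in> P. cube_adj V x (x \<triangle> (s \<triangle> t))}"
  define P2 where "P2 = {(s, t) \<in> P. \<not> cube_adj V x (x \<triangle> (s \<triangle> t))}"
  have finP: "finite P"
    by (rule finite_subset[OF _ finite_free_pairs[of J d0]]) (auto simp: P_def)
  have finP12: "finite P1" "finite P2"
    using finP by (auto simp: P1_def P2_def intro: finite_subset)
  have PP: "card P \<le> card P1 + card P2"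
  proof -
    have "P = P1 \<union> P2" by (auto simp: P1_def P2_def)
    then show ?thesis using card_Un_le[of P1 P2] by simp
  qed
  let ?T = "{f \<in> star_triples x d0 s0. star_points x f \<subseteq> V}"
  have finT: "finite ?T"
  proof (rule finite_subset[of _ "S \<times> S \<times> \<Omega>"])
    show "?T \<subseteq> S \<times> S \<times> \<Omega>" by (auto simp: star_triples_def)
  qed (auto simp: finS fin)
  have "P2 \<subseteq> (\<lambda>f. (fst f, fst (snd f))) ` ?T"
  proof clarify
    fix s t assume st: "(s, t) \<in> P2"
    have S2: "s \<in> S" "t \<in> S" "s \<noteq> t" "(s \<triangle> t) \<inter> J = {}" "card (s \<triangle> t) \<le> d0" "x \<triangle> (s \<triangle> t) \<in> V"
      "\<not> cube_adj V x (x \<triangle> (s \<triangle> t))"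
      using st by (auto simp: P2_def P_def free_pairs_def simp del: in_symdiff_iff)
    have "x \<noteq> x \<triangle> (s \<triangle> t)" using S2(3) by (metis symdiff_eq_self symdiff_eq_empty)
    then obtain w where w: "w \<in> V" "w \<triangle> x \<subseteq> x \<triangle> (x \<triangle> (s \<triangle> t))" "w \<noteq> x" "w \<noteq> x \<triangle> (s \<triangle> t)"
      using not_cube_adjD[OF S2(7)] by blast
    have wx: "w \<triangle> x \<subseteq> s \<triangle> t" using w(2) by simp
    have "s0 < card (w \<triangle> x)"
    proof (rule ccontr)
      assume c: "\<not> s0 < card (w \<triangle> x)"
      have "w \<triangle> x \<in> Low" by (rule Low(3)[OF S2(1,2) wx]) (use c w(3) in auto)
      moreover have "x \<triangle> (w \<triangle> x) = w" by (simp add: symdiff_left_commute)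
      ultimately have "w \<triangle> x \<in> {u \<in> Low. x \<triangle> u \<in> V}" using w(1) by simp
      then have "pick (w \<triangle> x) \<in> J" "pick (w \<triangle> x) \<in> w \<triangle> x"
        using pick unfolding J_def by blast+
      then show False using wx S2(4) by blast
    qed
    then have "(s, t, w) \<in> ?T"
      using S2 w wx V by (auto simp: star_triples_def star_points_def simp del: in_symdiff_iff)
    then show "(s, t) \<in> (\<lambda>f. (fst f, fst (snd f))) ` ?T" by force
  qed
  then have "card P2 \<le> card ?T"
    using finT by (meson card_image_le card_mono finite_imageI order_trans)
  then have P2: "real (card P2) \<le> \<epsilon> * N * D" using star by linarith
  have Pl: "5 * \<epsilon> * N * D \<le> real (card P)"
    using free[OF JO cJ] by (simp add: P_def)
  let ?Q = "SIGMA z:{z \<in> \<Omega>. x \<in> hub S V z}. {y \<in> hub S V z. cube_adj V x y}"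
  have finQ: "finite ?Q"
    using fin finV by (auto simp: hub_def intro!: finite_SigmaI)
  \<comment> \<open>A pair is recorded by the hub centre and the neighbour found in that hub;
    \<open>s\<close> can be read off the former, then \<open>t\<close> off the latter.\<close>
  have "card P1 \<le> card ?Q"
  proof (rule card_inj_on_le[where f = "\<lambda>(s, t). (x \<triangle> s, x \<triangle> (s \<triangle> t))"])
    show "inj_on (\<lambda>(s, t). (x \<triangle> s, x \<triangle> (s \<triangle> t))) P1"
      by (rule inj_onI) (auto simp: prod_eq_iff simp del: in_symdiff_iff)
    show "(\<lambda>(s, t). (x \<triangle> s, x \<triangle> (s \<triangle> t))) ` P1 \<subseteq> ?Q"
    proof (rule image_subsetI)
      fix q assume "q \<in> P1"
      then obtain s t where q: "q = (s, t)" and st: "(s, t) \<in> P1" by (cases q) auto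
      then have S2: "s \<in> S" "t \<in> S" "x \<triangle> (s \<triangle> t) \<in> V" "cube_adj V x (x \<triangle> (s \<triangle> t))"
        by (auto simp: P1_def P_def free_pairs_def simp del: in_symdiff_iff)
      have "x \<triangle> s \<in> \<Omega>" using xO S2 S_Omega sdO by blast
      moreover have "x \<in> hub S V (x \<triangle> s)" using x S2 by (simp add: hub_def)
      moreover have "x \<triangle> (s \<triangle> t) \<triangle> (x \<triangle> s) = t" by auto
      then have "x \<triangle> (s \<triangle> t) \<in> hub S V (x \<triangle> s)" using S2 by (simp add: hub_def)
      ultimately show "(case q of (s, t) \<Rightarrow> (x \<triangle> s, x \<triangle> (s \<triangle> t))) \<in> ?Q"
        using S2 by (simp add: q)
    qed
    show "finite ?Q" by (rule finQ)
  qed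
  then have "real (card P1) \<le> real (card ?Q)" by simp
  also have "\<dots> = (\<Sum>z\<in>{z \<in> \<Omega>. x \<in> hub S V z}. real (card {y \<in> hub S V z. cube_adj V x y}))"
    using fin finV by (subst card_SigmaI) (auto simp: hub_def)
  finally have "real (card P1) \<le> (\<Sum>z\<in>{z \<in> \<Omega>. x \<in> hub S V z}. real (card {y \<in> hub S V z. cube_adj V x y}))" .
  moreover have "real (card P) \<le> real (card P1) + real (card P2)" using PP by linarith
  ultimately show ?thesis using P2 Pl by linarith
qed

text \<open>The empty step stands for pairs inside a single hub.\<close>

definition edge_steps :: "nat set set" where
  "edge_steps = insert {} ((\<lambda>i. {i}) ` {..<n})"

lemma card_edge_steps: "card edge_steps \<le> 2 ^ n"
proof -
  have "card edge_steps \<le> Suc (card ((\<lambda>i. {i}) ` {..<n}))"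
    unfolding edge_steps_def by (rule card_insert_le_m1) auto
  also have "\<dots> \<le> Suc n" using card_image_le[of "{..<n}" "\<lambda>i. {i}"] by simp
  also have "\<dots> \<le> 2 ^ n" by (simp add: Suc_le_eq)
  finally show ?thesis .
qed

lemma edge_steps_Omega: "e \<in> edge_steps \<Longrightarrow> e \<in> \<Omega>" "e \<in> edge_steps \<Longrightarrow> card e \<le> 1"
  by (auto simp: edge_steps_def \<Omega>_def)

text \<open>Two nested union bounds over at most \<open>2 ^ n\<close> objects, such as a cube point
  and a coordinate set \<open>J\<close>, still leave \<open>(1/2) ^ n\<close>.\<close>

lemma half_power_bound: "2 ^ n * (2 ^ n * (1/2) ^ (4 * n)) \<le> (1/2 :: real) ^ n"
proof -
  have "2 ^ n * (2 ^ n * (1/2 :: real) ^ (4 * n)) = (1/2) ^ (2 * n)"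
    by (simp add: power_divide field_simps power_add[symmetric])
  also have "\<dots> \<le> (1/2) ^ n" by (rule power_decreasing) auto
  finally show ?thesis .
qed

lemma half_power_bound': "2 ^ n * (c * (1/2) ^ (4 * n)) \<le> c * (1/2 :: real) ^ n" if "c \<ge> 0"
proof -
  have "2 ^ n * (c * (1/2 :: real) ^ (4 * n)) = c * (1/2) ^ (3 * n)"
    by (simp add: power_divide field_simps power_add[symmetric])
  also have "\<dots> \<le> c * (1/2) ^ n" by (intro mult_left_mono power_decreasing that) auto
  finally show ?thesis .
qed

text \<open>The condition on pairs of hubs stays a hypothesis because the two choices of
  \<open>S\<close> establish it differently. The constants form a chain: \<open>free\<close>
  supplies 10 \<epsilon> N^2 pairs, at least half of the expected 10 \<epsilon> N D of them have
  their far endpoint sampled, and star obstructions remove at most \<epsilon> N D, which leaves the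
  4 \<epsilon> N D wanted by \<open>hub_expansion\<close>.\<close>

lemma prob_expanding:
  fixes \<epsilon> C1 C2 L \<pi> :: real and k d0 s0 :: nat
  assumes Dn: "D \<ge> 2000 * real n" and eps: "0 < \<epsilon>" "\<epsilon> \<le> 1/10" "\<epsilon> * D \<ge> 3 * real n"
    and Low: "Low \<subseteq> \<Omega>" "{} \<notin> Low"
      "\<And>s t u. s \<in> S \<Longrightarrow> t \<in> S \<Longrightarrow> u \<subseteq> s \<triangle> t \<Longrightarrow> u \<noteq> {} \<Longrightarrow> card u \<le> s0 \<Longrightarrow> u \<in> Low"
    and few: "real (card Low choose k) * p ^ k \<le> (1/2) ^ (4 * n)"
    and free: "\<And>J. J \<in> \<Omega> \<Longrightarrow> card J \<le> k \<Longrightarrow> 10 * \<epsilon> * N\<^sup>2 \<le> real (card (free_pairs J d0))"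
    and C1: "\<And>s. s \<in> S \<Longrightarrow> (\<Sum>t\<in>S. 2 ^ card (s \<triangle> t)) \<le> C1"
    and C2: "\<And>u. u \<in> \<Omega> \<Longrightarrow> s0 < card u \<Longrightarrow> real (card {(s, t). s \<in> S \<and> t \<in> S \<and> u \<subseteq> s \<triangle> t}) \<le> C2" "C2 \<ge> 0"
    and L: "L = 12 * real n"
    and mu: "2 * (p * D * C1 + p * L * C2 + L * D * 2 ^ d0 + L\<^sup>2 * N) \<le> \<epsilon> * N * D"
    and pairs: "measure_pmf.prob M {V. \<exists>z\<in>\<Omega>. \<exists>e\<in>edge_steps.
        \<not> real (card {(a, b). a \<in> hub S V z \<and> b \<in> hub S V (z \<triangle> e) \<and> \<not> cube_adj V a b}) \<le> \<epsilon>\<^sup>2 * D\<^sup>2 / 4} \<le> \<pi>"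
  shows "measure_pmf.prob M {V. \<not> expanding (\<epsilon>\<^sup>2 * D / (25 * real n)) V} \<le> 5 * (1/2) ^ n + \<pi>"
proof -
  have n1: "real n \<ge> 1" using n by simp
  define B1 where "B1 = (\<lambda>V. \<exists>z\<in>\<Omega>. \<not> (9/10 * D \<le> real (card (hub S V z)) \<and> real (card (hub S V z)) \<le> 11/10 * D))"
  define B2 where "B2 = (\<lambda>V. \<exists>z\<in>\<Omega>. k \<le> card {u \<in> Low. z \<triangle> u \<in> V})"
  \<comment> \<open>The relevant \<open>J\<close> depends on the sample, so the event has to range
    over all small \<open>J\<close>.\<close>
  define B3 where "B3 = (\<lambda>V. \<exists>x\<in>\<Omega>. \<exists>J\<in>{J \<in> \<Omega>. card J \<le> k}.
      real (card {(s, t) \<in> free_pairs J d0. x \<triangle> (s \<triangle> t) \<in> V}) \<le> p * real (card (free_pairs J d0)) / 2)"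
  define \<mu> where "\<mu> = p * D * C1 + p * L * C2 + L * D * 2 ^ d0 + L\<^sup>2 * N"
  define B4 where "B4 = (\<lambda>V. \<exists>x\<in>\<Omega>. 2 * \<mu> \<le> real (card {f \<in> star_triples x d0 s0. star_points x f \<subseteq> V}))"
  define B5 where "B5 = (\<lambda>V. \<exists>z\<in>\<Omega>. \<exists>e\<in>edge_steps.
        \<not> real (card {(a, b). a \<in> hub S V z \<and> b \<in> hub S V (z \<triangle> e) \<and> \<not> cube_adj V a b}) \<le> \<epsilon>\<^sup>2 * D\<^sup>2 / 4)"
  have Np: "N > 0" using N_pos by simp
  have p1: "measure_pmf.prob M {V. B1 V} \<le> 2 * (1/2) ^ n"
    using prob_hub_sizes[OF Dn] half_power_bound'[of 2] unfolding B1_def by linarith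
  have p2: "measure_pmf.prob M {V. B2 V} \<le> (1/2) ^ n"
  proof -
    have "measure_pmf.prob M {V. B2 V} \<le> 2 ^ n * (real (card Low choose k) * p ^ k)"
      unfolding B2_def by (rule prob_low_count[OF Low(1)])
    also have "\<dots> \<le> 2 ^ n * (1/2) ^ (4 * n)" by (rule mult_left_mono[OF few]) simp
    finally show ?thesis using half_power_bound'[of 1] by simp
  qed
  have p3: "measure_pmf.prob M {V. B3 V} \<le> (1/2) ^ n"
  proof -
    have "measure_pmf.prob M {V. real (card {(s, t) \<in> free_pairs J d0. x \<triangle> (s \<triangle> t) \<in> V}) \<le> p * real (card (free_pairs J d0)) / 2}
        \<le> (1/2) ^ (4 * n)" if x: "x \<in> \<Omega>" and J: "J \<in> {J \<in> \<Omega>. card J \<le> k}" for x J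
    proof -
      have "3 * real n \<le> p * real (card (free_pairs J d0)) / (8 * N)"
      proof -
        have "p * (10 * \<epsilon> * N\<^sup>2) \<le> p * real (card (free_pairs J d0))"
          using free[of J] J p by (intro mult_left_mono) auto
        then have "p * (10 * \<epsilon> * N\<^sup>2) / (8 * N) \<le> p * real (card (free_pairs J d0)) / (8 * N)"
          using Np by (intro divide_right_mono) auto
        moreover have "p * (10 * \<epsilon> * N\<^sup>2) / (8 * N) = 10/8 * (\<epsilon> * D)"
          using Np by (simp add: D_def power2_eq_square)
        ultimately show ?thesis using eps n1 by linarith
      qed
      then have "exp (- (p * real (card (free_pairs J d0)) / (8 * N))) \<le> (1/2) ^ (4 * n)"
        by (rule exp_le_half_power)
      then show ?thesis using prob_free_pairs[OF x, of J d0] by linarith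
    qed
    then have "measure_pmf.prob M {V. \<exists>J\<in>{J \<in> \<Omega>. card J \<le> k}.
        real (card {(s, t) \<in> free_pairs J d0. x \<triangle> (s \<triangle> t) \<in> V}) \<le> p * real (card (free_pairs J d0)) / 2}
        \<le> real (card {J \<in> \<Omega>. card J \<le> k}) * (1/2) ^ (4 * n)" if x: "x \<in> \<Omega>" for x
      using x fin by (intro prob_union) auto
    moreover have "real (card {J \<in> \<Omega>. card J \<le> k}) \<le> 2 ^ n"
      unfolding card_Omega[symmetric] by (intro of_nat_mono card_mono fin) auto
    ultimately have "measure_pmf.prob M {V. \<exists>J\<in>{J \<in> \<Omega>. card J \<le> k}.
        real (card {(s, t) \<in> free_pairs J d0. x \<triangle> (s \<triangle> t) \<in> V}) \<le> p * real (card (free_pairs J d0)) / 2}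
        \<le> 2 ^ n * (1/2) ^ (4 * n)" if x: "x \<in> \<Omega>" for x
      using x mult_right_mono[of "real (card {J \<in> \<Omega>. card J \<le> k})" "2 ^ n" "(1/2) ^ (4 * n)"]
      by (meson order_trans zero_le_power zero_le_divide_1_iff zero_le_numeral)
    then have "measure_pmf.prob M {V. B3 V} \<le> real (card \<Omega>) * (2 ^ n * (1/2) ^ (4 * n))"
      unfolding B3_def by (intro prob_union fin) auto
    then show ?thesis using half_power_bound unfolding card_Omega by linarith
  qed
  have p4: "measure_pmf.prob M {V. B4 V} \<le> (1/2) ^ n"
  proof -
    have "measure_pmf.prob M {V. 2 * \<mu> \<le> real (card {f \<in> star_triples x d0 s0. star_points x f \<subseteq> V})} \<le> (1/2) ^ (4 * n)"
      if "x \<in> \<Omega>" for x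
      by (rule prob_star_triples[OF that C1 C2(1) _ _ C2(2) \<mu>_def]) (use L n1 in auto)
    then have "measure_pmf.prob M {V. B4 V} \<le> real (card \<Omega>) * (1/2) ^ (4 * n)"
      unfolding B4_def by (intro prob_union fin) auto
    then show ?thesis using half_power_bound'[of 1] unfolding card_Omega by simp
  qed
  have p5: "measure_pmf.prob M {V. B5 V} \<le> \<pi>" using pairs by (simp only: B5_def)
  have "measure_pmf.prob M {V. \<not> expanding (\<epsilon>\<^sup>2 * D / (25 * real n)) V}
      \<le> measure_pmf.prob M {V. B1 V \<or> B2 V \<or> B3 V \<or> B4 V \<or> B5 V}"
  proof (rule prob_mono, rule CollectI, rule ccontr)
    fix V assume V: "V \<subseteq> \<Omega>" and ne: "V \<in> {V. \<not> expanding (\<epsilon>\<^sup>2 * D / (25 * real n)) V}"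
      and "\<not> (B1 V \<or> B2 V \<or> B3 V \<or> B4 V \<or> B5 V)"
    then have B: "\<not> B1 V" "\<not> B2 V" "\<not> B3 V" "\<not> B4 V" "\<not> B5 V" by auto
    have finV: "finite V" using V fin finite_subset by blast
    have size: "9/10 * D \<le> real (card (hub S V z))" "real (card (hub S V z)) \<le> 11/10 * D"
      if "z \<in> Pow {..<n}" for z
      using B(1) that unfolding B1_def \<Omega>_def by blast+
    have card2: "2 \<le> card V"
    proof -
      have "9/10 * D \<le> real (card (hub S V {}))" by (rule size) simp
      moreover have "card (hub S V {}) \<le> card V" by (rule card_mono[OF finV hub_subset])
      ultimately have "2 \<le> real (card V)" using Dn n1 by linarith
      then show ?thesis by simp
    qed
    have deg: "4 * \<epsilon> * real (card S) * D
        \<le> (\<Sum>z\<in>{z \<in> Pow {..<n}. x \<in> hub S V z}. real (card {y \<in> hub S V z. cube_adj V x y}))"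
      if x: "x \<in> V" for x
    proof -
      have xO: "x \<in> \<Omega>" using x V by auto
      have "4 * \<epsilon> * N * D \<le> (\<Sum>z\<in>{z \<in> \<Omega>. x \<in> hub S V z}. real (card {y \<in> hub S V z. cube_adj V x y}))"
      proof (rule degree_lower[OF V x Low])
        show "card {u \<in> Low. x \<triangle> u \<in> V} < k"
          using B(2) xO unfolding B2_def by (meson not_le)
        show "5 * \<epsilon> * N * D \<le> real (card {(s, t) \<in> free_pairs J d0. x \<triangle> (s \<triangle> t) \<in> V})"
          if J: "J \<in> \<Omega>" "card J \<le> k" for J
        proof -
          have "J \<in> {J \<in> \<Omega>. card J \<le> k}" using J by simp
          then have "\<not> real (card {(s, t) \<in> free_pairs J d0. x \<triangle> (s \<triangle> t) \<in> V}) \<le> p * real (card (free_pairs J d0)) / 2"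
            using B(3) xO unfolding B3_def by blast
          moreover have "p * (10 * \<epsilon> * N\<^sup>2) \<le> p * real (card (free_pairs J d0))"
            using free[of J] J p by (intro mult_left_mono) auto
          moreover have "5 * \<epsilon> * N * D = p * (10 * \<epsilon> * N\<^sup>2) / 2"
            by (simp add: D_def power2_eq_square)
          ultimately show ?thesis by linarith
        qed
        have "\<not> 2 * \<mu> \<le> real (card {f \<in> star_triples x d0 s0. star_points x f \<subseteq> V})"
          using B(4) xO unfolding B4_def by blast
        then show "real (card {f \<in> star_triples x d0 s0. star_points x f \<subseteq> V}) \<le> \<epsilon> * N * D"
          using mu by (simp add: \<mu>_def)
      qed
      then show ?thesis by (simp add: N_def \<Omega>_def)
    qed
    have pr: "real (card {(a, b). a \<in> hub S V z \<and> b \<in> hub S V (z \<triangle> e) \<and> \<not> cube_adj V a b}) \<le> \<epsilon>\<^sup>2 * D\<^sup>2 / 4"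
      if "z \<in> Pow {..<n}" "e = {} \<or> (\<exists>i<n. e = {i})" for z e
    proof -
      have "e \<in> edge_steps" using that(2) by (auto simp: edge_steps_def)
      then show ?thesis using B(5) that(1) unfolding B5_def \<Omega>_def by blast
    qed
    have "expanding (\<epsilon>\<^sup>2 * D / (25 * real n)) V"
      unfolding expanding_def
    proof (intro conjI allI impI card2)
      fix U assume U: "U \<subseteq> V" "2 * card U \<le> card V"
      show "\<epsilon>\<^sup>2 * D / (25 * real n) * real (card U) \<le> real (card {(a, b). a \<in> U \<and> b \<in> V - U \<and> cube_adj V a b})"
        by (rule hub_expansion[OF _ S n D_pos eps(1,2) size deg pr U])
           (use V in \<open>auto simp: \<Omega>_def\<close>)
    qed
    then show False using ne by simp
  qed
  also have "\<dots> \<le> measure_pmf.prob M {V. B1 V} + (measure_pmf.prob M {V. B2 V}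
      + (measure_pmf.prob M {V. B3 V} + (measure_pmf.prob M {V. B4 V} + measure_pmf.prob M {V. B5 V})))"
    by (intro order_trans[OF prob_disj] add_left_mono) simp
  finally show ?thesis using p1 p2 p3 p4 p5 by linarith
qed

end

section \<open>Subcubes as hubs\<close>

lemma sum_Pow_power_card:
  fixes x :: real
  assumes "finite I"
  shows "(\<Sum>v\<in>Pow I. x ^ card v) = (1 + x) ^ card I"
  using assms
proof (induction I)
  case empty
  then show ?case by simp
next
  case (insert a I)
  have "(\<Sum>v\<in>Pow (insert a I). x ^ card v) = (\<Sum>v\<in>Pow I. x ^ card v) + (\<Sum>v\<in>insert a ` Pow I. x ^ card v)"
    unfolding Pow_insert by (rule sum.union_disjoint) (use insert in auto)
  also have "(\<Sum>v\<in>insert a ` Pow I. x ^ card v) = (\<Sum>v\<in>Pow I. x ^ card (insert a v))"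
    by (subst sum.reindex) (use insert in \<open>auto simp: inj_on_def\<close>)
  also have "\<dots> = (\<Sum>v\<in>Pow I. x * x ^ card v)"
  proof (rule sum.cong)
    fix v assume "v \<in> Pow I"
    then have "a \<notin> v" "finite v" using insert finite_subset by auto
    then show "x ^ card (insert a v) = x * x ^ card v" by simp
  qed simp
  finally show ?case using insert by (simp add: sum_distrib_left[symmetric] algebra_simps)
qed

text \<open>Give every subset \<open>u\<close> the weight \<open>x ^ card u\<close>: a subset with
  at most \<open>s\<close> elements weighs at least \<open>x ^ s\<close>, and all subsets together
  weigh \<open>(1 + x) ^ card I\<close>.\<close>

lemma card_small_subsets_le:
  fixes x :: real
  assumes "finite I" "0 < x" "x \<le> 1"
  shows "real (card {u. u \<subseteq> I \<and> u \<noteq> {} \<and> card u \<le> s}) * x ^ s \<le> (1 + x) ^ card I"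
proof -
  let ?U = "{u. u \<subseteq> I \<and> u \<noteq> {} \<and> card u \<le> s}"
  have "real (card ?U) * x ^ s = (\<Sum>u\<in>?U. x ^ s)" by simp
  also have "\<dots> \<le> (\<Sum>u\<in>?U. x ^ card u)"
    using assms by (intro sum_mono power_decreasing) auto
  also have "\<dots> \<le> (\<Sum>u\<in>Pow I. x ^ card u)"
    using assms by (intro sum_mono2) auto
  finally show ?thesis using sum_Pow_power_card[OF assms(1)] by simp
qed

lemma sum_symdiff_Pow:
  assumes "finite I" "s \<subseteq> I"
  shows "(\<Sum>t\<in>Pow I. (2::real) ^ card (s \<triangle> t)) = 3 ^ card I"
proof -
  have "(\<Sum>t\<in>Pow I. (2::real) ^ card (s \<triangle> t)) = (\<Sum>v\<in>Pow I. 2 ^ card v)"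
    by (rule sum.reindex_bij_witness[where i = "\<lambda>v. s \<triangle> v" and j = "\<lambda>v. s \<triangle> v"])
       (use assms in \<open>auto\<close>)
  then show ?thesis using sum_Pow_power_card[OF assms(1), of 2] by simp
qed

text \<open>Coordinate by coordinate, lying between means agreeing with at least one endpoint. After
  translation by \<open>y\<close> and \<open>y'\<close>, the sets derived from \<open>s\<close> and
  \<open>t\<close> are where the endpoints disagree with \<open>w\<close>; they must be disjoint,
  which leaves three of four options per coordinate of \<open>I\<close>.\<close>

lemma card_between_Pow:
  fixes I :: "nat set"
  assumes "finite I"
  shows "real (card {(s, t). s \<in> Pow I \<and> t \<in> Pow I \<and> w \<triangle> (z \<triangle> s) \<subseteq> (z \<triangle> s) \<triangle> (z \<triangle> e \<triangle> t)}) \<le> 3 ^ card I"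
proof -
  let ?A = "{(s, t). s \<in> Pow I \<and> t \<in> Pow I \<and> w \<triangle> (z \<triangle> s) \<subseteq> (z \<triangle> s) \<triangle> (z \<triangle> e \<triangle> t)}"
  define y where "y = (w \<triangle> z) \<inter> I"
  define y' where "y' = (w \<triangle> z \<triangle> e) \<inter> I"
  let ?B = "SIGMA s:Pow I. Pow (I - s)"
  have "card ?A \<le> card ?B"
  proof (rule card_inj_on_le[where f = "\<lambda>(s, t). (s \<triangle> y, t \<triangle> y')"])
    show "inj_on (\<lambda>(s, t). (s \<triangle> y, t \<triangle> y')) ?A"
      by (rule inj_onI) (auto simp: prod_eq_iff simp del: in_symdiff_iff)
    show "(\<lambda>(s, t). (s \<triangle> y, t \<triangle> y')) ` ?A \<subseteq> ?B"
    proof (rule image_subsetI)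
      fix q assume "q \<in> ?A"
      then obtain s t where q: "q = (s, t)" "s \<subseteq> I" "t \<subseteq> I" "w \<triangle> (z \<triangle> s) \<subseteq> (z \<triangle> s) \<triangle> (z \<triangle> e \<triangle> t)"
        by (cases q) (auto simp del: in_symdiff_iff)
      have "s \<triangle> y \<subseteq> I" "t \<triangle> y' \<subseteq> I" using q by (auto simp: y_def y'_def)
      moreover have "i \<notin> s \<triangle> y" if "i \<in> t \<triangle> y'" for i
      proof
        assume "i \<in> s \<triangle> y"
        moreover have "i \<in> I" using that q(3) by (auto simp: y'_def)
        ultimately have "i \<in> w \<triangle> (z \<triangle> s)" "i \<notin> (z \<triangle> s) \<triangle> (z \<triangle> e \<triangle> t)"
          using that by (auto simp: y_def y'_def)
        then show False using q(4) by blast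
      qed
      ultimately show "(case q of (s, t) \<Rightarrow> (s \<triangle> y, t \<triangle> y')) \<in> ?B"
        using q(1) by (auto simp del: in_symdiff_iff)
    qed
    show "finite ?B" using assms by auto
  qed
  also have "card ?B = (\<Sum>s\<in>Pow I. 2 ^ card (I - s))"
    using assms by (subst card_SigmaI) (auto simp: card_Pow)
  finally have "real (card ?A) \<le> (\<Sum>s\<in>Pow I. 2 ^ card (I - s))"
    by (metis (mono_tags, lifting) of_nat_le_iff of_nat_numeral of_nat_power of_nat_sum sum.cong)
  also have "\<dots> = (\<Sum>v\<in>Pow I. 2 ^ card v)"
    by (rule sum.reindex_bij_witness[where i = "\<lambda>v. I - v" and j = "\<lambda>v. I - v"]) (auto simp: double_diff)
  also have "\<dots> = 3 ^ card I" using sum_Pow_power_card[OF assms, of 2] by simp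
  finally show ?thesis .
qed

text \<open>For given \<open>s\<close> the set \<open>s \<triangle> t\<close> is prescribed on
  \<open>u\<close>, so every element of \<open>u\<close> halves the number of choices for
  \<open>t\<close>.\<close>

lemma card_superset_pairs_Pow:
  fixes I u :: "nat set"
  assumes "finite I" "s0 < card u"
  shows "real (card {(s, t). s \<in> Pow I \<and> t \<in> Pow I \<and> u \<subseteq> s \<triangle> t}) * 2 ^ s0 \<le> 4 ^ card I"
proof (cases "u \<subseteq> I")
  case True
  let ?A = "{(s, t). s \<in> Pow I \<and> t \<in> Pow I \<and> u \<subseteq> s \<triangle> t}"
  have "card ?A \<le> card (Pow I \<times> Pow (I - u))"
  proof (rule card_inj_on_le[where f = "\<lambda>(s, t). (s, (s \<triangle> t) - u)"])
    show "inj_on (\<lambda>(s, t). (s, (s \<triangle> t) - u)) ?A"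
    proof (rule inj_onI)
      fix q r assume q: "q \<in> ?A" and r: "r \<in> ?A"
        and eq: "(case q of (s, t) \<Rightarrow> (s, (s \<triangle> t) - u)) = (case r of (s, t) \<Rightarrow> (s, (s \<triangle> t) - u))"
      obtain s t s' t' where qr: "q = (s, t)" "r = (s', t')" by (cases q, cases r)
      have "s = s'" and d: "(s \<triangle> t) - u = (s \<triangle> t') - u" using eq qr by auto
      moreover have "u \<subseteq> s \<triangle> t" "u \<subseteq> s \<triangle> t'" using q r qr \<open>s = s'\<close> by auto
      then have "s \<triangle> t = s \<triangle> t'" using d by blast
      ultimately show "q = r" using qr by simp
    qed
  qed (use assms in auto)
  also have "\<dots> = 2 ^ card I * 2 ^ card (I - u)"
    using assms by (simp add: card_cartesian_product card_Pow)
  finally have "card ?A * 2 ^ card u \<le> 2 ^ card I * 2 ^ card (I - u) * 2 ^ card u" by simp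
  also have "\<dots> = 4 ^ card I"
  proof -
    have "card (I - u) + card u = card I"
      using True assms(1) by (metis card_Diff_subset card_mono finite_subset le_add_diff_inverse2)
    then have "(2::nat) ^ card (I - u) * 2 ^ card u = 2 ^ card I" by (simp add: power_add[symmetric])
    then show ?thesis by (simp add: mult.assoc power_mult_distrib[symmetric])
  qed
  finally have "real (card ?A * 2 ^ card u) \<le> real (4 ^ card I)" by (rule of_nat_mono)
  then have 1: "real (card ?A) * 2 ^ card u \<le> 4 ^ card I" by simp
  have "real (card ?A) * 2 ^ s0 \<le> real (card ?A) * 2 ^ card u"
    using assms(2) by (intro mult_left_mono power_increasing) auto
  then show ?thesis using 1 by linarith
next
  case False
  have emp: "{(s, t). s \<in> Pow I \<and> t \<in> Pow I \<and> u \<subseteq> s \<triangle> t} = {}"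
    using False by (auto simp: subset_iff)
  show ?thesis unfolding emp by simp
qed

text \<open>Complementation in \<open>X\<close> injects the large subsets into the small ones. The
  threshold \<open>m div 2\<close> serves all \<open>X\<close> with at most \<open>m\<close>
  elements, so that it can be fixed before \<open>J\<close> is removed.\<close>

lemma card_half_subsets_ge:
  assumes "finite X" "card X \<le> m"
  shows "2 ^ card X \<le> 2 * card {v. v \<subseteq> X \<and> card v \<le> m div 2}"
proof -
  let ?A = "{v. v \<subseteq> X \<and> card v \<le> m div 2}" and ?B = "{v. v \<subseteq> X \<and> \<not> card v \<le> m div 2}"
  have fin: "finite ?A" "finite ?B" using assms by auto
  have eq: "Pow X = ?A \<union> ?B" by auto
  have "card (Pow X) \<le> card ?A + card ?B" unfolding eq by (rule card_Un_le)
  then have "2 ^ card X \<le> card ?A + card ?B" using assms by (simp only: card_Pow)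
  also have "card ?B \<le> card ?A"
  proof (rule card_inj_on_le[where f = "\<lambda>v. X - v"])
    show "inj_on (\<lambda>v. X - v) ?B" by (rule inj_onI) blast
    show "(\<lambda>v. X - v) ` ?B \<subseteq> ?A"
    proof (rule image_subsetI)
      fix v assume "v \<in> ?B"
      then have v: "v \<subseteq> X" "\<not> card v \<le> m div 2" by auto
      then have "card (X - v) = card X - card v" using assms by (meson card_Diff_subset finite_subset)
      then show "X - v \<in> ?A" using v assms(2) by auto
    qed
    show "finite ?A" by (rule fin)
  qed
  finally show ?thesis by simp
qed

section \<open>Subcube hubs: non-adjacent pairs and the choice of parameters\<close>

context cube_sample
begin

text \<open>A non-adjacent pair either has equal entries, which happens at most 11/10 D times, or
  comes with an obstructing triple. No points are set aside (\<open>Hv = {}\<close>), as is possible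
  when \<open>C2\<close> is a good bound for every \<open>w\<close>, in particular for
  subcubes.\<close>

lemma prob_nonadjacent_pairs:
  fixes C1 C2 L \<epsilon> :: real
  assumes Dn: "D \<ge> 2000 * real n"
    and C1: "\<And>s. s \<in> S \<Longrightarrow> (\<Sum>t\<in>S. 2 ^ card (s \<triangle> t)) \<le> C1"
    and C2: "\<And>z e w. real (card {(s, t). s \<in> S \<and> t \<in> S \<and> w \<triangle> (z \<triangle> s) \<subseteq> (z \<triangle> s) \<triangle> (z \<triangle> e \<triangle> t)}) \<le> C2"
      "C2 \<ge> 0"
    and dm: "\<And>s t. s \<in> S \<Longrightarrow> t \<in> S \<Longrightarrow> card (s \<triangle> t) \<le> dm"
    and L: "L = 12 * real n"
    and mu: "\<mu> = 2 * p\<^sup>2 * D * C1 + 4 * p\<^sup>2 * L * C1 + p\<^sup>2 * L * C2 + 2 * p * L\<^sup>2 * 2 ^ dm + 2 * L\<^sup>2 * D + L ^ 3"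
    and small: "11/10 * D + 2 * \<mu> \<le> \<epsilon>\<^sup>2 * D\<^sup>2 / 4"
  shows "measure_pmf.prob M {V. \<exists>z\<in>\<Omega>. \<exists>e\<in>edge_steps.
        \<not> real (card {(a, b). a \<in> hub S V z \<and> b \<in> hub S V (z \<triangle> e) \<and> \<not> cube_adj V a b}) \<le> \<epsilon>\<^sup>2 * D\<^sup>2 / 4}
      \<le> 3 * (1/2) ^ n"
proof -
  have n1: "real n \<ge> 1" using n by simp
  define B1 where "B1 = (\<lambda>V. \<exists>z\<in>\<Omega>. \<not> (9/10 * D \<le> real (card (hub S V z)) \<and> real (card (hub S V z)) \<le> 11/10 * D))"
  define B2 where "B2 = (\<lambda>V. \<exists>z\<in>\<Omega>. \<exists>e\<in>edge_steps.
      2 * \<mu> \<le> real (card {f \<in> pair_triples z e {}. triple_points z e f \<subseteq> V}))"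
  have p1: "measure_pmf.prob M {V. B1 V} \<le> 2 * (1/2) ^ n"
    using prob_hub_sizes[OF Dn] half_power_bound'[of 2] unfolding B1_def by linarith
  have finE: "finite edge_steps" by (simp add: edge_steps_def)
  have p2: "measure_pmf.prob M {V. B2 V} \<le> (1/2) ^ n"
  proof -
    have "measure_pmf.prob M {V. 2 * \<mu> \<le> real (card {f \<in> pair_triples z e {}. triple_points z e f \<subseteq> V})} \<le> (1/2) ^ (4 * n)"
      if "z \<in> \<Omega>" "e \<in> edge_steps" for z e
      by (rule prob_pair_triples[OF that(1) edge_steps_Omega[OF that(2)] C1 C2(1) dm _ _ C2(2) mu]) (use L n1 in auto)
    then have "measure_pmf.prob M {V. \<exists>e\<in>edge_steps. 2 * \<mu> \<le> real (card {f \<in> pair_triples z e {}. triple_points z e f \<subseteq> V})}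
        \<le> real (card edge_steps) * (1/2) ^ (4 * n)" if "z \<in> \<Omega>" for z
      using that by (intro prob_union finE) auto
    moreover have "real (card edge_steps) * (1/2) ^ (4 * n) \<le> 2 ^ n * (1/2) ^ (4 * n)"
    proof (rule mult_right_mono)
      have "real (card edge_steps) \<le> real (2 ^ n)" using card_edge_steps by (rule of_nat_mono)
      then show "real (card edge_steps) \<le> 2 ^ n" by simp
    qed simp
    ultimately have "measure_pmf.prob M {V. \<exists>e\<in>edge_steps. 2 * \<mu> \<le> real (card {f \<in> pair_triples z e {}. triple_points z e f \<subseteq> V})}
        \<le> 2 ^ n * (1/2) ^ (4 * n)" if "z \<in> \<Omega>" for z
      using that order_trans by blast
    then have "measure_pmf.prob M {V. B2 V} \<le> real (card \<Omega>) * (2 ^ n * (1/2) ^ (4 * n))"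
      unfolding B2_def by (intro prob_union fin) auto
    then show ?thesis using half_power_bound unfolding card_Omega by linarith
  qed
  have "measure_pmf.prob M {V. \<exists>z\<in>\<Omega>. \<exists>e\<in>edge_steps.
        \<not> real (card {(a, b). a \<in> hub S V z \<and> b \<in> hub S V (z \<triangle> e) \<and> \<not> cube_adj V a b}) \<le> \<epsilon>\<^sup>2 * D\<^sup>2 / 4}
      \<le> measure_pmf.prob M {V. B1 V \<or> B2 V}"
  proof (rule prob_mono, rule CollectI, rule ccontr)
    fix V assume V: "V \<subseteq> \<Omega>" and ne: "V \<in> {V. \<exists>z\<in>\<Omega>. \<exists>e\<in>edge_steps.
        \<not> real (card {(a, b). a \<in> hub S V z \<and> b \<in> hub S V (z \<triangle> e) \<and> \<not> cube_adj V a b}) \<le> \<epsilon>\<^sup>2 * D\<^sup>2 / 4}"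
      and "\<not> (B1 V \<or> B2 V)"
    then have B: "\<not> B1 V" "\<not> B2 V" by auto
    obtain z e where ze: "z \<in> \<Omega>" "e \<in> edge_steps"
      "\<not> real (card {(a, b). a \<in> hub S V z \<and> b \<in> hub S V (z \<triangle> e) \<and> \<not> cube_adj V a b}) \<le> \<epsilon>\<^sup>2 * D\<^sup>2 / 4"
      using ne by blast
    let ?H = "hub S V z" and ?T = "{f \<in> pair_triples z e {}. triple_points z e f \<subseteq> V}"
    let ?P = "{(a, b). a \<in> ?H \<and> b \<in> hub S V (z \<triangle> e) \<and> \<not> cube_adj V a b}"
    have finV: "finite V" using V fin finite_subset by blast
    have finH: "finite ?H" by (rule finite_subset[OF hub_subset finV])
    have finT: "finite ?T"
    proof (rule finite_subset[of _ "S \<times> S \<times> \<Omega>"])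
      show "?T \<subseteq> S \<times> S \<times> \<Omega>" by (auto simp: pair_triples_def)
    qed (auto simp: finS fin)
    have "?P \<subseteq> (\<lambda>a. (a, a)) ` ?H \<union> (\<lambda>(s, t, w). (z \<triangle> s, z \<triangle> e \<triangle> t)) ` ?T"
    proof
      fix q assume "q \<in> ?P"
      then obtain a b where q: "q = (a, b)" "a \<in> ?H" "b \<in> hub S V (z \<triangle> e)" "\<not> cube_adj V a b" by auto
      show "q \<in> (\<lambda>a. (a, a)) ` ?H \<union> (\<lambda>(s, t, w). (z \<triangle> s, z \<triangle> e \<triangle> t)) ` ?T"
      proof (cases "a = b")
        case True
        then show ?thesis using q by auto
      next
        case False
        obtain w where w: "w \<in> V" "w \<triangle> a \<subseteq> a \<triangle> b" "w \<noteq> a" "w \<noteq> b"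
          by (rule not_cube_adjD[OF q(4) False])
        define s where "s = a \<triangle> z"
        define t where "t = b \<triangle> (z \<triangle> e)"
        have st: "s \<in> S" "t \<in> S" "a \<in> V" "b \<in> V" using q by (auto simp: hub_def s_def t_def)
        have ab: "z \<triangle> s = a" "z \<triangle> e \<triangle> t = b" by (simp_all add: s_def t_def symdiff_ac)
        have "(s, t, w) \<in> ?T"
          using st w V by (auto simp: pair_triples_def triple_points_def ab simp del: in_symdiff_iff)
        then have "(\<lambda>(s, t, w). (z \<triangle> s, z \<triangle> e \<triangle> t)) (s, t, w) \<in> (\<lambda>(s, t, w). (z \<triangle> s, z \<triangle> e \<triangle> t)) ` ?T"
          by (rule imageI)
        then show ?thesis using q(1) ab by simp
      qed
    qed
    then have "card ?P \<le> card ((\<lambda>a. (a, a)) ` ?H \<union> (\<lambda>(s, t, w). (z \<triangle> s, z \<triangle> e \<triangle> t)) ` ?T)"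
      by (rule card_mono[rotated]) (use finH finT in auto)
    also have "\<dots> \<le> card ((\<lambda>a. (a, a)) ` ?H) + card ((\<lambda>(s, t, w). (z \<triangle> s, z \<triangle> e \<triangle> t)) ` ?T)"
      by (rule card_Un_le)
    also have "\<dots> \<le> card ?H + card ?T"
      by (intro add_mono card_image_le finH finT)
    finally have "real (card ?P) \<le> real (card ?H) + real (card ?T)"
      unfolding of_nat_add[symmetric] of_nat_le_iff .
    moreover have "real (card ?H) \<le> 11/10 * D"
      using B(1) ze(1) unfolding B1_def by blast
    moreover have "\<not> 2 * \<mu> \<le> real (card ?T)"
      using B(2) ze(1,2) unfolding B2_def by blast
    ultimately show False using ze(3) small by linarith
  qed
  also have "\<dots> \<le> measure_pmf.prob M {V. B1 V} + measure_pmf.prob M {V. B2 V}" by (rule prob_disj)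
  finally show ?thesis using p1 p2 by linarith
qed

end

lemma expanding_mono: "expanding K V \<Longrightarrow> K' \<le> K \<Longrightarrow> expanding K' V"
  unfolding expanding_def by (meson mult_right_mono of_nat_0_le_iff order_trans)

lemma binomial_times_power_le:
  fixes p x :: real
  assumes "0 \<le> p" "real a * p \<le> x"
  shows "real (a choose k) * p ^ k \<le> x ^ k"
proof -
  have "real (a choose k) \<le> real a ^ k"
  proof (cases "k \<le> a")
    case True
    then have "real (a choose k) \<le> real (a ^ k)" by (intro of_nat_mono binomial_le_pow)
    then show ?thesis by simp
  next
    case False
    then show ?thesis by (simp add: binomial_eq_0)
  qed
  then have "real (a choose k) * p ^ k \<le> real a ^ k * p ^ k" using assms by (intro mult_right_mono) auto
  also have "\<dots> = (real a * p) ^ k" by (simp add: power_mult_distrib)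
  also have "\<dots> \<le> x ^ k" using assms by (intro power_mono) auto
  finally show ?thesis .
qed

text \<open>The free pairs dictate \<open>\<epsilon>\<close>: differences avoiding \<open>k\<close>
  coordinates make up a fraction of at least 1 / 2 ^ k, half of these have at most
  \<open>m div 2\<close> elements, and another factor 2 covers the removal of the empty difference,
  so the fraction 1 / 2 ^ (k + 2) = 10 \<epsilon> remains. The restriction to \<open>m div 2\<close>
  keeps the number of points in between small against \<open>2 ^ m\<close>.\<close>

lemma subcube_expanding:
  fixes n m k s0 :: nat and p \<epsilon> D L :: real
  assumes n: "n \<ge> 1" and m: "m \<le> n" "k + 2 \<le> m" and p: "0 < p" "p \<le> 1"
    and D_eq: "D = p * 2 ^ m" and eps: "\<epsilon> = 1 / (10 * 2 ^ (k + 2))" and L: "L = 12 * real n"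
    and Dn: "D \<ge> 2000 * real n" and eD: "\<epsilon> * D \<ge> 3 * real n"
    and few: "(p * (8 ^ s0 * (9/8) ^ m)) ^ k \<le> (1/2) ^ (4 * n)"
    and star: "2 * (p * D * 3 ^ m + p * L * (4 ^ m / 2 ^ s0) + L * D * 2 ^ (m div 2) + L\<^sup>2 * 2 ^ m) \<le> \<epsilon> * 2 ^ m * D"
    and pair: "11/10 * D + 2 * (2 * p\<^sup>2 * D * 3 ^ m + 5 * p\<^sup>2 * L * 3 ^ m + 4 * L\<^sup>2 * D + L ^ 3) \<le> \<epsilon>\<^sup>2 * D\<^sup>2 / 4"
  shows "measure_pmf.prob (random_subset (Pow {..<n}) p) {V. \<not> expanding (\<epsilon>\<^sup>2 * D / (25 * real n)) V} \<le> 8 * (1/2) ^ n"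
proof -
  define I where "I = {..<m}"
  have finI: "finite I" and cI: "card I = m" by (auto simp: I_def)
  interpret C: cube_sample n p "Pow I" "Pow {..<n}" "real (card (Pow I))" "p * real (card (Pow I))"
      "random_subset (Pow {..<n}) p"
    by unfold_locales (use n p m in \<open>auto simp: I_def\<close>)
  have N: "real (card (Pow I)) = 2 ^ m" using finI by (simp add: card_Pow cI)
  have DD: "p * real (card (Pow I)) = D" by (simp add: N D_eq)
  have eps1: "0 < \<epsilon>" "\<epsilon> \<le> 1/10"
  proof -
    show "0 < \<epsilon>" by (simp add: eps)
    have "(1::real) \<le> 2 ^ (k + 2)" by (rule one_le_power) simp
    then show "\<epsilon> \<le> 1/10" by (simp add: eps field_simps)
  qed
  define Low where "Low = {u. u \<subseteq> I \<and> u \<noteq> {} \<and> card u \<le> s0}"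
  have C1: "(\<Sum>t\<in>Pow I. (2::real) ^ card (s \<triangle> t)) \<le> 3 ^ m" if "s \<in> Pow I" for s
    using sum_symdiff_Pow[OF finI, of s] that cI by simp
  have pairs: "measure_pmf.prob (random_subset (Pow {..<n}) p) {V. \<exists>z\<in>Pow {..<n}. \<exists>e\<in>C.edge_steps.
        \<not> real (card {(a, b). a \<in> hub (Pow I) V z \<and> b \<in> hub (Pow I) V (z \<triangle> e) \<and> \<not> cube_adj V a b})
          \<le> \<epsilon>\<^sup>2 * (p * real (card (Pow I)))\<^sup>2 / 4} \<le> 3 * (1/2) ^ n"
  proof (rule C.prob_nonadjacent_pairs[OF _ C1 _ _ _ L refl])
    show "real (card {(s, t). s \<in> Pow I \<and> t \<in> Pow I \<and> w \<triangle> (z \<triangle> s) \<subseteq> (z \<triangle> s) \<triangle> (z \<triangle> e \<triangle> t)}) \<le> 3 ^ m" for z e w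
      using card_between_Pow[OF finI, of w z e] cI by simp
    show "card (s \<triangle> t) \<le> m" if "s \<in> Pow I" "t \<in> Pow I" for s t
      using card_mono[OF finI, of "s \<triangle> t"] symdiff_Pow[OF that] cI by simp
    show "p * real (card (Pow I)) \<ge> 2000 * real n" using Dn DD by simp
    show "11/10 * (p * real (card (Pow I))) + 2 * (2 * p\<^sup>2 * (p * real (card (Pow I))) * 3 ^ m + 4 * p\<^sup>2 * L * 3 ^ m
        + p\<^sup>2 * L * 3 ^ m + 2 * p * L\<^sup>2 * 2 ^ m + 2 * L\<^sup>2 * (p * real (card (Pow I))) + L ^ 3)
        \<le> \<epsilon>\<^sup>2 * (p * real (card (Pow I)))\<^sup>2 / 4"
      unfolding DD using pair by (simp add: D_eq algebra_simps)
  qed simp_all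
  have "measure_pmf.prob (random_subset (Pow {..<n}) p)
      {V. \<not> expanding (\<epsilon>\<^sup>2 * (p * real (card (Pow I))) / (25 * real n)) V} \<le> 5 * (1/2) ^ n + 3 * (1/2) ^ n"
  proof (rule C.prob_expanding[OF _ eps1 _ _ _ _ _ _ C1 _ _ L _ pairs, where Low = Low and k = k and ?s0.0 = s0
        and ?d0.0 = "m div 2" and ?C2.0 = "4 ^ m / 2 ^ s0"])
    show "p * real (card (Pow I)) \<ge> 2000 * real n" using Dn DD by simp
    show "\<epsilon> * (p * real (card (Pow I))) \<ge> 3 * real n" using eD DD by simp
    show "Low \<subseteq> Pow {..<n}" using m by (auto simp: Low_def I_def)
    show "{} \<notin> Low" by (simp add: Low_def)
    show "u \<in> Low" if "s \<in> Pow I" "t \<in> Pow I" "u \<subseteq> s \<triangle> t" "u \<noteq> {}" "card u \<le> s0" for s t u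
      using that symdiff_Pow[OF that(1,2)] by (simp add: Low_def)
    \<comment> \<open>With weight 1/8 the bound 8 ^ s0 * (9/8) ^ m stays well below 1 / p for the
      intended \<open>s0\<close> near l / 20 and \<open>m\<close> near 11/10 l, where l = log 2 (1 /
      p).\<close>
    have "real (card Low) * (1/8) ^ s0 \<le> (9/8) ^ m"
      using card_small_subsets_le[OF finI, of "1/8" s0] by (simp add: Low_def cI)
    then have "real (card Low) \<le> 8 ^ s0 * (9/8) ^ m" by (simp add: power_divide field_simps)
    then have "real (card Low) * p \<le> p * (8 ^ s0 * (9/8) ^ m)"
      using p by (simp add: mult.commute mult_left_mono)
    then have "real (card Low choose k) * p ^ k \<le> (p * (8 ^ s0 * (9/8) ^ m)) ^ k"
      by (rule binomial_times_power_le[rotated]) (use p in simp)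
    then show "real (card Low choose k) * p ^ k \<le> (1/2) ^ (4 * n)" using few by linarith
    show "10 * \<epsilon> * (real (card (Pow I)))\<^sup>2 \<le> real (card (C.free_pairs J (m div 2)))"
      if J: "J \<in> Pow {..<n}" "card J \<le> k" for J
    proof -
      have finJ: "finite J" using J finite_subset by blast
      let ?A = "{v. v \<subseteq> I - J \<and> card v \<le> m div 2}" and ?Z = "{v. v \<subseteq> I - J \<and> v \<noteq> {} \<and> card v \<le> m div 2}"
      have finA: "finite ?A" using finI by auto
      have "card (I - J) \<le> m" using card_mono[OF finI, of "I - J"] cI by auto
      then have "2 ^ card (I - J) \<le> 2 * card ?A" using finI by (intro card_half_subsets_ge) auto
      moreover have "m - k \<le> card (I - J)"
        using diff_card_le_card_Diff[OF finJ, of I] J(2) cI by linarith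
      then have "(2::nat) ^ (m - k) \<le> 2 ^ card (I - J)" by (intro power_increasing) auto
      moreover have "?A = insert {} ?Z" by auto
      then have "card ?A = Suc (card ?Z)" using finA by (simp add: card_insert_if)
      \<comment> \<open>By \<open>k + 2 \<le> m\<close> at least two sets are counted in
        \<open>?A\<close>, so dropping the empty one costs at most half.\<close>
      moreover have "(4::nat) \<le> 2 ^ (m - k)"
        using power_increasing[of 2 "m - k" "2::nat"] m by simp
      ultimately have Z: "2 ^ (m - k) \<le> 4 * card ?Z" by linarith
      have "card (Pow I \<times> ?Z) \<le> card (C.free_pairs J (m div 2))"
      proof (rule card_inj_on_le[where f = "\<lambda>(s, v). (s, s \<triangle> v)"])
        show "inj_on (\<lambda>(s, v). (s, s \<triangle> v)) (Pow I \<times> ?Z)"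
          by (rule inj_onI) (auto simp: prod_eq_iff simp del: in_symdiff_iff)
        show "(\<lambda>(s, v). (s, s \<triangle> v)) ` (Pow I \<times> ?Z) \<subseteq> C.free_pairs J (m div 2)"
        proof (rule image_subsetI)
          fix q assume "q \<in> Pow I \<times> ?Z"
          then obtain s v where q: "q = (s, v)" "s \<subseteq> I" "v \<subseteq> I - J" "v \<noteq> {}" "card v \<le> m div 2" by auto
          have "s \<triangle> v \<subseteq> I" using q by auto
          moreover have "s \<noteq> s \<triangle> v" using q(4) by (metis symdiff_eq_self)
          ultimately show "(case q of (s, v) \<Rightarrow> (s, s \<triangle> v)) \<in> C.free_pairs J (m div 2)"
            using q unfolding C.free_pairs_def by (simp del: in_symdiff_iff) blast
        qed
      qed (rule C.finite_free_pairs)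
      then have "2 ^ m * card ?Z \<le> card (C.free_pairs J (m div 2))"
        using finI by (simp add: card_cartesian_product card_Pow cI)
      then have "2 ^ m * 2 ^ (m - k) \<le> 4 * card (C.free_pairs J (m div 2))"
        using mult_le_mono2[OF Z, of "2 ^ m"] by linarith
      then have "real (2 ^ m * 2 ^ (m - k)) \<le> real (4 * card (C.free_pairs J (m div 2)))" by (rule of_nat_mono)
      then have F: "2 ^ m * 2 ^ (m - k) \<le> 4 * real (card (C.free_pairs J (m div 2)))" by simp
      have "(2::real) ^ m = 2 ^ (m - k) * 2 ^ k" using m by (simp add: power_add[symmetric])
      then have "10 * \<epsilon> * (2 ^ m)\<^sup>2 = 2 ^ m * 2 ^ (m - k) / 4"
        by (simp add: eps power2_eq_square power_add)
      then show ?thesis using F unfolding N by linarith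
    qed
    show "real (card {(s, t). s \<in> Pow I \<and> t \<in> Pow I \<and> u \<subseteq> s \<triangle> t}) \<le> 4 ^ m / 2 ^ s0"
      if "s0 < card u" for u
      using card_superset_pairs_Pow[OF finI that] by (simp add: cI pos_le_divide_eq)
    show "2 * (p * (p * real (card (Pow I))) * 3 ^ m + p * L * (4 ^ m / 2 ^ s0) + L * (p * real (card (Pow I))) * 2 ^ (m div 2)
        + L\<^sup>2 * real (card (Pow I))) \<le> \<epsilon> * real (card (Pow I)) * (p * real (card (Pow I)))"
      unfolding N using star by (simp only: D_eq)
  qed simp_all
  then show ?thesis unfolding DD by simp
qed

text \<open>Turns a numerical fact such as (3/2)^5 \<le> 2^3 into an exponential bound with the
  rational rate 3/5.\<close>

lemma power_le_two_powr:
  fixes x :: real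
  assumes "0 < x" "x ^ a \<le> 2 ^ b" "0 < a"
  shows "x ^ m \<le> 2 powr (real b / real a * real m)"
proof -
  have "x = (x ^ a) powr (1 / real a)"
    using assms by (simp add: powr_realpow[symmetric] powr_powr)
  also have "\<dots> \<le> (2 ^ b) powr (1 / real a)"
    using assms by (intro powr_mono2) auto
  also have "\<dots> = 2 powr (real b / real a)"
    by (simp add: powr_realpow[symmetric] powr_powr)
  finally have "x powr real m \<le> (2 powr (real b / real a)) powr real m"
    using assms by (intro powr_mono2) auto
  then show ?thesis using assms by (simp add: powr_realpow[symmetric] powr_powr)
qed

lemma two_powr_nat: "(2::real) ^ m = 2 powr real m"
  by (simp add: powr_realpow)

text \<open>After normalisation every error is at most a polynomial in n times 2 powr (- sqrt n),
  whereas the lower bound for \<epsilon>^2 is of order 2 powr (- 7/10 sqrt n). This is what l \<ge>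
  20 sqrt n buys, through 7 n / l \<le> 35/100 sqrt n. The hubs have at least 2 powr (sqrt n)
  expected points, so every \<open>C\<close> is allowed.\<close>

lemma subcube_regime:
  fixes C :: real
  assumes C: "C > 0"
  shows "\<forall>\<^sub>F n in sequentially. \<forall>p. 2 powr (-(9/10) * real n) < p \<and> p \<le> 2 powr (-20 * sqrt (real n)) \<longrightarrow>
    measure_pmf.prob (random_subset (Pow {..<n}) p) {V. \<not> expanding (real n powr (C * ln (real n))) V} \<le> 8 * (1/2) ^ n"
proof -
  \<comment> \<open>The first two inequalities are the hypotheses \<open>star\<close> and
    \<open>pair\<close> of \<open>subcube_expanding\<close> divided by \<open>2 ^ m * D\<close> and
    \<open>D ^ 2\<close>, with the small quantities replaced by multiples of \<open>h\<close> and
    \<open>\<epsilon>\<close> by its lower bound \<open>e0\<close>.\<close>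
  have e1: "\<forall>\<^sub>F n in sequentially. 2 * (2 powr (- sqrt (real n)) + 12 * real n * (2 * 2 powr (- sqrt (real n)))
      + 12 * real n * 2 powr (- sqrt (real n)) + (12 * real n)\<^sup>2 * 2 powr (- sqrt (real n)))
      \<le> 2 powr (-(35/100) * sqrt (real n) - 7)"
    by real_asymp
  have e2: "\<forall>\<^sub>F n in sequentially. 11/10 * 2 powr (- sqrt (real n)) + 2 * (2 * 2 powr (- sqrt (real n))
      + 5 * (12 * real n) * 2 powr (- sqrt (real n)) + 4 * (12 * real n)\<^sup>2 * 2 powr (- sqrt (real n))
      + (12 * real n) ^ 3 * 2 powr (- sqrt (real n)))
      \<le> (2 powr (-(35/100) * sqrt (real n) - 7))\<^sup>2 / 4"
    by real_asymp
  have e3: "\<forall>\<^sub>F n in sequentially. real n powr (C * ln (real n))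
      \<le> (2 powr (-(35/100) * sqrt (real n) - 7))\<^sup>2 * 2 powr (sqrt (real n)) / (25 * real n)"
    using C by real_asymp
  have e4: "\<forall>\<^sub>F n in sequentially. 2000 * real n \<le> 2 powr (sqrt (real n))" by real_asymp
  have e5: "\<forall>\<^sub>F n in sequentially. 3 * real n \<le> 2 powr (-(35/100) * sqrt (real n) - 7) * 2 powr (sqrt (real n))" by real_asymp
  have e6: "\<forall>\<^sub>F n in sequentially. (100::nat) \<le> n" by (rule eventually_ge_at_top)
  show ?thesis
    using e1 e2 e3 e4 e5 e6
  proof eventually_elim
    case (elim n)
    define \<sigma> where "\<sigma> = sqrt (real n)"
    define h where "h = 2 powr (- \<sigma>)"
    define e0 where "e0 = 2 powr (-(35/100) * \<sigma> - 7)"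
    note E = elim[folded \<sigma>_def, folded h_def e0_def]
    have n100: "real n \<ge> 100" using elim(6) by simp
    have s10: "\<sigma> \<ge> 10" unfolding \<sigma>_def using real_sqrt_le_mono[OF n100] by simp
    have sn: "real n = \<sigma> * \<sigma>" by (simp add: \<sigma>_def)
    show ?case
    proof (intro allI impI)
      fix p :: real assume pp: "2 powr (-(9/10) * real n) < p \<and> p \<le> 2 powr (-20 * sqrt (real n))"
      have p0: "p > 0"
      proof -
        have "0 < (2::real) powr (-(9/10) * real n)" by simp
        then show ?thesis using pp by linarith
      qed
      define l where "l = - log 2 p"
      have pl: "p = 2 powr (- l)" using p0 by (simp add: l_def)
      have l1: "l < 9/10 * real n" using pp pl by (simp add: powr_less_cancel_iff)
      have l2: "20 * \<sigma> \<le> l" using pp pl by (simp add: powr_le_cancel_iff \<sigma>_def)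
      have l200: "l \<ge> 200" using l2 s10 by linarith
      \<comment> \<open>The surplus of \<open>m\<close> over \<open>l\<close> makes D = 2 powr (m -
        l) large. The share l / 20 for \<open>s0\<close> suffices for 1 / 2 ^ s0 \<le> 2 h and keeps
        p * 8 ^ s0 * (9/8) ^ m below 2 powr (- 6/10 l); then 7 n / l factors push it below 2 powr (-
        4 n).\<close>
      define m where "m = nat \<lceil>11/10 * l\<rceil>"
      define k where "k = nat \<lceil>7 * real n / l\<rceil>"
      define s0 where "s0 = nat \<lfloor>l / 20\<rfloor>"
      have m1: "11/10 * l \<le> real m" "real m \<le> 11/10 * l + 1"
        using l200 unfolding m_def by linarith+
      have k1: "7 * real n / l \<le> real k" unfolding k_def by linarith
      have k2: "real k \<le> 35/100 * \<sigma> + 1"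
      proof -
        have "7 * real n / l \<le> 7 * real n / (20 * \<sigma>)"
          using l2 s10 n100 by (intro divide_left_mono) auto
        also have "\<dots> = 35/100 * \<sigma>" using s10 by (simp add: sn)
        finally have "7 * real n / l \<le> 35/100 * \<sigma>" .
        moreover have "0 \<le> 7 * real n / l" using l200 by simp
        ultimately show ?thesis unfolding k_def by linarith
      qed
      have s1: "real s0 \<le> l / 20" "l / 20 - 1 \<le> real s0"
        using l200 unfolding s0_def by linarith+
      define D where "D = p * 2 ^ m"
      define \<epsilon> :: real where "\<epsilon> = 1 / (10 * 2 ^ (k + 2))"
      define L where "L = 12 * real n"
      \<comment> \<open>\<open>a1\<close>, \<open>a2\<close>, \<open>a3\<close> and \<open>d\<close>
        are the normalised sizes of the error terms; each is compared with \<open>h\<close>.\<close>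
      define a1 where "a1 = p * (3/2) ^ m"
      define a2 :: real where "a2 = 1 / 2 ^ s0"
      define a3 :: real where "a3 = 2 ^ (m div 2) / 2 ^ m"
      define d where "d = 1 / D"
      have Dp: "D = 2 powr (real m - l)" unfolding D_def pl two_powr_nat by (simp add: powr_add[symmetric])
      have Ds: "D \<ge> 2 powr \<sigma>"
        unfolding Dp using m1 l2 s10 by (intro powr_mono) auto
      have Dpos: "D > 0" by (simp add: Dp)
      have hh: "h = 1 / 2 powr \<sigma>" by (simp add: h_def powr_minus_divide)
      have d: "0 < d" "d \<le> h"
        using Ds Dpos unfolding d_def hh by (auto intro: divide_left_mono)
      have h1: "h \<le> 1" "h > 0" using powr_mono[of "- \<sigma>" 0 2] s10 by (auto simp: h_def)
      have a1: "0 < a1" "a1 \<le> h"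
      proof -
        show "0 < a1" using p0 by (simp add: a1_def)
        have "(3/2 :: real) ^ m \<le> 2 powr (real 3 / real 5 * real m)"
          by (rule power_le_two_powr) (auto simp: power_divide)
        then have "a1 \<le> 2 powr (- l) * 2 powr (3/5 * real m)"
          unfolding a1_def pl by (intro mult_left_mono) auto
        also have "\<dots> = 2 powr (- l + 3/5 * real m)" by (simp only: powr_add)
        also have "\<dots> \<le> h" unfolding h_def using m1 l2 s10 by (intro powr_mono) auto
        finally show "a1 \<le> h" .
      qed
      have a2: "0 < a2" "a2 \<le> 2 * h"
      proof -
        show "0 < a2" by (simp add: a2_def)
        have "a2 = 2 powr (- real s0)" by (simp add: a2_def two_powr_nat powr_minus_divide)
        also have "\<dots> \<le> 2 powr (1 - \<sigma>)" using s1 l2 by (intro powr_mono) auto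
        also have "\<dots> = 2 * h" by (simp add: h_def powr_diff powr_minus_divide)
        finally show "a2 \<le> 2 * h" .
      qed
      have a3: "0 < a3" "a3 \<le> h"
      proof -
        show "0 < a3" by (simp add: a3_def)
        have "real (m div 2) \<le> real m / 2" by linarith
        then have "a3 \<le> 2 powr (- (real m / 2))"
          unfolding a3_def two_powr_nat powr_diff[symmetric] by (intro powr_mono) auto
        also have "\<dots> \<le> h" unfolding h_def using m1 l2 s10 by (intro powr_mono) auto
        finally show "a3 \<le> h" .
      qed
      have eps: "e0 \<le> \<epsilon>"
      proof -
        \<comment> \<open>The 7 in \<open>e0\<close> is 4 for 10 \<le> 2^4, 2 from
          \<open>k + 2\<close>, and 1 for rounding \<open>k\<close> up.\<close>
        have "10 * 2 ^ (k + 2) \<le> (2::real) ^ 4 * 2 ^ (k + 2)" by (intro mult_right_mono) auto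
        also have "\<dots> = 2 powr (real k + 6)" by (simp add: two_powr_nat powr_add)
        also have "\<dots> \<le> 2 powr (35/100 * \<sigma> + 7)" using k2 by (intro powr_mono) auto
        finally have "10 * 2 ^ (k + 2) \<le> 2 powr (35/100 * \<sigma> + 7)" .
        then have "1 / 2 powr (35/100 * \<sigma> + 7) \<le> \<epsilon>" unfolding \<epsilon>_def by (intro divide_left_mono) auto
        moreover have "e0 = 1 / 2 powr (35/100 * \<sigma> + 7)" by (simp add: e0_def powr_minus_divide[symmetric])
        ultimately show ?thesis by simp
      qed
      have e0p: "e0 > 0" by (simp add: e0_def)
      have Lp: "L \<ge> 0" "L = 12 * real n" by (auto simp: L_def)
      have three: "(3::real) ^ m = 2 ^ m * (3/2) ^ m" by (simp add: power_mult_distrib[symmetric])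
      have four: "(4::real) ^ m = 2 ^ m * 2 ^ m" by (simp add: power_mult_distrib[symmetric])
      have "measure_pmf.prob (random_subset (Pow {..<n}) p) {V. \<not> expanding (\<epsilon>\<^sup>2 * D / (25 * real n)) V} \<le> 8 * (1/2) ^ n"
      proof (rule subcube_expanding[OF _ _ _ p0 _ D_def \<epsilon>_def L_def, where ?s0.0 = s0])
        show "n \<ge> 1" using elim(6) by simp
        show "m \<le> n"
        proof -
          have "real m \<le> real n" using m1 l1 n100 by linarith
          then show ?thesis by simp
        qed
        show "k + 2 \<le> m"
        proof -
          have "real (k + 2) \<le> real m" using k2 m1 l2 s10 by simp
          then show ?thesis by (simp only: of_nat_le_iff)
        qed
        show "p \<le> 1" unfolding pl using l200 powr_mono[of "- l" 0 2] by simp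
        show "D \<ge> 2000 * real n" using Ds E(4) by linarith
        have "e0 * 2 powr \<sigma> \<le> \<epsilon> * D" using eps Ds e0p by (intro mult_mono) auto
        then show "\<epsilon> * D \<ge> 3 * real n" using E(5) by linarith
        show "(p * (8 ^ s0 * (9/8) ^ m)) ^ k \<le> (1/2) ^ (4 * n)"
        proof -
          have "(9/8 :: real) ^ m \<le> 2 powr (real 1 / real 5 * real m)"
            by (rule power_le_two_powr) (auto simp: power_divide)
          then have nine: "(9/8 :: real) ^ m \<le> 2 powr (1/5 * real m)" by simp
          have eight: "(8::real) ^ s0 = 2 powr (3 * real s0)"
          proof -
            have "(8::real) ^ s0 = 2 ^ (3 * s0)" by (simp add: power_mult)
            then show ?thesis by (simp add: two_powr_nat)
          qed
          have "p * (8 ^ s0 * (9/8) ^ m) \<le> 2 powr (- l) * (2 powr (3 * real s0) * 2 powr (1/5 * real m))"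
            unfolding pl eight by (intro mult_left_mono nine) auto
          also have "\<dots> = 2 powr (- l + 3 * real s0 + 1/5 * real m)" by (simp only: powr_add mult.assoc)
          also have "\<dots> \<le> 2 powr (- (6/10) * l)" using s1 m1 l200 by (intro powr_mono) auto
          finally have "(p * (8 ^ s0 * (9/8) ^ m)) ^ k \<le> (2 powr (- (6/10) * l)) ^ k"
            using p0 by (intro power_mono) auto
          also have "\<dots> = 2 powr (- (6/10) * l * real k)"
            by (simp add: powr_realpow[symmetric] powr_powr)
          also have "\<dots> \<le> 2 powr (- real (4 * n))"
          proof (rule powr_mono)
            have "7 * real n \<le> real k * l" using k1 l200 by (simp add: field_simps)
            moreover have "- (6/10) * l * real k = - (6/10) * (real k * l)" by simp
            ultimately show "- (6/10) * l * real k \<le> - real (4 * n)"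
              unfolding of_nat_mult of_nat_numeral using n100 by linarith
          qed simp
          also have "\<dots> = (1/2) ^ (4 * n)" by (simp only: powr_minus_divide two_powr_nat[symmetric] power_one_over)
          finally show ?thesis .
        qed
        show "2 * (p * D * 3 ^ m + p * L * (4 ^ m / 2 ^ s0) + L * D * 2 ^ (m div 2) + L\<^sup>2 * 2 ^ m) \<le> \<epsilon> * 2 ^ m * D"
        proof -
          have "2 * (p * D * 3 ^ m + p * L * (4 ^ m / 2 ^ s0) + L * D * 2 ^ (m div 2) + L\<^sup>2 * 2 ^ m)
              = (2 ^ m * D) * (2 * (a1 + L * a2 + L * a3 + L\<^sup>2 * d))"
          proof -
            have t1: "p * D * 3 ^ m = 2 ^ m * D * a1" by (simp add: three a1_def)
            have t2: "p * L * (4 ^ m / 2 ^ s0) = 2 ^ m * D * (L * a2)" by (simp add: four a2_def D_def)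
            have t3: "L * D * 2 ^ (m div 2) = 2 ^ m * D * (L * a3)" by (simp add: a3_def)
            have t4: "L\<^sup>2 * 2 ^ m = 2 ^ m * D * (L\<^sup>2 * d)" using Dpos by (simp add: d_def)
            show ?thesis unfolding t1 t2 t3 t4 by (simp add: algebra_simps)
          qed
          also have "\<dots> \<le> (2 ^ m * D) * \<epsilon>"
          proof (rule mult_left_mono)
            have "2 * (a1 + L * a2 + L * a3 + L\<^sup>2 * d) \<le> 2 * (h + L * (2 * h) + L * h + L\<^sup>2 * h)"
              using a1 a2 a3 d Lp by (intro mult_left_mono add_mono) auto
            also have "\<dots> \<le> e0" using E(1) by (simp add: L_def)
            finally show "2 * (a1 + L * a2 + L * a3 + L\<^sup>2 * d) \<le> \<epsilon>" using eps by linarith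
          qed (use Dpos in simp)
          finally show ?thesis by (simp add: mult_ac)
        qed
        show "11/10 * D + 2 * (2 * p\<^sup>2 * D * 3 ^ m + 5 * p\<^sup>2 * L * 3 ^ m + 4 * L\<^sup>2 * D + L ^ 3) \<le> \<epsilon>\<^sup>2 * D\<^sup>2 / 4"
        proof -
          have "11/10 * D + 2 * (2 * p\<^sup>2 * D * 3 ^ m + 5 * p\<^sup>2 * L * 3 ^ m + 4 * L\<^sup>2 * D + L ^ 3)
             = D\<^sup>2 * (11/10 * d + 2 * (2 * a1 + 5 * L * (a1 * d) + 4 * L\<^sup>2 * d + L ^ 3 * (d * d)))"
          proof -
            have u: "D * d = 1" using Dpos by (simp add: d_def)
            have u2: "D\<^sup>2 * d = D" using Dpos by (simp add: d_def power2_eq_square)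
            have u3: "D\<^sup>2 * (d * d) = 1" using Dpos by (simp add: d_def power2_eq_square)
            have q: "p\<^sup>2 * 3 ^ m = D * a1" by (simp add: three a1_def D_def power2_eq_square)
            have q1: "2 * p\<^sup>2 * D * 3 ^ m = D\<^sup>2 * (2 * a1)"
              using q by (simp add: power2_eq_square mult_ac)
            have q2: "5 * p\<^sup>2 * L * 3 ^ m = D\<^sup>2 * (5 * L * (a1 * d))"
            proof -
              have "5 * p\<^sup>2 * L * 3 ^ m = 5 * L * (p\<^sup>2 * 3 ^ m)" by (simp add: mult_ac)
              also have "\<dots> = 5 * L * ((D\<^sup>2 * d) * a1)" by (simp add: q u2)
              finally show ?thesis by (simp add: mult_ac)
            qed
            have q3: "4 * L\<^sup>2 * D = D\<^sup>2 * (4 * L\<^sup>2 * d)"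
            proof -
              have "4 * L\<^sup>2 * D = 4 * L\<^sup>2 * (D\<^sup>2 * d)" by (simp add: u2)
              then show ?thesis by (simp add: mult_ac)
            qed
            have q4: "L ^ 3 = D\<^sup>2 * (L ^ 3 * (d * d))"
            proof -
              have "L ^ 3 = L ^ 3 * (D\<^sup>2 * (d * d))" by (simp add: u3)
              then show ?thesis by (simp add: mult_ac)
            qed
            have q5: "11/10 * D = D\<^sup>2 * (11/10 * d)"
            proof -
              have "11/10 * D = 11/10 * (D\<^sup>2 * d)" by (simp add: u2)
              then show ?thesis by (simp add: mult_ac)
            qed
            have "11/10 * D + 2 * (2 * p\<^sup>2 * D * 3 ^ m + 5 * p\<^sup>2 * L * 3 ^ m + 4 * L\<^sup>2 * D + L ^ 3)
              = D\<^sup>2 * (11/10 * d) + 2 * (D\<^sup>2 * (2 * a1) + D\<^sup>2 * (5 * L * (a1 * d)) + D\<^sup>2 * (4 * L\<^sup>2 * d) + D\<^sup>2 * (L ^ 3 * (d * d)))"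
              by (intro q1 q2 q3 q4 q5 arg_cong2[where f = "(+)"] arg_cong[where f = "(*) 2"])
            then show ?thesis by (simp only: distrib_left mult.left_commute[of 2 "D\<^sup>2"])
          qed
          also have "\<dots> \<le> D\<^sup>2 * (\<epsilon>\<^sup>2 / 4)"
          proof (rule mult_left_mono)
            have ad: "a1 * d \<le> h * 1" using a1 d h1 by (intro mult_mono) auto
            have dd: "d * d \<le> h * 1" using d h1 by (intro mult_mono) auto
            have "11/10 * d + 2 * (2 * a1 + 5 * L * (a1 * d) + 4 * L\<^sup>2 * d + L ^ 3 * (d * d))
                \<le> 11/10 * h + 2 * (2 * h + 5 * L * h + 4 * L\<^sup>2 * h + L ^ 3 * h)"
              using a1 d Lp ad dd by (intro mult_left_mono add_mono) auto
            also have "\<dots> \<le> e0\<^sup>2 / 4" using E(2) by (simp add: L_def)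
            also have "\<dots> \<le> \<epsilon>\<^sup>2 / 4" using eps e0p by (intro divide_right_mono power_mono) auto
            finally show "11/10 * d + 2 * (2 * a1 + 5 * L * (a1 * d) + 4 * L\<^sup>2 * d + L ^ 3 * (d * d)) \<le> \<epsilon>\<^sup>2 / 4" .
          qed simp
          finally show ?thesis by (simp add: mult_ac)
        qed
      qed
      moreover have "real n powr (C * ln (real n)) \<le> \<epsilon>\<^sup>2 * D / (25 * real n)"
      proof -
        have "e0\<^sup>2 * 2 powr \<sigma> / (25 * real n) \<le> \<epsilon>\<^sup>2 * D / (25 * real n)"
          using eps e0p Ds by (intro divide_right_mono mult_mono power_mono) auto
        then show ?thesis using E(3) by linarith
      qed
      then have "measure_pmf.prob (random_subset (Pow {..<n}) p) {V. \<not> expanding (real n powr (C * ln (real n))) V}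
          \<le> measure_pmf.prob (random_subset (Pow {..<n}) p) {V. \<not> expanding (\<epsilon>\<^sup>2 * D / (25 * real n)) V}"
        by (intro measure_pmf.finite_measure_mono) (auto dest: expanding_mono)
      ultimately show "measure_pmf.prob (random_subset (Pow {..<n}) p) {V. \<not> expanding (real n powr (C * ln (real n))) V} \<le> 8 * (1/2) ^ n"
        by linarith
    qed
  qed
qed

section \<open>Spheres as hubs\<close>

text \<open>Deleting \<open>i\<close> is a bijection. The predicate \<open>P\<close> on the
  remainder allows a second point to be prescribed.\<close>

lemma card_subsets_containing:
  assumes X: "finite X" "i \<in> X" and r: "r \<ge> 1"
  shows "card {s. s \<subseteq> X \<and> card s = r \<and> i \<in> s \<and> P (s - {i})} = card {s. s \<subseteq> X - {i} \<and> card s = r - 1 \<and> P s}"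
proof (rule bij_betw_same_card[OF bij_betwI[where f = "\<lambda>s. s - {i}" and g = "insert i"]])
  show "(\<lambda>s. s - {i}) \<in> {s. s \<subseteq> X \<and> card s = r \<and> i \<in> s \<and> P (s - {i})} \<rightarrow> {s. s \<subseteq> X - {i} \<and> card s = r - 1 \<and> P s}"
    by auto
  show "insert i \<in> {s. s \<subseteq> X - {i} \<and> card s = r - 1 \<and> P s} \<rightarrow> {s. s \<subseteq> X \<and> card s = r \<and> i \<in> s \<and> P (s - {i})}"
  proof
    fix s assume "s \<in> {s. s \<subseteq> X - {i} \<and> card s = r - 1 \<and> P s}"
    then have s: "s \<subseteq> X - {i}" "card s = r - 1" "P s" by auto
    have "finite s" "i \<notin> s" using s X finite_subset[of s X] by auto
    then show "insert i s \<in> {s. s \<subseteq> X \<and> card s = r \<and> i \<in> s \<and> P (s - {i})}"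
      using s X r by auto
  qed
qed auto

lemma card_subsets_point:
  assumes X: "finite X" "i \<in> X" and r: "r \<ge> 1"
  shows "card X * card {s. s \<subseteq> X \<and> card s = r \<and> i \<in> s} = r * (card X choose r)"
proof -
  have "card {s. s \<subseteq> X \<and> card s = r \<and> i \<in> s} = card {s. s \<subseteq> X - {i} \<and> card s = r - 1}"
    using card_subsets_containing[OF assms, of "\<lambda>_. True"] by simp
  also have "\<dots> = (card X - 1 choose (r - 1))"
    using n_subsets[of "X - {i}" "r - 1"] X by simp
  finally have c: "card {s. s \<subseteq> X \<and> card s = r \<and> i \<in> s} = (card X - 1 choose (r - 1))" .
  have "card X \<ge> 1" using X by (auto simp: Suc_le_eq card_gt_0_iff)
  then show ?thesis
    unfolding c using Suc_times_binomial_eq[of "card X - 1" "r - 1"] r by (simp add: mult.commute)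
qed

text \<open>The exact fraction r (r - 1) / (n (n - 1)) is at most (r / n)^2. The case r = 1 is split
  off because the count for the second point is applied to sets of size r - 1, which must be
  positive.\<close>

lemma card_subsets_two_points:
  assumes X: "finite X" "i \<in> X" "j \<in> X" "i \<noteq> j" and r: "1 \<le> r" "r \<le> card X"
  shows "(real (card X))\<^sup>2 * real (card {s. s \<subseteq> X \<and> card s = r \<and> i \<in> s \<and> j \<in> s}) \<le> (real r)\<^sup>2 * real (card X choose r)"
proof -
  let ?A = "{s. s \<subseteq> X \<and> card s = r \<and> i \<in> s \<and> j \<in> s}"
  define n where "n = card X"
  have eq: "?A = {s. s \<subseteq> X \<and> card s = r \<and> i \<in> s \<and> j \<in> s - {i}}" using X by auto
  have c: "card ?A = card {s. s \<subseteq> X - {i} \<and> card s = r - 1 \<and> j \<in> s}"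
    unfolding eq by (rule card_subsets_containing[OF X(1,2) r(1)])
  have cX: "card (X - {i}) = n - 1" using X by (simp add: n_def)
  have n2: "n \<ge> 2" unfolding n_def using X card_mono[of X "{i, j}"] by simp
  show ?thesis
  proof (cases "r \<ge> 2")
    case True
    have 1: "(n - 1) * card ?A = (r - 1) * (n - 1 choose (r - 1))"
      unfolding c using card_subsets_point[of "X - {i}" j "r - 1"] X True by (simp add: cX)
    have 2: "n * (n - 1 choose (r - 1)) = r * (n choose r)"
      using Suc_times_binomial_eq[of "n - 1" "r - 1"] n2 r by (simp add: mult.commute)
    have 3: "real n * real (n - 1) * real (card ?A) = real (r - 1) * real r * real (n choose r)"
    proof -
      have "n * ((n - 1) * card ?A) = (r - 1) * (n * (n - 1 choose (r - 1)))" unfolding 1 by simp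
      also have "\<dots> = (r - 1) * (r * (n choose r))" unfolding 2 ..
      finally have "real (n * ((n - 1) * card ?A)) = real ((r - 1) * (r * (n choose r)))" by (rule arg_cong)
      then show ?thesis by (simp only: of_nat_mult mult.assoc)
    qed
    have ineq: "real n * real (r - 1) \<le> real r * real (n - 1)"
      using n2 r True by (simp add: n_def of_nat_diff algebra_simps)
    have "real (n - 1) * ((real n)\<^sup>2 * real (card ?A)) = real n * (real n * real (n - 1) * real (card ?A))"
      by (simp add: power2_eq_square mult_ac)
    also have "\<dots> = (real n * real (r - 1)) * (real r * real (n choose r))"
      unfolding 3 by (simp add: mult_ac)
    also have "\<dots> \<le> (real r * real (n - 1)) * (real r * real (n choose r))"
      using ineq by (intro mult_right_mono) auto
    also have "\<dots> = real (n - 1) * ((real r)\<^sup>2 * real (n choose r))"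
      by (simp add: power2_eq_square mult_ac)
    finally have "(real n)\<^sup>2 * real (card ?A) \<le> (real r)\<^sup>2 * real (n choose r)"
      using n2 by (simp add: mult_le_cancel_left_pos)
    then show ?thesis by (simp only: n_def)
  next
    case False
    have "r = 1" using False r(1) by linarith
    have "?A = {}"
    proof (rule ccontr)
      assume "?A \<noteq> {}"
      then obtain s where s: "s \<subseteq> X" "card s = 1" "i \<in> s" "j \<in> s" using \<open>r = 1\<close> by auto
      then obtain a where "s = {a}" using card_1_singletonE by blast
      then show False using s X(4) by auto
    qed
    then have z: "card ?A = 0" by (simp only: card.empty)
    show ?thesis unfolding z by simp
  qed
qed

lemma binomial_le_two_power: "n choose k \<le> 2 ^ n"
proof (cases "k \<le> n")
  case True
  have "(n choose k) \<le> (\<Sum>i\<le>n. n choose i)"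
    by (rule member_le_sum) (use True in auto)
  then show ?thesis by (simp add: choose_row_sum)
qed (simp add: binomial_eq_0)

section \<open>Counting pairs of sets of size \<open>r\<close>\<close>

locale sphere_sample = cube_sample n p S \<Omega> N D M
  for n p S \<Omega> N D M +
  fixes r :: nat
  assumes sphere: "S = {s. s \<subseteq> {..<n} \<and> card s = r}" and r: "1 \<le> r" "r \<le> n"
begin

lemma N_eq: "N = real (n choose r)"
  unfolding N_def sphere using n_subsets[of "{..<n}" r] by simp

lemma card_point: "i < n \<Longrightarrow> real n * real (card {s \<in> S. i \<in> s}) = real r * N"
proof -
  assume "i < n"
  then have "n * card {s. s \<subseteq> {..<n} \<and> card s = r \<and> i \<in> s} = r * (n choose r)"
    using card_subsets_point[of "{..<n}" i r] r by simp
  moreover have "{s \<in> S. i \<in> s} = {s. s \<subseteq> {..<n} \<and> card s = r \<and> i \<in> s}" by (auto simp: sphere)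
  ultimately have "real (n * card {s \<in> S. i \<in> s}) = real (r * (n choose r))" by simp
  then show ?thesis by (simp add: N_eq)
qed

lemma card_hitting: "J \<in> \<Omega> \<Longrightarrow> real n * real (card {s \<in> S. s \<inter> J \<noteq> {}}) \<le> real (card J) * (real r * N)"
proof -
  assume J: "J \<in> \<Omega>"
  have "{s \<in> S. s \<inter> J \<noteq> {}} = (\<Union>i\<in>J. {s \<in> S. i \<in> s})" by auto
  then have "card {s \<in> S. s \<inter> J \<noteq> {}} \<le> (\<Sum>i\<in>J. card {s \<in> S. i \<in> s})"
    using card_UN_le[OF finO[OF J], of "\<lambda>i. {s \<in> S. i \<in> s}"] by simp
  then have "real (card {s \<in> S. s \<inter> J \<noteq> {}}) \<le> (\<Sum>i\<in>J. real (card {s \<in> S. i \<in> s}))"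
    unfolding of_nat_sum[symmetric] of_nat_le_iff .
  then have "real n * real (card {s \<in> S. s \<inter> J \<noteq> {}}) \<le> real n * (\<Sum>i\<in>J. real (card {s \<in> S. i \<in> s}))"
    by (intro mult_left_mono) auto
  also have "\<dots> = (\<Sum>i\<in>J. real r * N)"
    unfolding sum_distrib_left by (intro sum.cong refl card_point) (use J in \<open>auto simp: \<Omega>_def\<close>)
  finally show ?thesis by simp
qed

text \<open>Either one set contains both coordinates or each contains one: four cases, each at most
  the fraction (r / n)^2 of all pairs. The quadratic saving survives multiplication by
  \<open>L\<close>, of order n, once r^2 is small against n; one prescribed coordinate would save
  only r / n.\<close>

lemma card_two_hits:
  assumes "i < n" "j < n" "i \<noteq> j" "A \<subseteq> {(s, t). s \<in> S \<and> t \<in> S \<and> i \<in> s \<union> t \<and> j \<in> s \<union> t}"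
  shows "real (card A) \<le> 4 * (real r)\<^sup>2 / (real n)\<^sup>2 * N\<^sup>2"
proof -
  let ?i = "{s \<in> S. i \<in> s}" and ?j = "{s \<in> S. j \<in> s}" and ?ij = "{s \<in> S. i \<in> s \<and> j \<in> s}"
  have n0: "real n > 0" using assms by simp
  have "A \<subseteq> (?ij \<times> S) \<union> (S \<times> ?ij) \<union> (?i \<times> ?j) \<union> (?j \<times> ?i)"
    using assms(4) by auto
  then have "card A \<le> card ((?ij \<times> S) \<union> (S \<times> ?ij) \<union> (?i \<times> ?j) \<union> (?j \<times> ?i))"
    by (rule card_mono[rotated]) (use finS in auto)
  also have "\<dots> \<le> card (?ij \<times> S) + card (S \<times> ?ij) + card (?i \<times> ?j) + card (?j \<times> ?i)"
    by (intro order_trans[OF card_Un_le] add_mono order_refl)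
  finally have "card A \<le> card ?ij * card S + card S * card ?ij + card ?i * card ?j + card ?j * card ?i"
    by (simp only: card_cartesian_product)
  then have A: "real (card A) \<le> real (card ?ij) * N + N * real (card ?ij) + real (card ?i) * real (card ?j) + real (card ?j) * real (card ?i)"
    unfolding N_def of_nat_mult[symmetric] of_nat_add[symmetric] of_nat_le_iff .
  have "?ij = {s. s \<subseteq> {..<n} \<and> card s = r \<and> i \<in> s \<and> j \<in> s}" by (auto simp: sphere)
  then have ij: "(real n)\<^sup>2 * real (card ?ij) \<le> (real r)\<^sup>2 * N"
    using card_subsets_two_points[of "{..<n}" i j r] assms r by (simp add: N_eq)
  have i: "real n * real (card ?i) = real r * N" and j: "real n * real (card ?j) = real r * N"
    using card_point assms by auto
  have "(real n)\<^sup>2 * (real (card ?i) * real (card ?j)) = (real n * real (card ?i)) * (real n * real (card ?j))"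
    by (simp add: power2_eq_square mult_ac)
  then have ij2: "(real n)\<^sup>2 * (real (card ?i) * real (card ?j)) = (real r)\<^sup>2 * N\<^sup>2"
    unfolding i j by (simp add: power2_eq_square mult_ac)
  have "(real n)\<^sup>2 * real (card A) \<le> (real n)\<^sup>2 * (real (card ?ij) * N + N * real (card ?ij)
      + real (card ?i) * real (card ?j) + real (card ?j) * real (card ?i))"
    using A by (intro mult_left_mono) auto
  also have "\<dots> = 2 * (((real n)\<^sup>2 * real (card ?ij)) * N) + 2 * ((real n)\<^sup>2 * (real (card ?i) * real (card ?j)))"
    by (simp add: algebra_simps)
  also have "\<dots> \<le> 2 * (((real r)\<^sup>2 * N) * N) + 2 * ((real r)\<^sup>2 * N\<^sup>2)"
    unfolding ij2 using mult_right_mono[OF ij, of N] N_pos by simp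
  also have "\<dots> = 4 * (real r)\<^sup>2 * N\<^sup>2" by (simp add: power2_eq_square)
  finally show ?thesis using n0 by (simp add: field_simps)
qed

lemma card_symdiff_sphere: "s \<in> S \<Longrightarrow> t \<in> S \<Longrightarrow> card (s \<triangle> t) \<le> 2 * r"
proof -
  assume s: "s \<in> S" "t \<in> S"
  have fin: "finite s" "finite t" using s S_Omega finO by auto
  have "card (s \<triangle> t) \<le> card (s \<union> t)" by (rule card_mono) (use fin in auto)
  also have "\<dots> \<le> card s + card t" by (rule card_Un_le)
  finally show ?thesis using s by (simp add: sphere)
qed

lemma sum_symdiff_sphere: "s \<in> S \<Longrightarrow> (\<Sum>t\<in>S. (2::real) ^ card (s \<triangle> t)) \<le> N * 4 ^ r"
proof -
  assume s: "s \<in> S"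
  have "(\<Sum>t\<in>S. (2::real) ^ card (s \<triangle> t)) \<le> (\<Sum>t\<in>S. 2 ^ (2 * r))"
    by (intro sum_mono power_increasing card_symdiff_sphere s) auto
  then show ?thesis by (simp add: N_def power_mult)
qed

lemma superset_pairs_sphere:
  assumes "u \<in> \<Omega>" "1 < card u"
  shows "real (card {(s, t). s \<in> S \<and> t \<in> S \<and> u \<subseteq> s \<triangle> t}) \<le> 4 * (real r)\<^sup>2 / (real n)\<^sup>2 * N\<^sup>2"
proof -
  obtain i j where ij: "i \<in> u" "j \<in> u" "i \<noteq> j"
    using assms(2) by (metis One_nat_def card_le_Suc0_iff_eq card.infinite linorder_not_less not_less_zero)
  show ?thesis
    by (rule card_two_hits[of i j]) (use ij assms in \<open>auto simp: \<Omega>_def\<close>)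
qed

text \<open>The points out of reach of \<open>card_two_hits\<close>: lying between two hub points
  forces fewer than two coordinates into \<open>s \<union> t\<close>. As \<open>card\<close> is 0 on
  infinite sets, finiteness has to be argued separately where the bound is exploited.\<close>

definition near :: "nat set \<Rightarrow> nat set \<Rightarrow> nat set set" where
  "near z e = {w. card (w \<triangle> z - e) \<le> 1}"

text \<open>Where \<open>w\<close> differs from \<open>z\<close> outside \<open>e\<close>, one of
  \<open>s\<close> and \<open>t\<close> must change that coordinate for \<open>w\<close> to lie
  between the endpoints.\<close>

lemma between_pairs_sphere:
  assumes "w \<in> \<Omega> - near z e" "z \<in> \<Omega>"
  shows "real (card {(s, t). s \<in> S \<and> t \<in> S \<and> w \<triangle> (z \<triangle> s) \<subseteq> (z \<triangle> s) \<triangle> (z \<triangle> e \<triangle> t)})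
    \<le> 4 * (real r)\<^sup>2 / (real n)\<^sup>2 * N\<^sup>2"
proof -
  have "w \<triangle> z \<in> \<Omega>" using assms sdO by blast
  then have wz: "w \<triangle> z \<subseteq> {..<n}" by (simp add: \<Omega>_def)
  have "\<not> card (w \<triangle> z - e) \<le> 1" using assms by (simp add: near_def)
  then obtain i j where ij: "i \<in> w \<triangle> z - e" "j \<in> w \<triangle> z - e" "i \<noteq> j"
    by (metis One_nat_def card_le_Suc0_iff_eq card.infinite linorder_not_less not_less_zero)
  show ?thesis
  proof (rule card_two_hits[of i j])
    show "i < n" "j < n" "i \<noteq> j" using ij wz by auto
    show "{(s, t). s \<in> S \<and> t \<in> S \<and> w \<triangle> (z \<triangle> s) \<subseteq> (z \<triangle> s) \<triangle> (z \<triangle> e \<triangle> t)}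
      \<subseteq> {(s, t). s \<in> S \<and> t \<in> S \<and> i \<in> s \<union> t \<and> j \<in> s \<union> t}"
    proof clarify
      fix s t assume st: "s \<in> S" "t \<in> S" and sub: "w \<triangle> (z \<triangle> s) \<subseteq> (z \<triangle> s) \<triangle> (z \<triangle> e \<triangle> t)"
      have "l \<in> s \<union> t" if "l \<in> w \<triangle> z - e" for l
      proof (rule ccontr)
        assume "l \<notin> s \<union> t"
        then have "l \<in> w \<triangle> (z \<triangle> s)" "l \<notin> (z \<triangle> s) \<triangle> (z \<triangle> e \<triangle> t)" using that by auto
        then show False using sub by blast
      qed
      then show "i \<in> s \<union> t \<and> j \<in> s \<union> t" using ij by blast
    qed
  qed
qed

text \<open>\<open>s\<close> and \<open>t\<close> have equal size and \<open>e\<close> at most one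
  element, so an inclusion up to \<open>e\<close> leaves at most one coordinate to choose. For all
  other pairs both coordinates \<open>j\<close> and \<open>k\<close> required by the edge functional
  exist.\<close>

lemma near_inclusion_count:
  assumes s: "s \<in> S" and e: "e \<in> edge_steps"
  shows "card {t \<in> S. s \<subseteq> t \<union> e \<or> t \<subseteq> s \<union> e} \<le> 2 * n + 2"
proof -
  have fs: "finite s" "s \<subseteq> {..<n}" "card s = r" using s S_Omega finO by (auto simp: sphere)
  have fe: "finite e" "card e \<le> 1" "e \<subseteq> {..<n}" using edge_steps_Omega[OF e] finO by (auto simp: \<Omega>_def)
  let ?A = "insert s ((\<lambda>i. insert i (s - e)) ` {..<n})" and ?B = "insert (s \<union> e) ((\<lambda>i. (s \<union> e) - {i}) ` {..<n})"
  have "t \<in> ?A" if t: "t \<in> S" "s \<subseteq> t \<union> e" for t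
  proof -
    have ft: "finite t" "card t = r" "t \<subseteq> {..<n}" using t finO S_Omega by (auto simp: sphere)
    have sub: "s - e \<subseteq> t" using t by auto
    have "card t \<le> card (s - e) + 1"
      using diff_card_le_card_Diff[OF fe(1), of s] fs ft fe by linarith
    then have "card (t - (s - e)) \<le> 1"
      using card_Diff_subset[of "s - e" t] sub fs by simp
    then have "t - (s - e) = {} \<or> (\<exists>i. t - (s - e) = {i})"
      using ft by (metis card_0_eq card_1_singletonE finite_Diff le_less less_one)
    then show ?thesis
    proof
      assume "t - (s - e) = {}"
      then have "t \<subseteq> s" by auto
      then have "t = s" using ft fs by (simp add: card_subset_eq)
      then show ?thesis by simp
    next
      assume "\<exists>i. t - (s - e) = {i}"
      then obtain i where i: "t - (s - e) = {i}" by auto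
      then have "t = insert i (s - e)" "i < n" using sub ft by auto
      then show ?thesis by auto
    qed
  qed
  moreover have "t \<in> ?B" if t: "t \<in> S" "t \<subseteq> s \<union> e" for t
  proof -
    have ft: "finite t" "card t = r" "t \<subseteq> {..<n}" using t finO S_Omega by (auto simp: sphere)
    have "card (s \<union> e) \<le> r + 1" using card_Un_le[of s e] fs fe by linarith
    then have "card ((s \<union> e) - t) \<le> 1"
      using card_Diff_subset[of t "s \<union> e"] t ft by simp
    then have "(s \<union> e) - t = {} \<or> (\<exists>i. (s \<union> e) - t = {i})"
      using fs fe by (metis card_0_eq card_1_singletonE finite_Diff finite_Un le_less less_one)
    then show ?thesis
    proof
      assume "(s \<union> e) - t = {}"
      then have "t = s \<union> e" using t by auto
      then show ?thesis by simp
    next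
      assume "\<exists>i. (s \<union> e) - t = {i}"
      then obtain i where i: "(s \<union> e) - t = {i}" by auto
      then have "t = (s \<union> e) - {i}" "i < n" using t fs fe by auto
      then show ?thesis by auto
    qed
  qed
  ultimately have "{t \<in> S. s \<subseteq> t \<union> e \<or> t \<subseteq> s \<union> e} \<subseteq> ?A \<union> ?B" by blast
  then have "card {t \<in> S. s \<subseteq> t \<union> e \<or> t \<subseteq> s \<union> e} \<le> card (?A \<union> ?B)"
    by (rule card_mono[rotated]) auto
  also have "\<dots> \<le> card ?A + card ?B" by (rule card_Un_le)
  also have "card ?A \<le> n + 1"
    using card_image_le[of "{..<n}" "\<lambda>i. insert i (s - e)"] by (simp add: card_insert_if)
  also have "card ?B \<le> n + 1"
    using card_image_le[of "{..<n}" "\<lambda>i. (s \<union> e) - {i}"] by (simp add: card_insert_if)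
  finally show ?thesis by simp
qed

end

section \<open>Adjacency and expansion for sphere hubs\<close>

context sphere_sample
begin

text \<open>The hub centres \<open>z\<close> and \<open>z \<triangle> e\<close> lie between almost all pairs, hence they cannot simply be counted as
  obstructions; but a functional with \<open>j \<in> s\<close> and \<open>k \<in> t\<close> is negative at both of them.\<close>

lemma cube_adj_sphere_pair:
  assumes V: "V \<subseteq> \<Omega>" and e: "e \<in> edge_steps"
    and a: "a = z \<triangle> s" and b: "b = z \<triangle> e \<triangle> t"
    and J: "J = {i. i < n \<and> (z \<triangle> {i} \<in> V \<or> z \<triangle> e \<triangle> {i} \<in> V)}"
    and sJ: "s \<inter> J = {}" "t \<inter> J = {}" and st: "s \<subseteq> {..<n}" "t \<subseteq> {..<n}"
    and incl: "\<not> s \<subseteq> t \<union> e" "\<not> t \<subseteq> s \<union> e"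
    and no: "\<And>w. w \<in> V \<Longrightarrow> w \<notin> near z e \<Longrightarrow> w \<noteq> a \<Longrightarrow> w \<noteq> b \<Longrightarrow> \<not> w \<triangle> a \<subseteq> a \<triangle> b"
  shows "cube_adj V a b"
proof -
  obtain j where j: "j \<in> s" "j \<notin> t" "j \<notin> e" using incl by auto
  obtain k where k: "k \<in> t" "k \<notin> s" "k \<notin> e" using incl by auto
  have ab: "a \<triangle> b = s \<triangle> t \<triangle> e" by (auto simp: a b)
  have jk: "j \<in> a \<triangle> b" "k \<in> a \<triangle> b" using j k by (auto simp: ab)
  \<comment> \<open>A near point that lies between \<open>a\<close> and \<open>b\<close> differs
    from \<open>z\<close> only inside \<open>e\<close>, since a further coordinate would belong to
    \<open>J\<close> and to \<open>s\<close> or \<open>t\<close>. Hence at \<open>j\<close> and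
    \<open>k\<close> its difference from \<open>a\<close> agrees with \<open>s\<close>.\<close>
  have key: "j \<in> w \<triangle> a \<and> k \<notin> w \<triangle> a" if w: "w \<in> V" "w \<triangle> a \<subseteq> a \<triangle> b" "w \<noteq> a" "w \<noteq> b" for w
  proof -
    have "w \<in> near z e" using no w by blast
    then have c1: "card (w \<triangle> z - e) \<le> 1" by (simp add: near_def)
    \<comment> \<open>Rules out the default value 0 of \<open>card\<close> in the definition of
      \<open>near\<close>.\<close>
    have fin: "finite (w \<triangle> z - e)"
    proof -
      have "finite w" using w(1) V finO by blast
      moreover have "w \<triangle> z - e \<subseteq> (w \<triangle> a) \<union> s" by (auto simp: a)
      moreover have "finite (w \<triangle> a)"
      proof (rule finite_subset[OF w(2)])
        show "finite (a \<triangle> b)"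
          unfolding ab using st finO[OF edge_steps_Omega(1)[OF e]] finite_subset[of s "{..<n}"] finite_subset[of t "{..<n}"]
          by (auto simp: symdiff_def)
      qed
      moreover have "finite s" using st finite_subset by blast
      ultimately show ?thesis by (meson finite_UnI finite_subset)
    qed
    have "w \<triangle> z - e = {}"
    proof (rule ccontr)
      assume "w \<triangle> z - e \<noteq> {}"
      then have "card (w \<triangle> z - e) = 1" using c1 fin by (metis card_0_eq le_less less_one)
      then obtain i where i: "w \<triangle> z - e = {i}" by (rule card_1_singletonE)
      then have iw: "i \<in> w \<triangle> z" "i \<notin> e" by auto
      have ist: "i \<in> s \<union> t"
      proof (rule ccontr)
        assume "i \<notin> s \<union> t"
        then have "i \<in> w \<triangle> a" "i \<notin> a \<triangle> b" using iw by (auto simp: a b)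
        then show False using w(2) by blast
      qed
      have "i < n" using ist st by auto
      have "w \<triangle> z = {i} \<or> w \<triangle> z = {i} \<union> e"
      proof -
        have "e = {} \<or> (\<exists>l. e = {l})" using e by (auto simp: edge_steps_def)
        then show ?thesis using i iw by auto
      qed
      moreover have zw: "w = z \<triangle> (w \<triangle> z)" by auto
      moreover have "{i} \<union> e = e \<triangle> {i}" using iw(2) by auto
      ultimately have "w = z \<triangle> {i} \<or> w = z \<triangle> e \<triangle> {i}"
        unfolding symdiff_assoc by metis
      then have "i \<in> J" using w(1) \<open>i < n\<close> by (auto simp: J)
      then show False using ist sJ by auto
    qed
    then have "j \<notin> w \<triangle> z" "k \<notin> w \<triangle> z" using j k by auto
    then show ?thesis using j k by (auto simp: a)
  qed
  have "a \<noteq> b" using jk by auto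
  show ?thesis
    unfolding cube_adj_def
  proof (rule conjI, rule \<open>a \<noteq> b\<close>, rule bexI[OF _ jk(1)], rule bexI[OF _ jk(2)], intro ballI impI)
    fix w assume "w \<in> V" "w \<triangle> a \<subseteq> a \<triangle> b"
    then show "w = a \<or> w = b \<or> (j \<in> w \<triangle> a \<and> k \<notin> w \<triangle> a)" using key[of w] by blast
  qed
qed

text \<open>\<open>J\<close> collects the directions of the sampled neighbours of the two centres,
  at most 2 k of them. A non-adjacent pair has an entry reached through \<open>J\<close>
  (\<open>G\<close> or \<open>G'\<close>), is close to an inclusion (\<open>I\<close>), or has an
  obstruction away from the centres, counted by triples. In units of D^2 / 1000000 these cost at
  most 94, 11/10 and 118, while 625 is available.\<close>

lemma prob_nonadjacent_pairs_sphere: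
  fixes L :: real and k :: nat
  assumes Dn: "D \<ge> 2000 * real n" and L: "L = 12 * real n"
    and few: "p ^ k \<le> (1/2) ^ (5 * n)"
    and kr: "real k * real r \<le> real n / 100000"
    and beta: "p * 4 ^ r \<le> 1 / 1000000" and rr: "(real r)\<^sup>2 \<le> real n / 1000000"
    and LD: "L ^ 3 \<le> D / 1000000"
  shows "measure_pmf.prob M {V. \<exists>z\<in>\<Omega>. \<exists>e\<in>edge_steps.
        \<not> real (card {(a, b). a \<in> hub S V z \<and> b \<in> hub S V (z \<triangle> e) \<and> \<not> cube_adj V a b}) \<le> (1/20)\<^sup>2 * D\<^sup>2 / 4}
      \<le> 5 * (1/2) ^ n"
proof -
  have n1: "real n \<ge> 1" using n by simp
  have L1: "L \<ge> 12" using L n1 by simp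
  define C2 where "C2 = 4 * (real r)\<^sup>2 / (real n)\<^sup>2 * N\<^sup>2"
  define \<mu> where "\<mu> = 2 * p\<^sup>2 * D * (N * 4 ^ r) + 4 * p\<^sup>2 * L * (N * 4 ^ r) + p\<^sup>2 * L * C2 + 2 * p * L\<^sup>2 * 2 ^ (2 * r) + 2 * L\<^sup>2 * D + L ^ 3"
  \<comment> \<open>D / 50000 bounds the expected number of hub points reached through
    \<open>J\<close>, 4 n is the order of the moment, and the factor 2 produces the base
    1/2.\<close>
  define t where "t = 2 * (1 / 50000 * D + 4 * real n)"
  define Low where "Low = (\<lambda>i. {i}) ` {..<n}"
  define R where "R = (\<lambda>J. {s \<in> S. s \<inter> J \<noteq> {}})"
  define B1 where "B1 = (\<lambda>V. \<exists>z\<in>\<Omega>. \<not> (9/10 * D \<le> real (card (hub S V z)) \<and> real (card (hub S V z)) \<le> 11/10 * D))"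
  define B2 where "B2 = (\<lambda>V. \<exists>z\<in>\<Omega>. \<exists>e\<in>edge_steps.
      2 * \<mu> \<le> real (card {f \<in> pair_triples z e (near z e). triple_points z e f \<subseteq> V}))"
  define B3 where "B3 = (\<lambda>V. \<exists>z\<in>\<Omega>. k \<le> card {u \<in> Low. z \<triangle> u \<in> V})"
  \<comment> \<open>Again \<open>J\<close> is determined by the sample, so all candidates are
    treated at once.\<close>
  define B4 where "B4 = (\<lambda>V. \<exists>z\<in>\<Omega>. \<exists>J\<in>{J \<in> \<Omega>. card J \<le> 2 * k}. t \<le> real (card {x \<in> V. x \<triangle> z \<in> R J}))"
  have finE: "finite edge_steps" by (simp add: edge_steps_def)
  have p1: "measure_pmf.prob M {V. B1 V} \<le> 2 * (1/2) ^ n"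
    using prob_hub_sizes[OF Dn] half_power_bound'[of 2] unfolding B1_def by linarith
  have p2: "measure_pmf.prob M {V. B2 V} \<le> (1/2) ^ n"
  proof -
    have "measure_pmf.prob M {V. 2 * \<mu> \<le> real (card {f \<in> pair_triples z e (near z e). triple_points z e f \<subseteq> V})} \<le> (1/2) ^ (4 * n)"
      if ze: "z \<in> \<Omega>" "e \<in> edge_steps" for z e
    proof (rule prob_pair_triples[OF ze(1) edge_steps_Omega[OF ze(2)] sum_symdiff_sphere _ card_symdiff_sphere _ _ _ \<mu>_def])
      show "real (card {(s, t). s \<in> S \<and> t \<in> S \<and> w \<triangle> (z \<triangle> s) \<subseteq> (z \<triangle> s) \<triangle> (z \<triangle> e \<triangle> t)}) \<le> C2"
        if "w \<in> \<Omega> - near z e" for w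
        unfolding C2_def by (rule between_pairs_sphere[OF that ze(1)])
      show "C2 \<ge> 0" by (simp add: C2_def)
    qed (use L n1 in auto)
    then have "measure_pmf.prob M {V. \<exists>e\<in>edge_steps. 2 * \<mu> \<le> real (card {f \<in> pair_triples z e (near z e). triple_points z e f \<subseteq> V})}
        \<le> real (card edge_steps) * (1/2) ^ (4 * n)" if "z \<in> \<Omega>" for z
      using that by (intro prob_union finE) auto
    moreover have "real (card edge_steps) * (1/2) ^ (4 * n) \<le> 2 ^ n * (1/2) ^ (4 * n)"
    proof (rule mult_right_mono)
      have "real (card edge_steps) \<le> real (2 ^ n)" using card_edge_steps by (rule of_nat_mono)
      then show "real (card edge_steps) \<le> 2 ^ n" by simp
    qed simp
    ultimately have "measure_pmf.prob M {V. \<exists>e\<in>edge_steps. 2 * \<mu> \<le> real (card {f \<in> pair_triples z e (near z e). triple_points z e f \<subseteq> V})}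
        \<le> 2 ^ n * (1/2) ^ (4 * n)" if "z \<in> \<Omega>" for z
      using that order_trans by blast
    then have "measure_pmf.prob M {V. B2 V} \<le> real (card \<Omega>) * (2 ^ n * (1/2) ^ (4 * n))"
      unfolding B2_def by (intro prob_union fin) auto
    then show ?thesis using half_power_bound unfolding card_Omega by linarith
  qed
  have LowO: "Low \<subseteq> \<Omega>" by (auto simp: Low_def \<Omega>_def)
  have cLow: "card Low = n" unfolding Low_def by (subst card_image) auto
  have p3: "measure_pmf.prob M {V. B3 V} \<le> (1/2) ^ n"
  proof -
    have "measure_pmf.prob M {V. B3 V} \<le> 2 ^ n * (real (card Low choose k) * p ^ k)"
      unfolding B3_def by (rule prob_low_count[OF LowO])
    \<comment> \<open>One of the five powers in \<open>few\<close> pays for the crude bound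
      \<open>2 ^ n\<close> on the binomial coefficient, which is independent of how \<open>p\<close>
      compares with 1 / n.\<close>
    also have "real (card Low choose k) * p ^ k \<le> 2 ^ n * (1/2) ^ (5 * n)"
    proof (rule mult_mono)
      have "real (n choose k) \<le> real (2 ^ n)" by (rule of_nat_mono[OF binomial_le_two_power])
      then show "real (card Low choose k) \<le> 2 ^ n" by (simp add: cLow)
    qed (use few p in auto)
    also have "2 ^ n * (1/2 :: real) ^ (5 * n) = (1/2) ^ (4 * n)"
      by (simp add: power_divide field_simps power_add[symmetric])
    finally show ?thesis using half_power_bound'[of 1] by simp
  qed
  have tpos: "t > 0" using D_pos n1 by (simp add: t_def)
  have p4: "measure_pmf.prob M {V. B4 V} \<le> (1/2) ^ n"
  proof -
    have one: "measure_pmf.prob M {V. t \<le> real (card {x \<in> V. x \<triangle> z \<in> R J})} \<le> (1/2) ^ (4 * n)"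
      if z: "z \<in> \<Omega>" and J: "J \<in> {J \<in> \<Omega>. card J \<le> 2 * k}" for z J
    proof -
      have "real n * real (card (R J)) \<le> real (card J) * (real r * N)"
        unfolding R_def using J by (intro card_hitting) auto
      also have "\<dots> \<le> real (2 * k) * (real r * N)"
        using J N_pos by (intro mult_right_mono) auto
      also have "\<dots> = 2 * (real k * real r) * N" by simp
      also have "\<dots> \<le> 2 * (real n / 100000) * N" using kr N_pos by (intro mult_right_mono mult_left_mono) auto
      finally have "real (card (R J)) \<le> 1 / 50000 * N" using n1 by (simp add: field_simps)
      from mult_left_mono[OF this p0] have "p * real (card (R J)) + real (4 * n) \<le> t / 2"
        by (simp add: t_def D_def mult_ac)
      then have "measure_pmf.prob M {V. t \<le> real (card {x \<in> V. x \<triangle> z \<in> R J})} \<le> (t / 2 / t) ^ (4 * n)"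
        by (intro prob_hub_part_ge z tpos) (auto simp: R_def)
      then show ?thesis using tpos by simp
    qed
    have cJ: "real (card {J \<in> \<Omega>. card J \<le> 2 * k}) \<le> 2 ^ n"
      unfolding card_Omega[symmetric] by (intro of_nat_mono card_mono fin) auto
    have two: "measure_pmf.prob M {V. \<exists>J\<in>{J \<in> \<Omega>. card J \<le> 2 * k}. t \<le> real (card {x \<in> V. x \<triangle> z \<in> R J})}
        \<le> 2 ^ n * (1/2) ^ (4 * n)" if z: "z \<in> \<Omega>" for z
    proof -
      have "measure_pmf.prob M {V. \<exists>J\<in>{J \<in> \<Omega>. card J \<le> 2 * k}. t \<le> real (card {x \<in> V. x \<triangle> z \<in> R J})}
        \<le> real (card {J \<in> \<Omega>. card J \<le> 2 * k}) * (1/2) ^ (4 * n)"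
        using fin by (intro prob_union one z) auto
      also have "\<dots> \<le> 2 ^ n * (1/2) ^ (4 * n)" by (rule mult_right_mono[OF cJ]) simp
      finally show ?thesis .
    qed
    have "measure_pmf.prob M {V. B4 V} \<le> real (card \<Omega>) * (2 ^ n * (1/2) ^ (4 * n))"
      unfolding B4_def by (intro prob_union fin two)
    then show ?thesis using half_power_bound unfolding card_Omega by linarith
  qed
  have small: "2 * (11/10 * D * t) + 11/10 * D * (2 * real n + 2) + 2 * \<mu> \<le> (1/20)\<^sup>2 * D\<^sup>2 / 4"
  proof -
    define x :: real where "x = 1 / 1000000"
    have Dp: "D > 0" by (rule D_pos)
    have LL: "L \<le> L ^ 3" "L\<^sup>2 \<le> L ^ 3"
      using L1 power_increasing[of 1 3 L] power_increasing[of 2 3 L] by auto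
    have xD: "L \<le> x * D" "L\<^sup>2 \<le> x * D" "L ^ 3 \<le> x * D" using LD LL by (auto simp: x_def)
    have nL: "12 * real n \<le> x * D" using xD L by simp
    have DD: "D * D = D\<^sup>2" by (simp add: power2_eq_square)
    have b0: "p * 4 ^ r \<ge> 0" using p by simp
    have m1: "2 * p\<^sup>2 * D * (N * 4 ^ r) = 2 * ((p * 4 ^ r) * D\<^sup>2)"
      by (simp add: D_def power2_eq_square mult_ac)
    have m1': "(p * 4 ^ r) * D\<^sup>2 \<le> x * D\<^sup>2" using beta by (intro mult_right_mono) (auto simp: x_def)
    have m2: "4 * p\<^sup>2 * L * (N * 4 ^ r) = 4 * ((p * 4 ^ r) * (L * D))"
      by (simp add: D_def power2_eq_square mult_ac)
    have m2': "(p * 4 ^ r) * (L * D) \<le> 1 * ((x * D) * D)"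
      using beta xD L1 Dp b0 by (intro mult_mono) auto
    have m3: "p\<^sup>2 * L * C2 = 48 * ((real r)\<^sup>2 / real n) * D\<^sup>2"
      using n1 by (simp add: C2_def L D_def power2_eq_square field_simps)
    have "(real r)\<^sup>2 / real n \<le> x" using rr n1 by (simp add: x_def field_simps)
    then have m3': "48 * ((real r)\<^sup>2 / real n) * D\<^sup>2 \<le> 48 * x * D\<^sup>2" by (intro mult_right_mono mult_left_mono) auto
    have D1: "D \<ge> 1" using Dn n1 by linarith
    have m4: "2 * p * L\<^sup>2 * 2 ^ (2 * r) = 2 * ((p * 4 ^ r) * L\<^sup>2)" by (simp add: power_mult)
    have m4': "(p * 4 ^ r) * L\<^sup>2 \<le> 1 * (x * D * D)"
    proof (rule mult_mono)
      show "p * 4 ^ r \<le> 1" using beta by simp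
      have "x * D * 1 \<le> x * D * D" using D1 Dp by (intro mult_left_mono) (auto simp: x_def)
      then show "L\<^sup>2 \<le> x * D * D" using xD(2) by linarith
    qed auto
    have m5': "L\<^sup>2 * D \<le> x * D * D" using xD(2) Dp by (intro mult_right_mono) auto
    have m6': "L ^ 3 \<le> x * D * D"
    proof -
      have "x * D * 1 \<le> x * D * D" using D1 Dp by (intro mult_left_mono) (auto simp: x_def)
      then show ?thesis using xD(3) by linarith
    qed
    have xDD: "x * D * D = x * D\<^sup>2" by (simp add: power2_eq_square)
    have "\<mu> \<le> 2 * (x * D\<^sup>2) + 4 * (x * D\<^sup>2) + 48 * x * D\<^sup>2 + 2 * (x * D\<^sup>2) + 2 * (x * D\<^sup>2) + x * D\<^sup>2"
      unfolding \<mu>_def m1 m2 m3 m4 using m1' m2' m3' m4' m5' m6' unfolding xDD by linarith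
    then have mu: "\<mu> \<le> 59 * (x * D\<^sup>2)" by linarith
    have "11/10 * D * (2 * real n + 2) \<le> 11/10 * D * (x * D)"
      using nL n1 Dp by (intro mult_left_mono) auto
    then have u1: "11/10 * D * (2 * real n + 2) \<le> 11/10 * (x * D\<^sup>2)" by (simp add: power2_eq_square mult_ac)
    have "t \<le> 42 * (x * D)"
    proof -
      have "12 * real n \<le> D / 1000000" using nL by (simp add: x_def)
      then have "t \<le> 42 * (D / 1000000)" using n1 by (simp add: t_def)
      then show ?thesis by (simp add: x_def)
    qed
    then have "11/10 * D * t \<le> 11/10 * D * (42 * (x * D))" using Dp by (intro mult_left_mono) auto
    also have "\<dots> = 462/10 * (x * D\<^sup>2)" by (simp add: power2_eq_square)
    also have "\<dots> \<le> 47 * (x * D\<^sup>2)" by (intro mult_right_mono) (auto simp: x_def)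
    finally have u2: "11/10 * D * t \<le> 47 * (x * D\<^sup>2)" .
    have "(1/20)\<^sup>2 * D\<^sup>2 / 4 = 625 * (x * D\<^sup>2)" by (simp add: x_def power2_eq_square)
    moreover have "0 \<le> x * D\<^sup>2" by (simp add: x_def)
    ultimately show ?thesis using mu u1 u2 by linarith
  qed
  have "measure_pmf.prob M {V. \<exists>z\<in>\<Omega>. \<exists>e\<in>edge_steps.
        \<not> real (card {(a, b). a \<in> hub S V z \<and> b \<in> hub S V (z \<triangle> e) \<and> \<not> cube_adj V a b}) \<le> (1/20)\<^sup>2 * D\<^sup>2 / 4}
      \<le> measure_pmf.prob M {V. B1 V \<or> B2 V \<or> B3 V \<or> B4 V}"
  proof (rule prob_mono, rule CollectI, rule ccontr)
    fix V assume V: "V \<subseteq> \<Omega>" and ne: "V \<in> {V. \<exists>z\<in>\<Omega>. \<exists>e\<in>edge_steps.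
        \<not> real (card {(a, b). a \<in> hub S V z \<and> b \<in> hub S V (z \<triangle> e) \<and> \<not> cube_adj V a b}) \<le> (1/20)\<^sup>2 * D\<^sup>2 / 4}"
      and "\<not> (B1 V \<or> B2 V \<or> B3 V \<or> B4 V)"
    then have B: "\<not> B1 V" "\<not> B2 V" "\<not> B3 V" "\<not> B4 V" by auto
    obtain z e where ze: "z \<in> \<Omega>" "e \<in> edge_steps"
      "\<not> real (card {(a, b). a \<in> hub S V z \<and> b \<in> hub S V (z \<triangle> e) \<and> \<not> cube_adj V a b}) \<le> (1/20)\<^sup>2 * D\<^sup>2 / 4"
      using ne by blast
    have ze2: "z \<triangle> e \<in> \<Omega>" using sdO[OF ze(1) edge_steps_Omega(1)[OF ze(2)]] .
    let ?H = "hub S V z" and ?H' = "hub S V (z \<triangle> e)"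
    let ?T = "{f \<in> pair_triples z e (near z e). triple_points z e f \<subseteq> V}"
    let ?P = "{(a, b). a \<in> ?H \<and> b \<in> ?H' \<and> \<not> cube_adj V a b}"
    define J where "J = {i. i < n \<and> (z \<triangle> {i} \<in> V \<or> z \<triangle> e \<triangle> {i} \<in> V)}"
    have finV: "finite V" using V fin finite_subset by blast
    have finH: "finite ?H" "finite ?H'" by (rule finite_subset[OF hub_subset finV])+
    have finT: "finite ?T"
    proof (rule finite_subset[of _ "S \<times> S \<times> \<Omega>"])
      show "?T \<subseteq> S \<times> S \<times> \<Omega>" by (auto simp: pair_triples_def)
    qed (auto simp: finS fin)
    have JO: "J \<in> {J \<in> \<Omega>. card J \<le> 2 * k}"
    proof -
      have lowc: "card {i. i < n \<and> y \<triangle> {i} \<in> V} \<le> k" if y: "y \<in> \<Omega>" for y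
      proof -
        have "card {i. i < n \<and> y \<triangle> {i} \<in> V} \<le> card {u \<in> Low. y \<triangle> u \<in> V}"
          by (rule card_inj_on_le[where f = "\<lambda>i. {i}"]) (auto simp: inj_on_def Low_def)
        also have "\<dots> \<le> k" using B(3) y unfolding B3_def by (meson nat_le_linear)
        finally show ?thesis .
      qed
      have eq: "J = {i. i < n \<and> z \<triangle> {i} \<in> V} \<union> {i. i < n \<and> z \<triangle> e \<triangle> {i} \<in> V}" by (auto simp: J_def)
      have "card J \<le> card {i. i < n \<and> z \<triangle> {i} \<in> V} + card {i. i < n \<and> z \<triangle> e \<triangle> {i} \<in> V}"
        unfolding eq by (rule card_Un_le)
      then have "card J \<le> 2 * k" using lowc[OF ze(1)] lowc[OF ze2] by linarith
      moreover have "J \<in> \<Omega>" by (auto simp: J_def \<Omega>_def)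
      ultimately show ?thesis by simp
    qed
    define G where "G = {x \<in> V. x \<triangle> z \<in> R J}"
    define G' where "G' = {x \<in> V. x \<triangle> (z \<triangle> e) \<in> R J}"
    have G: "real (card G) \<le> t" "real (card G') \<le> t"
    proof -
      have "\<not> t \<le> real (card {x \<in> V. x \<triangle> y \<in> R J})" if "y \<in> \<Omega>" for y
        using B(4) that JO unfolding B4_def by blast
      from this[OF ze(1)] this[OF ze2] show "real (card G) \<le> t" "real (card G') \<le> t"
        unfolding G_def G'_def by linarith+
    qed
    have finG: "finite G" "finite G'" using finV by (auto simp: G_def G'_def)
    define I where "I = (SIGMA a:?H. {b \<in> ?H'. a \<triangle> z \<subseteq> b \<triangle> (z \<triangle> e) \<union> e \<or> b \<triangle> (z \<triangle> e) \<subseteq> a \<triangle> z \<union> e})"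
    have finI: "finite I" using finH by (auto simp: I_def)
    have cI: "card I \<le> card ?H * (2 * n + 2)"
    proof -
      have "card I = (\<Sum>a\<in>?H. card {b \<in> ?H'. a \<triangle> z \<subseteq> b \<triangle> (z \<triangle> e) \<union> e \<or> b \<triangle> (z \<triangle> e) \<subseteq> a \<triangle> z \<union> e})"
        unfolding I_def by (rule card_SigmaI) (use finH in auto)
      also have "\<dots> \<le> (\<Sum>a\<in>?H. 2 * n + 2)"
      proof (rule sum_mono)
        fix a assume "a \<in> ?H"
        then have aS: "a \<triangle> z \<in> S" by (simp add: hub_def)
        have "card {b \<in> ?H'. a \<triangle> z \<subseteq> b \<triangle> (z \<triangle> e) \<union> e \<or> b \<triangle> (z \<triangle> e) \<subseteq> a \<triangle> z \<union> e}
            \<le> card {t \<in> S. a \<triangle> z \<subseteq> t \<union> e \<or> t \<subseteq> a \<triangle> z \<union> e}"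
          by (rule card_inj_on_le[where f = "\<lambda>b. b \<triangle> (z \<triangle> e)"])
             (use finS in \<open>auto simp: inj_on_def hub_def simp del: in_symdiff_iff\<close>)
        also have "\<dots> \<le> 2 * n + 2" by (rule near_inclusion_count[OF aS ze(2)])
        finally show "card {b \<in> ?H'. a \<triangle> z \<subseteq> b \<triangle> (z \<triangle> e) \<union> e \<or> b \<triangle> (z \<triangle> e) \<subseteq> a \<triangle> z \<union> e} \<le> 2 * n + 2" .
      qed
      finally show ?thesis by simp
    qed
    have "?P \<subseteq> G \<times> ?H' \<union> ?H \<times> G' \<union> I \<union> (\<lambda>(s, t, w). (z \<triangle> s, z \<triangle> e \<triangle> t)) ` ?T"
    proof
      fix q assume "q \<in> ?P"
      then obtain a b where q: "q = (a, b)" "a \<in> ?H" "b \<in> ?H'" "\<not> cube_adj V a b" by auto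
      define s where "s = a \<triangle> z"
      define t where "t = b \<triangle> (z \<triangle> e)"
      have st: "s \<in> S" "t \<in> S" "a \<in> V" "b \<in> V" using q by (auto simp: hub_def s_def t_def)
      have ab: "a = z \<triangle> s" "b = z \<triangle> e \<triangle> t" by (simp_all add: s_def t_def symdiff_ac)
      show "q \<in> G \<times> ?H' \<union> ?H \<times> G' \<union> I \<union> (\<lambda>(s, t, w). (z \<triangle> s, z \<triangle> e \<triangle> t)) ` ?T"
      proof (rule ccontr)
        assume nq: "q \<notin> G \<times> ?H' \<union> ?H \<times> G' \<union> I \<union> (\<lambda>(s, t, w). (z \<triangle> s, z \<triangle> e \<triangle> t)) ` ?T"
        have sJ: "s \<inter> J = {}"
        proof (rule ccontr)
          assume "s \<inter> J \<noteq> {}"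
          then have "a \<in> G" using st by (simp add: G_def R_def s_def)
          then show False using nq q by blast
        qed
        have tJ: "t \<inter> J = {}"
        proof (rule ccontr)
          assume "t \<inter> J \<noteq> {}"
          then have "b \<in> G'" using st by (simp add: G'_def R_def t_def)
          then show False using nq q by blast
        qed
        have "(a, b) \<notin> I" using nq q by blast
        then have incl: "\<not> s \<subseteq> t \<union> e" "\<not> t \<subseteq> s \<union> e" using q by (auto simp: I_def s_def t_def simp del: in_symdiff_iff)
        have sub: "s \<subseteq> {..<n}" "t \<subseteq> {..<n}" using st by (auto simp: sphere)
        have "cube_adj V a b"
        proof (rule cube_adj_sphere_pair[OF V ze(2) ab J_def sJ tJ sub incl])
          fix w assume w: "w \<in> V" "w \<notin> near z e" "w \<noteq> a" "w \<noteq> b"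
          show "\<not> w \<triangle> a \<subseteq> a \<triangle> b"
          proof
            assume wa: "w \<triangle> a \<subseteq> a \<triangle> b"
            have "(s, t, w) \<in> ?T"
              using st w wa V by (auto simp: pair_triples_def triple_points_def ab[symmetric] simp del: in_symdiff_iff)
            then have "(\<lambda>(s, t, w). (z \<triangle> s, z \<triangle> e \<triangle> t)) (s, t, w) \<in> (\<lambda>(s, t, w). (z \<triangle> s, z \<triangle> e \<triangle> t)) ` ?T"
              by (rule imageI)
            then have "q \<in> (\<lambda>(s, t, w). (z \<triangle> s, z \<triangle> e \<triangle> t)) ` ?T" using q(1) ab by simp
            then show False using nq by blast
          qed
        qed
        then show False using q(4) by simp
      qed
    qed
    then have "card ?P \<le> card (G \<times> ?H' \<union> ?H \<times> G' \<union> I \<union> (\<lambda>(s, t, w). (z \<triangle> s, z \<triangle> e \<triangle> t)) ` ?T)"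
      by (rule card_mono[rotated]) (use finH finT finG finI in auto)
    also have "\<dots> \<le> card (G \<times> ?H') + card (?H \<times> G') + card I + card ((\<lambda>(s, t, w). (z \<triangle> s, z \<triangle> e \<triangle> t)) ` ?T)"
      by (intro order_trans[OF card_Un_le] add_mono order_refl)
    also have "\<dots> \<le> card G * card ?H' + card ?H * card G' + card ?H * (2 * n + 2) + card ?T"
      using cI card_image_le[OF finT, of "\<lambda>(s, t, w). (z \<triangle> s, z \<triangle> e \<triangle> t)"]
      by (simp only: card_cartesian_product add_mono order_refl)
    finally have "real (card ?P) \<le> real (card G * card ?H' + card ?H * card G' + card ?H * (2 * n + 2) + card ?T)"
      by (rule of_nat_mono)
    then have P: "real (card ?P) \<le> real (card G) * real (card ?H') + real (card ?H) * real (card G')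
        + real (card ?H) * (2 * real n + 2) + real (card ?T)"
      by (simp only: of_nat_add of_nat_mult of_nat_numeral)
    have H: "real (card ?H) \<le> 11/10 * D" "real (card ?H') \<le> 11/10 * D"
      using B(1) ze(1) ze2 unfolding B1_def by blast+
    have "real (card G) * real (card ?H') \<le> t * (11/10 * D)"
      using G H tpos by (intro mult_mono) auto
    moreover have "real (card ?H) * real (card G') \<le> (11/10 * D) * t"
      using G H D_pos by (intro mult_mono) auto
    moreover have "real (card ?H) * (2 * real n + 2) \<le> 11/10 * D * (2 * real n + 2)"
      using H by (intro mult_right_mono) auto
    moreover have "\<not> 2 * \<mu> \<le> real (card ?T)"
      using B(2) ze(1,2) unfolding B2_def by blast
    moreover have "t * (11/10 * D) = 11/10 * D * t" by simp
    ultimately show False using ze(3) small P by linarith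
  qed
  also have "\<dots> \<le> measure_pmf.prob M {V. B1 V} + (measure_pmf.prob M {V. B2 V}
      + (measure_pmf.prob M {V. B3 V} + measure_pmf.prob M {V. B4 V}))"
    by (intro order_trans[OF prob_disj] add_left_mono) simp
  finally show ?thesis using p1 p2 p3 p4 by linarith
qed

text \<open>With \<epsilon> = 1/20 half of all pairs must be free, and only the diagonal and the
  pairs with a set meeting \<open>J\<close>, a fraction of at most 2 k r / n, are lost. Two
  coordinates already yield the saving of \<open>card_two_hits\<close>, hence \<open>s0 = 1\<close>
  and singletons in \<open>Low\<close>; \<open>d0 = 2 * r\<close> bounds every difference. The 10000
  is 20^2 * 25.\<close>

lemma prob_expanding_sphere:
  fixes L :: real and k :: nat
  assumes Dn: "D \<ge> 2000 * real n" and L: "L = 12 * real n"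
    and few: "p ^ k \<le> (1/2) ^ (5 * n)"
    and kr: "real k * real r \<le> real n / 100000"
    and beta: "p * 4 ^ r \<le> 1 / 1000000" and rr: "(real r)\<^sup>2 \<le> real n / 1000000"
    and LD: "L ^ 3 \<le> D / 1000000"
  shows "measure_pmf.prob M {V. \<not> expanding (D / (10000 * real n)) V} \<le> 10 * (1/2) ^ n"
proof -
  have n1: "real n \<ge> 1" using n by simp
  have Np: "N > 0" using N_pos by simp
  have L1: "L \<ge> 12" using L n1 by simp
  define C2 where "C2 = 4 * (real r)\<^sup>2 / (real n)\<^sup>2 * N\<^sup>2"
  define Low where "Low = (\<lambda>i. {i}) ` {..<n}"
  have cLow: "card Low = n" unfolding Low_def by (subst card_image) auto
  have "measure_pmf.prob M {V. \<not> expanding ((1/20)\<^sup>2 * D / (25 * real n)) V} \<le> 5 * (1/2) ^ n + 5 * (1/2) ^ n"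
  proof (rule prob_expanding[OF Dn _ _ _ _ _ _ _ _ sum_symdiff_sphere _ _ L _ prob_nonadjacent_pairs_sphere[OF assms],
        where Low = Low and k = k and ?s0.0 = 1 and ?d0.0 = "2 * r" and ?C2.0 = C2])
    show "1/20 * D \<ge> 3 * real n" using Dn n1 by linarith
    show "Low \<subseteq> \<Omega>" by (auto simp: Low_def \<Omega>_def)
    show "{} \<notin> Low" by (auto simp: Low_def)
    show "u \<in> Low" if "s \<in> S" "t \<in> S" "u \<subseteq> s \<triangle> t" "u \<noteq> {}" "card u \<le> 1" for s t u
    proof -
      have su: "s \<triangle> t \<in> \<Omega>" using that S_Omega sdO by blast
      then have fu: "finite u" using that(3) finO finite_subset by blast
      then have "card u = 1" using that(4,5) by (metis card_0_eq le_less less_one)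
      then obtain i where "u = {i}" by (rule card_1_singletonE)
      then show ?thesis using that(3) su by (auto simp: Low_def \<Omega>_def simp del: in_symdiff_iff)
    qed
    have "real (card Low choose k) * p ^ k \<le> 2 ^ n * (1/2) ^ (5 * n)"
    proof (rule mult_mono)
      have "real (n choose k) \<le> real (2 ^ n)" by (rule of_nat_mono[OF binomial_le_two_power])
      then show "real (card Low choose k) \<le> 2 ^ n" by (simp add: cLow)
    qed (use few p in auto)
    also have "2 ^ n * (1/2 :: real) ^ (5 * n) = (1/2) ^ (4 * n)"
      by (simp add: power_divide field_simps power_add[symmetric])
    finally show "real (card Low choose k) * p ^ k \<le> (1/2) ^ (4 * n)" .
    show "10 * (1/20) * N\<^sup>2 \<le> real (card (free_pairs J (2 * r)))" if J: "J \<in> \<Omega>" "card J \<le> k" for J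
    proof -
      let ?R = "{s \<in> S. s \<inter> J \<noteq> {}}"
      have "S \<times> S \<subseteq> free_pairs J (2 * r) \<union> (\<lambda>s. (s, s)) ` S \<union> ?R \<times> S \<union> S \<times> ?R"
        using card_symdiff_sphere by (auto simp: free_pairs_def)
      then have "card (S \<times> S) \<le> card (free_pairs J (2 * r) \<union> (\<lambda>s. (s, s)) ` S \<union> ?R \<times> S \<union> S \<times> ?R)"
        by (rule card_mono[rotated]) (use finS finite_free_pairs in auto)
      also have "\<dots> \<le> card (free_pairs J (2 * r)) + card ((\<lambda>s. (s, s)) ` S) + card (?R \<times> S) + card (S \<times> ?R)"
        by (intro order_trans[OF card_Un_le] add_mono order_refl)
      also have "\<dots> \<le> card (free_pairs J (2 * r)) + card S + card ?R * card S + card S * card ?R"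
        using card_image_le[OF finS, of "\<lambda>s. (s, s)"] by (simp only: card_cartesian_product add_mono order_refl)
      finally have "real (card S * card S) \<le> real (card (free_pairs J (2 * r)) + card S + card ?R * card S + card S * card ?R)"
        unfolding card_cartesian_product by (rule of_nat_mono)
      then have NN: "N * N \<le> real (card (free_pairs J (2 * r))) + N + real (card ?R) * N + N * real (card ?R)"
        by (simp only: of_nat_add of_nat_mult N_def)
      have "real n * real (card ?R) \<le> real (card J) * (real r * N)" by (rule card_hitting[OF J(1)])
      also have "\<dots> \<le> real k * (real r * N)" using J Np by (intro mult_right_mono) auto
      also have "\<dots> = real k * real r * N" by simp
      also have "\<dots> \<le> real n / 100000 * N" using kr Np by (intro mult_right_mono) auto
      finally have R: "real (card ?R) \<le> N / 100000" using n1 by (simp add: field_simps)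
      have "real (card ?R) * N \<le> N / 100000 * N" using R Np by (intro mult_right_mono) auto
      then have "real (card ?R) * N \<le> (N * N) / 100000" by simp
      moreover have "N * real (card ?R) = real (card ?R) * N" by simp
      moreover have "N \<le> (N * N) / 100"
      proof -
        have "D \<le> N" using p Np mult_right_mono[of p 1 N] by (simp add: D_def)
        then have "100 \<le> N" using Dn n1 by linarith
        then have "N * 1 \<le> N * (N / 100)" using Np by (intro mult_left_mono) auto
        then show ?thesis by simp
      qed
      moreover have "0 \<le> N * N" by simp
      moreover have "10 * (1/20) * N\<^sup>2 = (N * N) / 2" by (simp add: power2_eq_square)
      ultimately show ?thesis using NN by linarith
    qed
    show "real (card {(s, t). s \<in> S \<and> t \<in> S \<and> u \<subseteq> s \<triangle> t}) \<le> C2" if "u \<in> \<Omega>" "1 < card u" for u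
      unfolding C2_def by (rule superset_pairs_sphere[OF that])
    show "C2 \<ge> 0" by (simp add: C2_def)
    show "2 * (p * D * (N * 4 ^ r) + p * L * C2 + L * D * 2 ^ (2 * r) + L\<^sup>2 * N) \<le> 1/20 * N * D"
    proof -
      define x :: real where "x = 1 / 1000000"
      have Dp: "D > 0" by (rule D_pos)
      have ND: "N * D > 0" using Np Dp by simp
      have LL: "L \<le> L ^ 3" "L\<^sup>2 \<le> L ^ 3"
        using L1 power_increasing[of 1 3 L] power_increasing[of 2 3 L] by auto
      have xD: "L \<le> x * D" "L\<^sup>2 \<le> x * D" using LD LL by (auto simp: x_def)
      have t1: "p * D * (N * 4 ^ r) \<le> x * (N * D)"
      proof -
        have "(p * 4 ^ r) * (N * D) \<le> x * (N * D)" using beta ND by (intro mult_right_mono) (auto simp: x_def)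
        then show ?thesis by (simp add: mult_ac)
      qed
      have t2: "p * L * C2 \<le> 48 * x * (N * D)"
      proof -
        have "p * L * C2 = 48 * ((real r)\<^sup>2 / real n) * (N * D)"
          using n1 by (simp add: C2_def L D_def power2_eq_square field_simps)
        moreover have "(real r)\<^sup>2 / real n \<le> x" using rr n1 by (simp add: x_def field_simps)
        then have "48 * ((real r)\<^sup>2 / real n) * (N * D) \<le> 48 * x * (N * D)"
          using ND by (intro mult_right_mono mult_left_mono) auto
        ultimately show ?thesis by linarith
      qed
      have t3: "L * D * 2 ^ (2 * r) \<le> x * (N * D)"
      proof -
        have "(2::real) ^ (2 * r) = 4 ^ r" by (simp add: power_mult)
        then have "L * D * 2 ^ (2 * r) = L * ((p * 4 ^ r) * N)" by (simp add: D_def)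
        also have "\<dots> \<le> (x * D) * (1 * N)"
          using xD beta Np L1 p by (intro mult_mono) auto
        finally show ?thesis by (simp add: mult_ac)
      qed
      have t4: "L\<^sup>2 * N \<le> x * (N * D)"
      proof -
        have "L\<^sup>2 * N \<le> (x * D) * N" using xD Np by (intro mult_right_mono) auto
        then show ?thesis by (simp add: mult_ac)
      qed
      have "2 * (p * D * (N * 4 ^ r) + p * L * C2 + L * D * 2 ^ (2 * r) + L\<^sup>2 * N) \<le> 102 * x * (N * D)"
        using t1 t2 t3 t4 by (simp add: algebra_simps)
      also have "\<dots> \<le> 1/20 * (N * D)" using ND by (intro mult_right_mono) (auto simp: x_def)
      finally show ?thesis by simp
    qed
  qed simp_all
  moreover have "(1/20)\<^sup>2 * D / (25 * real n) = D / (10000 * real n)" by (simp add: power2_eq_square)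
  ultimately show ?thesis by simp
qed

end

section \<open>The theorem\<close>

text \<open>For r near \<delta> l with l = log 2 (1 / p), the number of sets is at least (n / r)^r
  \<ge> (sqrt n)^r \<ge> (B n^(1/4))^r. The factor B^r = 2 powr (2 r / \<delta>) \<ge> 2 powr l
  cancels \<open>p\<close>, and n^(r/4) is at least n powr (C' ln n) because l \<ge> c ln n. The
  smallness of \<open>\<delta>\<close> takes care of p 4^r, of k r, and of r^2.\<close>

lemma sphere_regime:
  fixes c :: real
  assumes c: "c > 0"
  shows "\<exists>C>0. \<forall>\<^sub>F n in sequentially. \<forall>p. 2 powr (-20 * sqrt (real n)) \<le> p \<and> p < real n powr (- c) \<longrightarrow>
    measure_pmf.prob (random_subset (Pow {..<n}) p) {V. \<not> expanding (real n powr (C * ln (real n))) V} \<le> 10 * (1/2) ^ n"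
proof -
  define \<delta> :: real where "\<delta> = 1 / 1000000"
  define B :: real where "B = 2 powr (2 / \<delta>)"
  have B: "B > 0" by (simp add: B_def)
  \<comment> \<open>Half of \<open>C'\<close>, so that the quotient of the two powers absorbs 10000
    n.\<close>
  define C where "C = \<delta> * c / 16"
  define C' where "C' = \<delta> * c / 8"
  have C: "C > 0" "C' > 0" "C < C'" using c by (auto simp: C_def C'_def \<delta>_def)
  have e1: "\<forall>\<^sub>F n in sequentially. B * real n powr (1/4) \<le> sqrt (real n)" using B by real_asymp
  have e2: "\<forall>\<^sub>F n in sequentially. 1000000 * (12 * real n) ^ 3 \<le> real n powr (C' * ln (real n))" using C by real_asymp
  have e3: "\<forall>\<^sub>F n in sequentially. 10000 * real n * real n powr (C * ln (real n)) \<le> real n powr (C' * ln (real n))"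
    using C by real_asymp
  have e4: "\<forall>\<^sub>F n in sequentially. real n powr (- (c / 2)) \<le> 1 / 1000000" using c by real_asymp
  have e5: "\<forall>\<^sub>F n in sequentially. 2 / \<delta> \<le> c * ln (real n)" using c by real_asymp
  have e6: "\<forall>\<^sub>F n in sequentially. (100::nat) \<le> n" by (rule eventually_ge_at_top)
  have "\<forall>\<^sub>F n in sequentially. \<forall>p. 2 powr (-20 * sqrt (real n)) \<le> p \<and> p < real n powr (- c) \<longrightarrow>
    measure_pmf.prob (random_subset (Pow {..<n}) p) {V. \<not> expanding (real n powr (C * ln (real n))) V} \<le> 10 * (1/2) ^ n"
    using e1 e2 e3 e4 e5 e6
  proof eventually_elim
    case (elim n)
    note E = elim
    have n100: "real n \<ge> 100" using elim(6) by simp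
    define \<sigma> where "\<sigma> = sqrt (real n)"
    have s10: "\<sigma> \<ge> 10" unfolding \<sigma>_def using real_sqrt_le_mono[OF n100] by simp
    have sn: "real n = \<sigma> * \<sigma>" by (simp add: \<sigma>_def)
    have lnpos: "ln (real n) > 0" using n100 by simp
    show ?case
    proof (intro allI impI)
      fix p :: real assume pp: "2 powr (-20 * sqrt (real n)) \<le> p \<and> p < real n powr (- c)"
      have p0: "p > 0"
      proof -
        have "0 < (2::real) powr (-20 * sqrt (real n))" by simp
        then show ?thesis using pp by linarith
      qed
      define l where "l = - log 2 p"
      have pl: "p = 2 powr (- l)" using p0 by (simp add: l_def)
      have l2: "l \<le> 20 * \<sigma>" using pp pl by (simp add: powr_le_cancel_iff \<sigma>_def)
      have l1: "c * ln (real n) \<le> l"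
      proof -
        have "ln p \<le> ln (real n powr (- c))" using pp p0 by (intro ln_mono) auto
        then have "- (l * ln 2) \<le> - (c * ln (real n))" using n100 unfolding pl by (simp add: ln_powr)
        then have a: "c * ln (real n) \<le> l * ln 2" by simp
        have "0 < c * ln (real n)" using c lnpos by simp
        then have "0 < l * ln 2" using a by linarith
        then have lpos: "0 < l" by (rule zero_less_mult_pos2) simp
        have "l * ln 2 \<le> l * 1" using lpos ln_2_less_1 by (intro mult_left_mono) auto
        then show ?thesis using a by simp
      qed
      have ld: "2 / \<delta> \<le> l" using l1 E(5) by linarith
      have dpos: "\<delta> > 0" by (simp add: \<delta>_def)
      have ld2: "2 \<le> \<delta> * l" using ld dpos by (simp add: field_simps)
      have lpos: "l > 0" using ld by (simp add: \<delta>_def)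
      \<comment> \<open>\<delta> l \<ge> 2 ensures that rounding down loses at most half, and l
        \<le> 20 sqrt n gives r \<le> sqrt n / 50000. The choice of \<open>k\<close> makes p ^ k
        \<le> 2 powr (- 5 n) and keeps k r near 5 \<delta> n.\<close>
      define r where "r = nat \<lfloor>\<delta> * l\<rfloor>"
      define k where "k = nat \<lceil>5 * real n / l\<rceil>"
      have r1: "real r \<le> \<delta> * l" "\<delta> * l / 2 \<le> real r" using ld2 unfolding r_def by linarith+
      have r2: "1 \<le> r" using r1 ld2 by linarith
      have rs: "real r \<le> \<sigma> / 50000" using r1 mult_left_mono[OF l2, of \<delta>] by (simp add: \<delta>_def)
      have rn: "r \<le> n"
      proof -
        have "1 * \<sigma> \<le> \<sigma> * \<sigma>" using s10 by (intro mult_right_mono) auto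
        then have "real r \<le> real n" using rs s10 unfolding sn by linarith
        then show ?thesis by simp
      qed
      have k1: "5 * real n / l \<le> real k" "real k \<le> 5 * real n / l + 1"
        using lpos n100 unfolding k_def by (linarith, simp)
      define S where "S = {s. s \<subseteq> {..<n} \<and> card s = r}"
      have cS: "card S = (n choose r)" unfolding S_def using n_subsets[of "{..<n}" r] by simp
      have "S \<noteq> {}"
      proof
        assume "S = {}"
        then have "(n choose r) = 0" using cS by simp
        then show False using rn by simp
      qed
      define D where "D = p * real (card S)"
      have p1: "p \<le> 1" unfolding pl using lpos powr_mono[of "- l" 0 2] by simp
      have fourr: "(4::real) ^ r = 2 powr (2 * real r)"
      proof -
        have "(4::real) ^ r = 2 ^ (2 * r)" by (simp add: power_mult)
        then show ?thesis by (simp add: two_powr_nat)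
      qed
      have D: "real n powr (C' * ln (real n)) \<le> D"
      proof -
        have nr: "\<sigma> \<le> real n / real r"
        proof -
          have "\<sigma> * real r \<le> \<sigma> * \<sigma>" using rs s10 by (intro mult_left_mono) auto
          then show ?thesis using r2 by (simp add: sn pos_le_divide_eq)
        qed
        have lr: "l \<le> 2 / \<delta> * real r" using r1 dpos by (simp add: field_simps)
        have "(B * real n powr (1/4)) ^ r \<le> \<sigma> ^ r" using E(1) B by (intro power_mono) (auto simp: \<sigma>_def)
        also have "\<dots> \<le> (real n / real r) ^ r" using nr s10 by (intro power_mono) auto
        also have "\<dots> \<le> real (n choose r)" using binomial_ge_n_over_k_pow_k[OF rn, where 'a = real] by simp
        finally have N: "B ^ r * (real n powr (1/4)) ^ r \<le> real (card S)" by (simp add: cS power_mult_distrib)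
        have "B ^ r = 2 powr (2 / \<delta> * real r)" by (simp add: B_def powr_realpow[symmetric] powr_powr)
        also have "\<dots> \<ge> 2 powr l" using lr by (intro powr_mono) auto
        finally have pB: "1 \<le> p * B ^ r"
          unfolding pl by (simp add: powr_minus_divide field_simps)
        have "real n powr (C' * ln (real n)) \<le> real n powr (1/4 * real r)"
        proof (rule powr_mono)
          have "C' * ln (real n) = \<delta> / 8 * (c * ln (real n))" by (simp add: C'_def)
          also have "\<dots> \<le> \<delta> / 8 * l" using l1 dpos by (intro mult_left_mono) auto
          also have "\<dots> \<le> 1/4 * real r" using r1 by simp
          finally show "C' * ln (real n) \<le> 1/4 * real r" .
        qed (use n100 in simp)
        also have "\<dots> = 1 * (real n powr (1/4)) ^ r" using n100 by (simp add: powr_realpow[symmetric] powr_powr)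
        also have "\<dots> \<le> (p * B ^ r) * (real n powr (1/4)) ^ r" by (rule mult_right_mono[OF pB]) simp
        also have "\<dots> = p * (B ^ r * (real n powr (1/4)) ^ r)" by simp
        also have "\<dots> \<le> D" unfolding D_def using N p0 by (intro mult_left_mono) auto
        finally show ?thesis .
      qed
      interpret Sp: sphere_sample n p S "Pow {..<n}" "real (card S)" "p * real (card S)" "random_subset (Pow {..<n}) p" r
        by unfold_locales (use elim(6) p0 p1 \<open>S \<noteq> {}\<close> r2 rn in \<open>auto simp: S_def\<close>)
      have LD: "(12 * real n) ^ 3 \<le> D / 1000000" using E(2) D by simp
      have Dn: "2000 * real n \<le> D"
      proof -
        have "12 * real n \<le> (12 * real n) ^ 3" using power_increasing[of 1 3 "12 * real n"] n100 by simp
        then show ?thesis using LD n100 by linarith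
      qed
      have "measure_pmf.prob (random_subset (Pow {..<n}) p) {V. \<not> expanding (p * real (card S) / (10000 * real n)) V} \<le> 10 * (1/2) ^ n"
      proof (rule Sp.prob_expanding_sphere[OF _ refl])
        show "p * real (card S) \<ge> 2000 * real n" using Dn by (simp add: D_def)
        show "p ^ k \<le> (1/2) ^ (5 * n)"
        proof -
          have "p ^ k = 2 powr (- l * real k)" unfolding pl by (simp add: powr_realpow[symmetric] powr_powr)
          also have "\<dots> \<le> 2 powr (- real (5 * n))"
          proof (rule powr_mono)
            have "5 * real n \<le> real k * l" using k1 lpos by (simp add: field_simps)
            then show "- l * real k \<le> - real (5 * n)" by (simp add: mult.commute)
          qed simp
          also have "\<dots> = (1/2) ^ (5 * n)" by (simp only: powr_minus_divide two_powr_nat[symmetric] power_one_over)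
          finally show ?thesis .
        qed
        show "real k * real r \<le> real n / 100000"
        proof -
          have "real k * real r \<le> (5 * real n / l + 1) * (\<delta> * l)"
            using k1 r1 lpos n100 by (intro mult_mono) auto
          also have "\<dots> = \<delta> * (5 * real n + l)" using lpos by (simp add: field_simps)
          also have "\<dots> \<le> \<delta> * (10 * real n)"
          proof -
            have "4 * \<sigma> \<le> real n" unfolding sn using s10 by (intro mult_right_mono) auto
            then have "5 * real n + l \<le> 10 * real n" using l2 by linarith
            then show ?thesis using dpos by (intro mult_left_mono) auto
          qed
          finally show ?thesis by (simp add: \<delta>_def)
        qed
        show "p * 4 ^ r \<le> 1 / 1000000"
        proof -
          \<comment> \<open>The small \<open>\<delta>\<close> makes 4 ^ r at most 1 / sqrt p, so the
            product is at most sqrt p < n powr (- c / 2).\<close>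
          have "p * 4 ^ r = 2 powr (- l + 2 * real r)" unfolding pl fourr by (simp only: powr_add)
          also have "\<dots> \<le> 2 powr (- (l / 2))"
            using r1 lpos by (intro powr_mono) (auto simp: \<delta>_def)
          also have "\<dots> = p powr (1/2)" unfolding pl powr_powr by simp
          also have "\<dots> \<le> (real n powr (- c)) powr (1/2)" using pp p0 by (intro powr_mono2) auto
          also have "\<dots> = real n powr (- (c / 2))" by (simp add: powr_powr)
          finally show ?thesis using E(4) by linarith
        qed
        show "(real r)\<^sup>2 \<le> real n / 1000000"
        proof -
          have "(real r)\<^sup>2 \<le> (\<sigma> / 50000)\<^sup>2" using rs by (intro power_mono) auto
          also have "\<dots> = real n / 2500000000" by (simp add: sn power2_eq_square)
          finally show ?thesis using n100 by linarith
        qed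
        show "(12 * real n) ^ 3 \<le> p * real (card S) / 1000000" using LD by (simp add: D_def)
      qed
      moreover have "real n powr (C * ln (real n)) \<le> p * real (card S) / (10000 * real n)"
      proof -
        have "10000 * real n * real n powr (C * ln (real n)) \<le> D" using E(3) D by linarith
        then show ?thesis using n100 unfolding D_def by (simp add: pos_le_divide_eq mult.commute)
      qed
      then have "measure_pmf.prob (random_subset (Pow {..<n}) p) {V. \<not> expanding (real n powr (C * ln (real n))) V}
          \<le> measure_pmf.prob (random_subset (Pow {..<n}) p) {V. \<not> expanding (p * real (card S) / (10000 * real n)) V}"
        by (intro measure_pmf.finite_measure_mono) (auto dest: expanding_mono)
      ultimately show "measure_pmf.prob (random_subset (Pow {..<n}) p) {V. \<not> expanding (real n powr (C * ln (real n))) V} \<le> 10 * (1/2) ^ n"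
        by linarith
    qed
  qed
  then show ?thesis using C(1) by blast
qed

theorem theorem1p2:
  fixes c :: real
  assumes "c > 0"
  shows "\<exists>C::real. C > 0 \<and>
    (\<forall>p :: nat \<Rightarrow> real.
       (\<forall>\<^sub>F n in sequentially. p n \<in> {2 powr (-(9/10) * real n) <..< real n powr (-c)}) \<longrightarrow>
       (\<lambda>n. measure_pmf.prob (random_vertices n (p n))
              {V. polytope_expansion (convex hull V) \<ge> real n powr (C * ln (real n))})
         \<longlonglongrightarrow> 1)"
proof -
  \<comment> \<open>The sphere regime dictates the constant; the subcube regime accepts any.\<close>
  obtain C where C: "C > 0" and sph: "\<forall>\<^sub>F n in sequentially. \<forall>p. 2 powr (-20 * sqrt (real n)) \<le> p \<and> p < real n powr (- c) \<longrightarrow>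
    measure_pmf.prob (random_subset (Pow {..<n}) p) {V. \<not> expanding (real n powr (C * ln (real n))) V} \<le> 10 * (1/2) ^ n"
    using sphere_regime[OF assms] by blast
  show ?thesis
  proof (intro exI[of _ C] conjI C allI impI)
    fix p :: "nat \<Rightarrow> real"
    assume p: "\<forall>\<^sub>F n in sequentially. p n \<in> {2 powr (-(9/10) * real n) <..< real n powr (-c)}"
    let ?P = "\<lambda>n. measure_pmf.prob (random_vertices n (p n))
        {V. polytope_expansion (convex hull V) \<ge> real n powr (C * ln (real n))}"
    have low: "\<forall>\<^sub>F n in sequentially. 1 - 10 * (1/2) ^ n \<le> ?P n"
      using p sph subcube_regime[OF C]
    proof eventually_elim
      case (elim n)
      let ?K = "real n powr (C * ln (real n))"
      have bad: "measure_pmf.prob (random_subset (Pow {..<n}) (p n)) {V. \<not> expanding ?K V} \<le> 10 * (1/2) ^ n"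
      \<comment> \<open>The regime may change from one \<open>n\<close> to the next; this is
        harmless since both bounds are uniform in \<open>p\<close>.\<close>
      proof (cases "p n \<le> 2 powr (-20 * sqrt (real n))")
        case True
        then have "measure_pmf.prob (random_subset (Pow {..<n}) (p n)) {V. \<not> expanding ?K V} \<le> 8 * (1/2) ^ n"
          using elim(1,3) by simp
        also have "\<dots> \<le> 10 * (1/2) ^ n" by simp
        finally show ?thesis .
      next
        case False
        then show ?thesis using elim(1,2) by simp
      qed
      \<comment> \<open>Passing to the support supplies \<open>V \<subseteq> hypercube n\<close>,
        without which expansion of the key sets says nothing about the polytope.\<close>
      have "measure_pmf.prob (random_vertices n (p n)) (- {V. polytope_expansion (convex hull V) \<ge> ?K})
          = measure_pmf.prob (random_vertices n (p n)) (- {V. polytope_expansion (convex hull V) \<ge> ?K} \<inter> set_pmf (random_vertices n (p n)))"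
        by (rule measure_Int_set_pmf[symmetric])
      also have "\<dots> \<le> measure_pmf.prob (random_vertices n (p n)) (image keys -` {V. \<not> expanding ?K V})"
      proof (rule measure_pmf.finite_measure_mono)
        have "?K \<le> polytope_expansion (convex hull V)"
          if V: "V \<in> set_pmf (random_vertices n (p n))" and ex: "expanding ?K (keys ` V)" for V
        proof (rule polytope_expansion_ge)
          show VH: "V \<subseteq> hypercube n" using V by (auto simp: random_vertices_def)
          have "inj_on keys V" using inj_on_keys VH inj_on_subset by blast
          then show "2 \<le> card V" using ex by (simp add: expanding_def card_image)
          show "?K * real (card U) \<le> real (card {(a, b). a \<in> U \<and> b \<in> keys ` V - U \<and> cube_adj (keys ` V) a b})"
            if "U \<subseteq> keys ` V" "2 * card U \<le> card (keys ` V)" for U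
            using ex that unfolding expanding_def by blast
        qed
        then show "- {V. polytope_expansion (convex hull V) \<ge> ?K} \<inter> set_pmf (random_vertices n (p n))
            \<subseteq> image keys -` {V. \<not> expanding ?K V}" by auto
      qed simp
      also have "\<dots> = measure_pmf.prob (random_subset (Pow {..<n}) (p n)) {V. \<not> expanding ?K V}"
        unfolding map_keys_random_vertices[symmetric] by (rule measure_map_pmf[symmetric])
      finally show ?case
        using bad measure_pmf.prob_compl[of "{V. polytope_expansion (convex hull V) \<ge> ?K}" "random_vertices n (p n)"]
        by (simp add: Compl_eq_Diff_UNIV)
    qed
    have up: "\<forall>\<^sub>F n in sequentially. ?P n \<le> 1" by simp
    have lim: "(\<lambda>n. 1 - 10 * (1/2 :: real) ^ n) \<longlonglongrightarrow> 1" by real_asymp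
    show "?P \<longlonglongrightarrow> 1"
      by (rule tendsto_sandwich[OF low up lim tendsto_const])
  qed
qed

end
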